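(* For every $c\in\mathbb{R}$, the space form $F(c)$, equipped with the torus action $\Phi_c:\mathbb{T}\times F(c)\to F(c)$, is a regular torification of the dually flat manifold $(M_c,h_c,\nabla)$.
   Context: Models $M_c$. For $c\in\mathbb{R}$, $M_c=\mathbb{R}$ if $c\ge0$ and $M_c=(-\infty,0)$ if $c<0$; with $\theta$ the linear coordinate, $\nabla$ is the standard flat connection on $M_c\subseteq\mathbb{R}$ and $h_c$ is the metric with $h_c(\theta)=h_c(\partial_\theta,\partial_\theta)$ equal to $\frac{1}{c\cosh^2(\theta)}$ if $c>0$, $e^{\theta}$ if $c=0$, and $\frac{-1}{c\sinh^2(\theta)}$ if $c<0$. $(M_c,h_c,\nabla)$ is a dually flat manifold. Space forms $F(c)$. $F(c)=\mathbb{D}(c)$ if $c<0$, $F(c)=\mathbb{C}$ with its standard flat (Euclidean) metric if $c=0$, and $F(c)=\mathbb{P}_1(c)$ if $c>0$. Here $\mathbb{D}(c)=\{z\in\mathbb{C}\mid|z|<1\}$ with the metric $ds^2=-4c^{-1}(dx^2+dy^2)(1-x^2-y^2)^{-2}$, and $\mathbb{P}_1(c)$ is the complex projective line with the Fubini–Study metric normalized to have holomorphic sectional curvature $c$. With $\mathbb{T}=\mathbb{R}/\mathbb{Z}$, the action is $\Phi_c([t],z)=e^{2i\pi t}z$ if $c\le0$ and $\Phi_c([t],[z_0,z_1])=[e^{2i\pi t}z_0,z_1]$ if $c>0$. Dually flat manifolds. A dually flat manifold is a triple $(M,h,\nabla)$ where $h$ is a Riemannian metric on the manifold $M$ and $\nabla$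 is an affine connection such that both $\nabla$ and its dual connection $\nabla^*$, defined by $X(h(Y,Z))=h(\nabla_XY,Z)+h(Y,\nabla^*_XZ)$, are flat (zero curvature and torsion). Coordinates $(x_1,\dots,x_n)$ are affine if $\nabla_{\partial_i}\partial_j=0$ for all $i,j$. Dombrowski's construction. If $(x_1,\dots,x_n)$ are affine coordinates on $U\subseteq M$, let $(q,r)$ be the coordinates on $\pi^{-1}(U)\subseteq TM$ ($\pi:TM\to M$ the projection) given by $(q,r)(\sum_j a_j\frac{\partial}{\partial x_j}|_p)=(x_1(p),\dots,x_n(p),a_1,\dots,a_n)$. The functions $z_j=q_j+ir_j$ form holomorphic charts making $TM$ a complex manifold, and the metric with matrix $\begin{bmatrix} h(x)&0\\0&h(x)\end{bmatrix}$ in the coordinates $(q,r)$, where $h(x)$ is the matrix of $h$ in the coordinates $x$, is a Kähler metric on $TM$. $TM$ is always given this Kähler structure. Torification. Let $(M,h,\nabla)$ be connected, $n=\dim M$, $\mathbb{T}^n=\mathbb{R}^n/\mathbb{Z}^n$. A parallel lattice is a set $L=\{k_1X_1(p)+\dots+k_nX_n(p)\mid k_i\in\mathbb{Z},p\in M\}\subset TM$, where $X=(X_1,\dots,X_n)$ is a frame of $\nabla$-parallel vector fields on $M$ (a basis of $T_pM$ at every $p$); $X$ is called a generator of $L$. Let $\Gamma(L)\cong\mathbb{Z}^n$ be the group of transformations $u\mapsto u+k_1X_1+\dots+k_nX_n$ of $TM$, $k_i\in\mathbb{Z}$; it acts freely, properly, and by holomorphic isometries, so $M_L=TM/\Gamma(L)$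 is a Kähler manifold, with quotient map $q_L:TM\to M_L$ and torus action $\Phi_X([t],q_L(u))=q_L(u+t_1X_1+\dots+t_nX_n)$. Let $N$ be a connected Kähler manifold of complex dimension $n$ with an effective, holomorphic and isometric action $\Phi:\mathbb{T}^n\times N\to N$, and let $N^\circ$ be the set of points where $\Phi$ is free. $N$ (or $\Phi$) is a torification of $M$ if there exist a parallel lattice $L\subset TM$, a generator $X$ of $L$, and a holomorphic isometric diffeomorphism $F:M_L\to N^\circ$ with $F\circ(\Phi_X)_a=\Phi_a\circ F$ for all $a\in\mathbb{T}^n$. A torification is regular if $N$ is connected, simply connected, complete and its Kähler metric is real analytic. *)

theory Defs
  imports "HOL-Analysis.Analysis"
begin

section \<open>Regularity of maps between Euclidean spaces\<close>

text \<open>All predicates in this section are meant for open sets \<open>S\<close>.\<close>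

primrec Ck_on :: "nat \<Rightarrow> ('a::euclidean_space \<Rightarrow> 'b::euclidean_space) \<Rightarrow> 'a set \<Rightarrow> bool" where
  "Ck_on 0 = (\<lambda>f S. continuous_on S f)"
| "Ck_on (Suc k) = (\<lambda>f S. (\<forall>x\<in>S. f differentiable (at x)) \<and>
     (\<forall>v. Ck_on k (\<lambda>x. frechet_derivative f (at x) v) S))"

definition smooth_on :: "('a::euclidean_space \<Rightarrow> 'b::euclidean_space) \<Rightarrow> 'a set \<Rightarrow> bool" where
  "smooth_on f S \<longleftrightarrow> (\<forall>k. Ck_on k f S)"

text \<open>Local expansion in a multivariate power series; the multi-indices are the (extensional)
  functions from the standard basis to \<open>nat\<close>.\<close>

definition real_analytic_on :: "('a::euclidean_space \<Rightarrow> real) \<Rightarrow> 'a set \<Rightarrow> bool" where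
  "real_analytic_on f S \<longleftrightarrow> (\<forall>x\<in>S. \<exists>r>0. \<exists>a :: ('a \<Rightarrow> nat) \<Rightarrow> real. \<forall>y\<in>ball x r.
     ((\<lambda>\<alpha>. a \<alpha> * (\<Prod>b\<in>Basis. ((y - x) \<bullet> b) ^ \<alpha> b)) has_sum f y) (Basis \<rightarrow>\<^sub>E UNIV))"

text \<open>Holomorphic in several variables: the real derivative is given by a complex matrix.\<close>

definition cholomorphic_on :: "(complex^'n \<Rightarrow> complex^'m) \<Rightarrow> (complex^'n) set \<Rightarrow> bool" where
  "cholomorphic_on f S \<longleftrightarrow>
     (\<forall>z\<in>S. \<exists>A::complex^'n^'m. (f has_derivative (\<lambda>v. A *v v)) (at z))"

section \<open>Manifolds given by atlases\<close>

text \<open>The atlas is indexed by \<open>charts\<close>: the chart \<open>i\<close> is the map \<open>cmap i\<close> on the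
  coordinate domain \<open>cdom i\<close>. A tensor is given by its components in the charts of the atlas:
  \<open>metric i z v w\<close> is the metric at the point with coordinates \<open>z\<close> in the chart \<open>i\<close>, evaluated
  on the tangent vectors with components \<open>v\<close> and \<open>w\<close> in that chart.\<close>

record ('p, 'i, 'e) riemannian =
  mtop :: "'p topology"
  charts :: "'i set"
  cdom :: "'i \<Rightarrow> 'p set"
  cmap :: "'i \<Rightarrow> 'p \<Rightarrow> 'e"
  metric :: "'i \<Rightarrow> 'e \<Rightarrow> 'e \<Rightarrow> 'e \<Rightarrow> real"

abbreviation points :: "('p, 'i, 'e, 'z) riemannian_scheme \<Rightarrow> 'p set" where
  "points M \<equiv> topspace (mtop M)"

definition cimage :: "('p, 'i, 'e, 'z) riemannian_scheme \<Rightarrow> 'i \<Rightarrow> 'e set" where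
  "cimage M i = cmap M i ` cdom M i"

definition cinv :: "('p, 'i, 'e, 'z) riemannian_scheme \<Rightarrow> 'i \<Rightarrow> 'e \<Rightarrow> 'p" where
  "cinv M i = inv_into (cdom M i) (cmap M i)"

definition chart_at :: "('p, 'i, 'e, 'z) riemannian_scheme \<Rightarrow> 'p \<Rightarrow> 'i" where
  "chart_at M p = (SOME i. i \<in> charts M \<and> p \<in> cdom M i)"

definition transition :: "('p, 'i, 'e, 'z) riemannian_scheme \<Rightarrow> 'i \<Rightarrow> 'i \<Rightarrow> 'e \<Rightarrow> 'e" where
  "transition M i j = cmap M j \<circ> cinv M i"

definition overlap :: "('p, 'i, 'e, 'z) riemannian_scheme \<Rightarrow> 'i \<Rightarrow> 'i \<Rightarrow> 'e set" where
  "overlap M i j = cmap M i ` (cdom M i \<inter> cdom M j)"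

definition second_countable_top :: "'p topology \<Rightarrow> bool" where
  "second_countable_top X \<longleftrightarrow> (\<exists>B. countable B \<and> (\<forall>V\<in>B. openin X V) \<and>
     (\<forall>U. openin X U \<longrightarrow> (\<exists>C\<subseteq>B. U = \<Union>C)))"

definition topological_manifold ::
  "('p, 'i, 'e::euclidean_space, 'z) riemannian_scheme \<Rightarrow> bool" where
  "topological_manifold M \<longleftrightarrow>
     Hausdorff_space (mtop M) \<and> second_countable_top (mtop M) \<and>
     points M = (\<Union>i\<in>charts M. cdom M i) \<and>
     (\<forall>i\<in>charts M. openin (mtop M) (cdom M i) \<and> open (cimage M i) \<and>
        homeomorphic_map (subtopology (mtop M) (cdom M i)) (top_of_set (cimage M i)) (cmap M i))"

definition smooth_manifold ::
  "('p, 'i, 'e::euclidean_space, 'z) riemannian_scheme \<Rightarrow> bool" where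
  "smooth_manifold M \<longleftrightarrow> topological_manifold M \<and>
     (\<forall>i\<in>charts M. \<forall>j\<in>charts M. smooth_on (transition M i j) (overlap M i j))"

definition complex_manifold :: "('p, 'i, complex^'n, 'z) riemannian_scheme \<Rightarrow> bool" where
  "complex_manifold M \<longleftrightarrow> topological_manifold M \<and>
     (\<forall>i\<in>charts M. \<forall>j\<in>charts M. cholomorphic_on (transition M i j) (overlap M i j))"

definition riemannian_metric ::
  "('p, 'i, 'e::euclidean_space, 'z) riemannian_scheme \<Rightarrow> bool" where
  "riemannian_metric M \<longleftrightarrow>
     (\<forall>i\<in>charts M. \<forall>z\<in>cimage M i. bilinear (metric M i z) \<and>
        (\<forall>v w. metric M i z v w = metric M i z w v) \<and>
        (\<forall>v. v \<noteq> 0 \<longrightarrow> 0 < metric M i z v v)) \<and>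
     (\<forall>i\<in>charts M. \<forall>v w. smooth_on (\<lambda>z. metric M i z v w) (cimage M i)) \<and>
     (\<forall>i\<in>charts M. \<forall>j\<in>charts M. \<forall>z\<in>overlap M i j. \<forall>v w.
        metric M j (transition M i j z)
          (frechet_derivative (transition M i j) (at z) v)
          (frechet_derivative (transition M i j) (at z) w) = metric M i z v w)"

section \<open>Kaehler manifolds and their maps\<close>

definition kaehler_form ::
  "('p, 'i, complex^'n, 'z) riemannian_scheme \<Rightarrow> 'i \<Rightarrow> complex^'n \<Rightarrow> complex^'n \<Rightarrow> complex^'n \<Rightarrow> real"
  where "kaehler_form N i z v w = metric N i z (\<i> *s v) w"

text \<open>The last condition is closedness of the Kaehler form, evaluated on the
  constant vector fields \<open>u\<close>, \<open>v\<close>, \<open>w\<close> of a chart.\<close>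

definition kaehler_manifold :: "('p, 'i, complex^'n, 'z) riemannian_scheme \<Rightarrow> bool" where
  "kaehler_manifold N \<longleftrightarrow> complex_manifold N \<and> riemannian_metric N \<and>
     (\<forall>i\<in>charts N. \<forall>z\<in>cimage N i. \<forall>v w.
        metric N i z (\<i> *s v) (\<i> *s w) = metric N i z v w) \<and>
     (\<forall>i\<in>charts N. \<forall>z\<in>cimage N i. \<forall>u v w.
        frechet_derivative (\<lambda>y. kaehler_form N i y v w) (at z) u +
        frechet_derivative (\<lambda>y. kaehler_form N i y w u) (at z) v +
        frechet_derivative (\<lambda>y. kaehler_form N i y u v) (at z) w = 0)"

definition local_rep ::
  "('p, 'i, 'e, 'z) riemannian_scheme \<Rightarrow> ('q, 'j, 'f, 'y) riemannian_scheme \<Rightarrow> ('p \<Rightarrow> 'q) \<Rightarrow>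
    'i \<Rightarrow> 'j \<Rightarrow> 'e \<Rightarrow> 'f" where
  "local_rep M N f i j = cmap N j \<circ> f \<circ> cinv M i"

definition rep_domain ::
  "('p, 'i, 'e, 'z) riemannian_scheme \<Rightarrow> ('q, 'j, 'f, 'y) riemannian_scheme \<Rightarrow> ('p \<Rightarrow> 'q) \<Rightarrow>
    'i \<Rightarrow> 'j \<Rightarrow> 'e set" where
  "rep_domain M N f i j = cmap M i ` {p \<in> cdom M i. f p \<in> cdom N j}"

definition holomorphic_map ::
  "('p, 'i, complex^'n, 'z) riemannian_scheme \<Rightarrow> ('q, 'j, complex^'m, 'y) riemannian_scheme \<Rightarrow>
    ('p \<Rightarrow> 'q) \<Rightarrow> bool" where
  "holomorphic_map M N f \<longleftrightarrow> continuous_map (mtop M) (mtop N) f \<and>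
     (\<forall>i\<in>charts M. \<forall>j\<in>charts N. cholomorphic_on (local_rep M N f i j) (rep_domain M N f i j))"

definition isometric_map ::
  "('p, 'i, 'e::euclidean_space, 'z) riemannian_scheme \<Rightarrow>
    ('q, 'j, 'f::euclidean_space, 'y) riemannian_scheme \<Rightarrow> ('p \<Rightarrow> 'q) \<Rightarrow> bool" where
  "isometric_map M N f \<longleftrightarrow>
     (\<forall>i\<in>charts M. \<forall>j\<in>charts N. \<forall>z\<in>rep_domain M N f i j. \<forall>v w.
        metric N j (local_rep M N f i j z)
          (frechet_derivative (local_rep M N f i j) (at z) v)
          (frechet_derivative (local_rep M N f i j) (at z) w) = metric M i z v w)"

definition holomorphic_isometric_diffeo ::
  "('p, 'i, complex^'n, 'z) riemannian_scheme \<Rightarrow> ('q, 'j, complex^'n, 'y) riemannian_scheme \<Rightarrow>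
    ('p \<Rightarrow> 'q) \<Rightarrow> bool" where
  "holomorphic_isometric_diffeo M N f \<longleftrightarrow>
     bij_betw f (points M) (points N) \<and> holomorphic_map M N f \<and>
     holomorphic_map N M (inv_into (points M) f) \<and> isometric_map M N f"

definition open_submanifold :: "('p, 'i, 'e) riemannian \<Rightarrow> 'p set \<Rightarrow> ('p, 'i, 'e) riemannian" where
  "open_submanifold N S =
     N\<lparr>mtop := subtopology (mtop N) S, cdom := (\<lambda>i. cdom N i \<inter> S)\<rparr>"

section \<open>Riemannian distance, completeness, simple connectedness\<close>

definition C1_curve_on ::
  "('p, 'i, 'e::euclidean_space, 'z) riemannian_scheme \<Rightarrow> real \<Rightarrow> real \<Rightarrow> (real \<Rightarrow> 'p) \<Rightarrow> bool" where
  "C1_curve_on N a b \<gamma> \<longleftrightarrow>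
     (\<forall>i\<in>charts N. \<exists>D. continuous_on {t\<in>{a..b}. \<gamma> t \<in> cdom N i} D \<and>
        (\<forall>t\<in>{t\<in>{a..b}. \<gamma> t \<in> cdom N i}.
           ((cmap N i \<circ> \<gamma>) has_vector_derivative D t) (at t within {a..b})))"

definition piecewise_C1_curve ::
  "('p, 'i, 'e::euclidean_space, 'z) riemannian_scheme \<Rightarrow> (real \<Rightarrow> 'p) \<Rightarrow> bool" where
  "piecewise_C1_curve N \<gamma> \<longleftrightarrow> pathin (mtop N) \<gamma> \<and>
     (\<exists>S. finite S \<and> (\<forall>a b. 0 \<le> a \<and> a < b \<and> b \<le> 1 \<and> {a<..<b} \<inter> S = {} \<longrightarrow>
        C1_curve_on N a b \<gamma>))"

definition speed ::
  "('p, 'i, 'e::euclidean_space, 'z) riemannian_scheme \<Rightarrow> (real \<Rightarrow> 'p) \<Rightarrow> real \<Rightarrow> real" where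
  "speed N \<gamma> t = (let i = chart_at N (\<gamma> t); v = vector_derivative (cmap N i \<circ> \<gamma>) (at t)
     in sqrt (metric N i (cmap N i (\<gamma> t)) v v))"

definition riemannian_dist ::
  "('p, 'i, 'e::euclidean_space, 'z) riemannian_scheme \<Rightarrow> 'p \<Rightarrow> 'p \<Rightarrow> real" where
  "riemannian_dist N p q =
     Inf {integral {0..1} (speed N \<gamma>) | \<gamma>. piecewise_C1_curve N \<gamma> \<and> \<gamma> 0 = p \<and> \<gamma> 1 = q}"

text \<open>Metric completeness; by Hopf--Rinow this agrees with geodesic completeness for
  connected manifolds.\<close>

definition complete_manifold ::
  "('p, 'i, 'e::euclidean_space, 'z) riemannian_scheme \<Rightarrow> bool" where
  "complete_manifold N \<longleftrightarrow>
     (\<forall>\<sigma>. range \<sigma> \<subseteq> points N \<and>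
        (\<forall>e>0. \<exists>K::nat. \<forall>m\<ge>K. \<forall>n\<ge>K. riemannian_dist N (\<sigma> m) (\<sigma> n) < e) \<longrightarrow>
        (\<exists>l\<in>points N. (\<lambda>n. riemannian_dist N (\<sigma> n) l) \<longlonglongrightarrow> 0))"

text \<open>The analogue for abstract topologies of the library predicate \<open>simply_connected\<close>:
  any two loops are freely homotopic (which includes path-connectedness).\<close>

definition simply_connected_top :: "'p topology \<Rightarrow> bool" where
  "simply_connected_top X \<longleftrightarrow>
     (\<forall>g h. pathin X g \<and> g 1 = g 0 \<and> pathin X h \<and> h 1 = h 0 \<longrightarrow>
        homotopic_with (\<lambda>r. r 1 = r 0) (top_of_set {0..1::real}) X g h)"

definition real_analytic_metric ::
  "('p, 'i, 'e::euclidean_space, 'z) riemannian_scheme \<Rightarrow> bool" where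
  "real_analytic_metric N \<longleftrightarrow>
     (\<forall>i\<in>charts N. \<forall>v w. real_analytic_on (\<lambda>z. metric N i z v w) (cimage N i))"

section \<open>Dually flat manifolds\<close>

text \<open>An affine connection is given by its Christoffel symbols: \<open>\<nabla>\<^sub>u V\<close> has in the chart \<open>i\<close> the
  components \<open>D\<^sub>u V + \<Gamma> i x u V\<close>.\<close>

type_synonym ('i, 'n) christoffel = "'i \<Rightarrow> real^'n \<Rightarrow> real^'n \<Rightarrow> real^'n \<Rightarrow> real^'n"

record ('m, 'i, 'n) affine_riemannian = "('m, 'i, real^('n::finite)) riemannian" +
  conn :: "('i, 'n) christoffel"

definition second_derivative ::
  "('a::real_normed_vector \<Rightarrow> 'b::real_normed_vector) \<Rightarrow> 'a \<Rightarrow> 'a \<Rightarrow> 'a \<Rightarrow> 'b" where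
  "second_derivative f x u v = frechet_derivative (\<lambda>y. frechet_derivative f (at y) v) (at x) u"

definition affine_connection ::
  "('m, 'i, real^'n, 'z) riemannian_scheme \<Rightarrow> ('i, 'n) christoffel \<Rightarrow> bool" where
  "affine_connection M \<Gamma> \<longleftrightarrow>
     (\<forall>i\<in>charts M. \<forall>x\<in>cimage M i. bilinear (\<Gamma> i x)) \<and>
     (\<forall>i\<in>charts M. \<forall>u v. smooth_on (\<lambda>x. \<Gamma> i x u v) (cimage M i)) \<and>
     (\<forall>i\<in>charts M. \<forall>j\<in>charts M. \<forall>x\<in>overlap M i j. \<forall>u v.
        (let \<tau> = transition M i j; D = frechet_derivative \<tau> (at x) in
          D (\<Gamma> i x u v) = second_derivative \<tau> x u v + \<Gamma> j (\<tau> x) (D u) (D v)))"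

text \<open>Vanishing torsion and vanishing curvature \<open>R(u,v)w\<close>, evaluated on constant vector fields
  of a chart.\<close>

definition flat_connection ::
  "('m, 'i, real^'n, 'z) riemannian_scheme \<Rightarrow> ('i, 'n) christoffel \<Rightarrow> bool" where
  "flat_connection M \<Gamma> \<longleftrightarrow>
     (\<forall>i\<in>charts M. \<forall>x\<in>cimage M i.
        (\<forall>u v. \<Gamma> i x u v = \<Gamma> i x v u) \<and>
        (\<forall>u v w.
           (frechet_derivative (\<lambda>y. \<Gamma> i y v w) (at x) u + \<Gamma> i x u (\<Gamma> i x v w)) -
           (frechet_derivative (\<lambda>y. \<Gamma> i y u w) (at x) v + \<Gamma> i x v (\<Gamma> i x u w)) = 0))"

text \<open>\<open>X(h(Y,Z)) = h(\<nabla>\<^sub>X Y, Z) + h(Y, \<nabla>'\<^sub>X Z)\<close> for the constant fields \<open>u\<close>, \<open>v\<close>, \<open>w\<close> of a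
  chart; by the Leibniz rule this gives the identity for all vector fields.\<close>

definition dual_connections ::
  "('m, 'i, real^'n, 'z) riemannian_scheme \<Rightarrow> ('i, 'n) christoffel \<Rightarrow> ('i, 'n) christoffel \<Rightarrow> bool"
  where
  "dual_connections M \<Gamma> \<Gamma>' \<longleftrightarrow>
     (\<forall>i\<in>charts M. \<forall>x\<in>cimage M i. \<forall>u v w.
        frechet_derivative (\<lambda>y. metric M i y v w) (at x) u =
          metric M i x (\<Gamma> i x u v) w + metric M i x v (\<Gamma>' i x u w))"

definition dually_flat_manifold :: "('m, 'i, 'n::finite) affine_riemannian \<Rightarrow> bool" where
  "dually_flat_manifold M \<longleftrightarrow>
     smooth_manifold M \<and> riemannian_metric M \<and>
     affine_connection M (conn M) \<and> flat_connection M (conn M) \<and>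
     (\<exists>\<Gamma>'. affine_connection M \<Gamma>' \<and> dual_connections M (conn M) \<Gamma>' \<and> flat_connection M \<Gamma>')"

section \<open>Affine coordinates, tangent bundle and Dombrowski's construction\<close>

text \<open>Affine coordinates \<open>(U, x)\<close> need not belong to the given atlas, only be compatible with it.
  The last clause says that the Christoffel symbols of the connection with respect to \<open>(U, x)\<close>
  vanish.\<close>

definition affine_coordinates ::
  "('m, 'i, 'n::finite) affine_riemannian \<Rightarrow> ('m set \<times> ('m \<Rightarrow> real^'n)) set" where
  "affine_coordinates M = {(U, x).
     openin (mtop M) U \<and> inj_on x U \<and> open (x ` U) \<and>
     (\<forall>i\<in>charts M.
        smooth_on (x \<circ> cinv M i) (cmap M i ` (U \<inter> cdom M i)) \<and>
        smooth_on (cmap M i \<circ> inv_into U x) (x ` (U \<inter> cdom M i)) \<and>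
        (\<forall>y\<in>x ` (U \<inter> cdom M i). \<forall>u v.
           (let \<sigma> = cmap M i \<circ> inv_into U x; D = frechet_derivative \<sigma> (at y) in
             second_derivative \<sigma> y u v + conn M i (\<sigma> y) (D u) (D v) = 0)))}"

text \<open>A tangent vector at \<open>p\<close> is the family of its components in the charts around \<open>p\<close>
  (set to \<open>0\<close> at all other indices).\<close>

definition tangent_space ::
  "('m, 'i, real^'n, 'z) riemannian_scheme \<Rightarrow> 'm \<Rightarrow> ('i \<Rightarrow> real^'n) set" where
  "tangent_space M p = {v.
     (\<forall>i. \<not> (i \<in> charts M \<and> p \<in> cdom M i) \<longrightarrow> v i = 0) \<and>
     (\<forall>i\<in>charts M. \<forall>j\<in>charts M. p \<in> cdom M i \<inter> cdom M j \<longrightarrow>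
        v j = frechet_derivative (transition M i j) (at (cmap M i p)) (v i))}"

definition tangent_bundle ::
  "('m, 'i, real^'n, 'z) riemannian_scheme \<Rightarrow> ('m \<times> ('i \<Rightarrow> real^'n)) set" where
  "tangent_bundle M = {(p, v). p \<in> points M \<and> v \<in> tangent_space M p}"

definition tangent_components ::
  "('m, 'i, real^'n, 'z) riemannian_scheme \<Rightarrow> ('m \<Rightarrow> real^'n) \<Rightarrow> 'm \<Rightarrow> ('i \<Rightarrow> real^'n) \<Rightarrow> real^'n"
  where
  "tangent_components M x p v = (let i = chart_at M p in
     frechet_derivative (x \<circ> cinv M i) (at (cmap M i p)) (v i))"

definition metric_in_coordinates ::
  "('m, 'i, real^'n, 'z) riemannian_scheme \<Rightarrow> 'm set \<Rightarrow> ('m \<Rightarrow> real^'n) \<Rightarrow>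
    real^'n \<Rightarrow> real^'n \<Rightarrow> real^'n \<Rightarrow> real" where
  "metric_in_coordinates M U x y a b =
     (let p = inv_into U x y; i = chart_at M p;
          D = frechet_derivative (cmap M i \<circ> inv_into U x) (at y)
      in metric M i (cmap M i p) (D a) (D b))"

definition tangent_dom ::
  "('m, 'i, 'n::finite) affine_riemannian \<Rightarrow> 'm set \<times> ('m \<Rightarrow> real^'n) \<Rightarrow>
    ('m \<times> ('i \<Rightarrow> real^'n)) set" where
  "tangent_dom M = (\<lambda>(U, x). {(p, v) \<in> tangent_bundle M. p \<in> U})"

text \<open>The holomorphic chart \<open>z\<^sub>k = q\<^sub>k + i r\<^sub>k\<close> of the tangent bundle defined by affine
  coordinates \<open>(U, x)\<close>.\<close>

definition tangent_chart ::
  "('m, 'i, 'n::finite) affine_riemannian \<Rightarrow> 'm set \<times> ('m \<Rightarrow> real^'n) \<Rightarrow>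
    'm \<times> ('i \<Rightarrow> real^'n) \<Rightarrow> complex^'n" where
  "tangent_chart M = (\<lambda>(U, x) (p, v).
     \<chi> k. Complex (x p $ k) (tangent_components M x p v $ k))"

definition re_vec :: "complex^'n \<Rightarrow> real^'n" where
  "re_vec z = (\<chi> k. Re (z $ k))"

definition im_vec :: "complex^'n \<Rightarrow> real^'n" where
  "im_vec z = (\<chi> k. Im (z $ k))"

text \<open>The topology of the tangent bundle is the one for which the charts above are
  homeomorphisms from open subsets onto open subsets.\<close>

definition dombrowski ::
  "('m, 'i, 'n::finite) affine_riemannian \<Rightarrow>
    ('m \<times> ('i \<Rightarrow> real^'n), 'm set \<times> ('m \<Rightarrow> real^'n), complex^'n) riemannian" where
  "dombrowski M =
     \<lparr>mtop = topology (\<lambda>W. W \<subseteq> tangent_bundle M \<and>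
        (\<forall>\<xi>\<in>affine_coordinates M. open (tangent_chart M \<xi> ` (W \<inter> tangent_dom M \<xi>)))),
      charts = affine_coordinates M,
      cdom = tangent_dom M,
      cmap = tangent_chart M,
      metric = (\<lambda>(U, x) z v w.
        metric_in_coordinates M U x (re_vec z) (re_vec v) (re_vec w) +
        metric_in_coordinates M U x (re_vec z) (im_vec v) (im_vec w))\<rparr>"

section \<open>Parallel lattices and the quotient of the tangent bundle\<close>

definition parallel_field ::
  "('m, 'i, 'n::finite) affine_riemannian \<Rightarrow> ('m \<Rightarrow> 'i \<Rightarrow> real^'n) \<Rightarrow> bool" where
  "parallel_field M Y \<longleftrightarrow>
     (\<forall>p\<in>points M. Y p \<in> tangent_space M p) \<and>
     (\<forall>i\<in>charts M. smooth_on (\<lambda>x. Y (cinv M i x) i) (cimage M i) \<and>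
        (\<forall>x\<in>cimage M i. \<forall>u.
           frechet_derivative (\<lambda>y. Y (cinv M i y) i) (at x) u
             + conn M i x u (Y (cinv M i x) i) = 0))"

definition parallel_frame ::
  "('m, 'i, 'n::finite) affine_riemannian \<Rightarrow> ('n \<Rightarrow> 'm \<Rightarrow> 'i \<Rightarrow> real^'n) \<Rightarrow> bool" where
  "parallel_frame M X \<longleftrightarrow>
     (\<forall>k. parallel_field M (X k)) \<and>
     (\<forall>p\<in>points M. \<forall>v\<in>tangent_space M p. \<exists>!a::real^'n. v = (\<lambda>i. \<Sum>k\<in>UNIV. a $ k *\<^sub>R X k p i))"

definition generated_lattice ::
  "('m, 'i, 'n::finite) affine_riemannian \<Rightarrow> ('n \<Rightarrow> 'm \<Rightarrow> 'i \<Rightarrow> real^'n) \<Rightarrow>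
    ('m \<times> ('i \<Rightarrow> real^'n)) set" where
  "generated_lattice M X =
     {(p, \<lambda>i. \<Sum>k\<in>UNIV. of_int (m k) *\<^sub>R X k p i) | p (m :: 'n \<Rightarrow> int). p \<in> points M}"

definition lattice_generator ::
  "('m, 'i, 'n::finite) affine_riemannian \<Rightarrow> ('m \<times> ('i \<Rightarrow> real^'n)) set \<Rightarrow>
    ('n \<Rightarrow> 'm \<Rightarrow> 'i \<Rightarrow> real^'n) \<Rightarrow> bool" where
  "lattice_generator M L X \<longleftrightarrow> parallel_frame M X \<and> L = generated_lattice M X"

text \<open>The points of \<open>TM/\<Gamma>(L)\<close> are the orbits; the orbit of a tangent vector \<open>v\<close> at \<open>p\<close> is the coset
  of the lattice at \<open>p\<close>.\<close>

definition lattice_orbit ::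
  "('m \<times> ('i \<Rightarrow> real^'n)) set \<Rightarrow> 'm \<times> ('i \<Rightarrow> real^'n) \<Rightarrow> ('m \<times> ('i \<Rightarrow> real^'n)) set" where
  "lattice_orbit L = (\<lambda>(p, v). {(p, \<lambda>i. v i + l i) | l. (p, l) \<in> L})"

definition quotient_top :: "'p topology \<Rightarrow> ('p \<Rightarrow> 'q) \<Rightarrow> 'q topology" where
  "quotient_top X q =
     topology (\<lambda>U. U \<subseteq> q ` topspace X \<and> openin X {x \<in> topspace X. q x \<in> U})"

text \<open>The structure on the image of a covering map \<open>q\<close> for which \<open>q\<close> is a local isometry
  preserving the atlases: a chart is obtained from a chart \<open>i\<close> upstairs and an open subset \<open>V\<close> of
  its domain on which \<open>q\<close> is injective.\<close>

definition quotient_manifold ::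
  "('p, 'i, 'e) riemannian \<Rightarrow> ('p \<Rightarrow> 'q) \<Rightarrow> ('q, 'i \<times> 'p set, 'e) riemannian" where
  "quotient_manifold T q =
     \<lparr>mtop = quotient_top (mtop T) q,
      charts = {(i, V). i \<in> charts T \<and> openin (mtop T) V \<and> V \<subseteq> cdom T i \<and> inj_on q V},
      cdom = (\<lambda>(i, V). q ` V),
      cmap = (\<lambda>(i, V). cmap T i \<circ> inv_into V q),
      metric = (\<lambda>(i, V). metric T i)\<rparr>"

section \<open>Torus actions and torifications\<close>

quotient_type ('n) torus = "real^('n::finite)" / "\<lambda>s t. \<forall>k. s $ k - t $ k \<in> \<int>"
proof (rule equivpI)
  show "reflp (\<lambda>s t :: real^'n. \<forall>k. s $ k - t $ k \<in> \<int>)"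
    by (simp add: reflp_def)
  show "symp (\<lambda>s t :: real^'n. \<forall>k. s $ k - t $ k \<in> \<int>)"
  proof (rule sympI, rule allI)
    fix s t :: "real^'n" and k
    assume "\<forall>k. s $ k - t $ k \<in> \<int>"
    then have "- (s $ k - t $ k) \<in> \<int>" by (blast intro: Ints_minus)
    then show "t $ k - s $ k \<in> \<int>" by simp
  qed
  show "transp (\<lambda>s t :: real^'n. \<forall>k. s $ k - t $ k \<in> \<int>)"
  proof (rule transpI, rule allI)
    fix r s t :: "real^'n" and k
    assume "\<forall>k. r $ k - s $ k \<in> \<int>" "\<forall>k. s $ k - t $ k \<in> \<int>"
    then have "(r $ k - s $ k) + (s $ k - t $ k) \<in> \<int>" by (blast intro: Ints_add)
    then show "r $ k - t $ k \<in> \<int>" by simp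
  qed
qed

instantiation torus :: (finite) ab_group_add
begin

lift_definition zero_torus :: "'a torus" is 0 .

lift_definition plus_torus :: "'a torus \<Rightarrow> 'a torus \<Rightarrow> 'a torus" is "(+)"
  by (simp add: add_diff_add)

lift_definition uminus_torus :: "'a torus \<Rightarrow> 'a torus" is uminus
proof -
  fix s t :: "real^'a" and k
  assume "\<And>k. s $ k - t $ k \<in> \<int>"
  then have "- (s $ k - t $ k) \<in> \<int>" by (rule Ints_minus)
  then show "(- s) $ k - (- t) $ k \<in> \<int>" by simp
qed

lift_definition minus_torus :: "'a torus \<Rightarrow> 'a torus \<Rightarrow> 'a torus" is "(-)"
proof -
  fix s t s' t' :: "real^'a" and k
  assume "\<And>k. s $ k - t $ k \<in> \<int>" "\<And>k. s' $ k - t' $ k \<in> \<int>"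
  then have "(s $ k - t $ k) - (s' $ k - t' $ k) \<in> \<int>" by (rule Ints_diff)
  then show "(s - s') $ k - (t - t') $ k \<in> \<int>" by (simp add: algebra_simps)
qed

instance
  by standard (transfer; simp add: algebra_simps)+

end

definition torus_action ::
  "('p, 'i, 'e::euclidean_space, 'z) riemannian_scheme \<Rightarrow> ('n::finite torus \<Rightarrow> 'p \<Rightarrow> 'p) \<Rightarrow> bool" where
  "torus_action N \<Phi> \<longleftrightarrow>
     (\<forall>a. \<forall>p\<in>points N. \<Phi> a p \<in> points N) \<and>
     (\<forall>p\<in>points N. \<Phi> 0 p = p) \<and>
     (\<forall>a b. \<forall>p\<in>points N. \<Phi> (a + b) p = \<Phi> a (\<Phi> b p)) \<and>
     continuous_map (prod_topology euclidean (mtop N)) (mtop N) (\<lambda>(t, p). \<Phi> (abs_torus t) p) \<and>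
     (\<forall>i\<in>charts N. \<forall>j\<in>charts N.
        smooth_on (\<lambda>(t, z). cmap N j (\<Phi> (abs_torus t) (cinv N i z)))
          {(t, z). z \<in> cimage N i \<and> \<Phi> (abs_torus t) (cinv N i z) \<in> cdom N j})"

definition effective_action :: "('p, 'i, 'e, 'z) riemannian_scheme \<Rightarrow>
    ('n::finite torus \<Rightarrow> 'p \<Rightarrow> 'p) \<Rightarrow> bool" where
  "effective_action N \<Phi> \<longleftrightarrow> (\<forall>a. (\<forall>p\<in>points N. \<Phi> a p = p) \<longrightarrow> a = 0)"

definition free_points :: "('p, 'i, 'e, 'z) riemannian_scheme \<Rightarrow>
    ('n::finite torus \<Rightarrow> 'p \<Rightarrow> 'p) \<Rightarrow> 'p set" where
  "free_points N \<Phi> = {p \<in> points N. \<forall>a. \<Phi> a p = p \<longrightarrow> a = 0}"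

definition translate ::
  "('n::finite \<Rightarrow> 'm \<Rightarrow> 'i \<Rightarrow> real^'n) \<Rightarrow> real^'n \<Rightarrow> 'm \<times> ('i \<Rightarrow> real^'n) \<Rightarrow> 'm \<times> ('i \<Rightarrow> real^'n)" where
  "translate X t = (\<lambda>(p, v). (p, \<lambda>i. v i + (\<Sum>k\<in>UNIV. t $ k *\<^sub>R X k p i)))"

text \<open>The action \<open>\<Phi>\<^sub>X\<close> on orbits: translating an orbit by any representative \<open>t\<close> of the torus
  element yields the same orbit, so the union below is a union of equal sets.\<close>

definition lattice_action ::
  "('n::finite \<Rightarrow> 'm \<Rightarrow> 'i \<Rightarrow> real^'n) \<Rightarrow> 'n torus \<Rightarrow>
    ('m \<times> ('i \<Rightarrow> real^'n)) set \<Rightarrow> ('m \<times> ('i \<Rightarrow> real^'n)) set" where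
  "lattice_action X a Q = (\<Union>t\<in>{t. abs_torus t = a}. translate X t ` Q)"

definition torification ::
  "('m, 'i, 'n::finite) affine_riemannian \<Rightarrow> ('p, 'j, complex^'n) riemannian \<Rightarrow>
    ('n torus \<Rightarrow> 'p \<Rightarrow> 'p) \<Rightarrow> bool" where
  "torification M N \<Phi> \<longleftrightarrow>
     dually_flat_manifold M \<and> connected_space (mtop M) \<and>
     kaehler_manifold N \<and> connected_space (mtop N) \<and>
     torus_action N \<Phi> \<and> effective_action N \<Phi> \<and>
     (\<forall>a. holomorphic_map N N (\<Phi> a)) \<and> (\<forall>a. isometric_map N N (\<Phi> a)) \<and>
     (\<exists>L X F. lattice_generator M L X \<and>
        (let M_L = quotient_manifold (dombrowski M) (lattice_orbit L) in
          holomorphic_isometric_diffeo M_L (open_submanifold N (free_points N \<Phi>)) F \<and>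
          (\<forall>a. \<forall>Q\<in>points M_L. F (lattice_action X a Q) = \<Phi> a (F Q))))"

definition regular_torification ::
  "('m, 'i, 'n::finite) affine_riemannian \<Rightarrow> ('p, 'j, complex^'n) riemannian \<Rightarrow>
    ('n torus \<Rightarrow> 'p \<Rightarrow> 'p) \<Rightarrow> bool" where
  "regular_torification M N \<Phi> \<longleftrightarrow>
     torification M N \<Phi> \<and> connected_space (mtop N) \<and> simply_connected_top (mtop N) \<and>
     complete_manifold N \<and> real_analytic_metric N"

section \<open>The models \<open>M\<^sub>c\<close>\<close>

definition model_set :: "real \<Rightarrow> real set" where
  "model_set c = (if c \<ge> 0 then UNIV else {..<0})"

definition model_metric :: "real \<Rightarrow> real \<Rightarrow> real" where
  "model_metric c \<theta> =
     (if c > 0 then 1 / (c * (cosh \<theta>)\<^sup>2)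
      else if c = 0 then exp \<theta>
      else - 1 / (c * (sinh \<theta>)\<^sup>2))"

definition model :: "real \<Rightarrow> (real, unit, 1) affine_riemannian" where
  "model c =
     \<lparr>mtop = top_of_set (model_set c),
      charts = {()},
      cdom = (\<lambda>_. model_set c),
      cmap = (\<lambda>_ \<theta>. vec \<theta>),
      metric = (\<lambda>_ x u v. model_metric c (x $ 1) * (u $ 1) * (v $ 1)),
      conn = (\<lambda>_ _ _ _. 0)\<rparr>"

section \<open>The space forms \<open>F(c)\<close> and their circle actions\<close>

lift_definition unit_phase :: "1 torus \<Rightarrow> complex" is
  "\<lambda>t. exp (2 * \<i> * of_real pi * of_real (t $ 1))"
proof -
  fix s t :: "real^1"
  assume "\<And>k. s $ k - t $ k \<in> \<int>"
  then obtain m where "s $ 1 - t $ 1 = of_int m"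
    by (rule Ints_cases)
  then have m: "s $ 1 = t $ 1 + of_int m" by simp
  show "exp (2 * \<i> * of_real pi * of_real (s $ 1)) = exp (2 * \<i> * of_real pi * of_real (t $ 1))"
    unfolding exp_eq m by (rule exI[of _ m]) (simp add: algebra_simps)
qed

definition rotation :: "1 torus \<Rightarrow> complex \<Rightarrow> complex" where
  "rotation a z = unit_phase a * z"

definition disc :: "real \<Rightarrow> (complex, unit, complex^1) riemannian" where
  "disc c =
     \<lparr>mtop = top_of_set {z. cmod z < 1},
      charts = {()},
      cdom = (\<lambda>_. {z. cmod z < 1}),
      cmap = (\<lambda>_ z. vec z),
      metric = (\<lambda>_ z v w. - 4 / c * (v \<bullet> w) / (1 - (Re (z $ 1))\<^sup>2 - (Im (z $ 1))\<^sup>2)\<^sup>2)\<rparr>"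

definition complex_plane :: "(complex, unit, complex^1) riemannian" where
  "complex_plane =
     \<lparr>mtop = euclidean,
      charts = {()},
      cdom = (\<lambda>_. UNIV),
      cmap = (\<lambda>_ z. vec z),
      metric = (\<lambda>_ z v w. v \<bullet> w)\<rparr>"

definition homogeneous :: "complex \<times> complex \<Rightarrow> (complex \<times> complex) set" where
  "homogeneous = (\<lambda>(z0, z1). {(k * z0, k * z1) | k. k \<noteq> 0})"

text \<open>The two affine charts are indexed by the affine sections \<open>w \<mapsto> (w, 1)\<close> (\<open>True\<close>) and
  \<open>w \<mapsto> (1, w)\<close> (\<open>False\<close>); \<open>affine_tangent\<close> is the derivative of the section.\<close>

definition affine_section :: "bool \<Rightarrow> complex \<Rightarrow> complex \<times> complex" where
  "affine_section b w = (if b then (w, 1) else (1, w))"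

definition affine_tangent :: "bool \<Rightarrow> complex \<Rightarrow> complex \<times> complex" where
  "affine_tangent b v = (if b then (v, 0) else (0, v))"

definition hermitian :: "complex \<times> complex \<Rightarrow> complex \<times> complex \<Rightarrow> complex" where
  "hermitian V W = fst V * cnj (fst W) + snd V * cnj (snd W)"

text \<open>The Fubini--Study metric at the point with homogeneous coordinates \<open>Z\<close>, on the images of
  tangent vectors \<open>V\<close>, \<open>W\<close> at \<open>Z\<close>. In an affine coordinate \<open>w\<close> it is
  \<open>(4/c) |dw|\<^sup>2 / (1 + |w|\<^sup>2)\<^sup>2\<close>, the metric of the round sphere of radius \<open>1/sqrt c\<close>;
  the factor \<open>4/c\<close> is thus the normalization to holomorphic sectional (= Gaussian) curvature \<open>c\<close>.\<close>

definition fubini_study ::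
  "real \<Rightarrow> complex \<times> complex \<Rightarrow> complex \<times> complex \<Rightarrow> complex \<times> complex \<Rightarrow> real" where
  "fubini_study c Z V W =
     4 / c * Re ((hermitian Z Z * hermitian V W - hermitian V Z * hermitian Z W) / (hermitian Z Z)\<^sup>2)"

definition projective_line :: "real \<Rightarrow> ((complex \<times> complex) set, bool, complex^1) riemannian" where
  "projective_line c =
     \<lparr>mtop = quotient_top (top_of_set (- {0})) homogeneous,
      charts = UNIV,
      cdom = (\<lambda>b. range (\<lambda>w. homogeneous (affine_section b w))),
      cmap = (\<lambda>b p. vec (THE w. affine_section b w \<in> p)),
      metric = (\<lambda>b z v w. fubini_study c (affine_section b (z $ 1))
        (affine_tangent b (v $ 1)) (affine_tangent b (w $ 1)))\<rparr>"

text \<open>\<open>[z\<^sub>0, z\<^sub>1] \<mapsto> [exp(2 i pi t) z\<^sub>0, z\<^sub>1]\<close>, as the image of the punctured line.\<close>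

definition projective_rotation :: "1 torus \<Rightarrow> (complex \<times> complex) set \<Rightarrow> (complex \<times> complex) set" where
  "projective_rotation a p = (\<lambda>(z0, z1). (unit_phase a * z0, z1)) ` p"

end

theory Submission
  imports Defs
begin

text \<open>
  The tangent bundle of the model, with Dombrowski's structure, is the domain of all \<open>\<zeta>\<close> in the
  complex plane with real part in \<open>M\<^sub>c\<close>, with the metric \<open>h\<^sub>c(Re \<zeta>) \<bar>d\<zeta>\<bar>\<^sup>2\<close>. The metric of the space form
  is invariant under rotation, so in the logarithmic coordinate \<open>ln w\<close> it too depends only on the real
  part, and a computation shows that it is the same metric: the covering
  \<open>w = \<beta> exp (\<alpha> \<zeta>)\<close> with \<open>(\<alpha>, \<beta>) = (1, 1)\<close> for \<open>c \<noteq> 0\<close> and \<open>(1/2, 2)\<close> for \<open>c = 0\<close> is a local isometry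
  onto the space form without the fixed points of the rotation, that is, onto the set where the circle
  acts freely. Its deck transformations are the translations by multiples of \<open>2 \<pi> \<i> / \<alpha>\<close>, hence it
  identifies that set with the quotient by the parallel lattice generated by \<open>(2 \<pi> / \<alpha>) \<partial>\<^sub>\<theta>\<close>, and it
  turns translation by \<open>t (2 \<pi> / \<alpha>) \<partial>\<^sub>\<theta>\<close> into rotation by \<open>exp (2 \<i> \<pi> t)\<close>. This common part of the three
  cases is the locale \<open>exponential_covering\<close>, with the results \<open>torify_diffeo\<close>,
  \<open>torify_equivariant\<close> and \<open>torificationI\<close>.

  The atlas of the tangent bundle contains a chart for every pair of affine coordinates, defined on an
  arbitrary open set. Such coordinates are locally affine functions of \<open>\<theta>\<close>, so the induced chart is
  locally the restriction of a complex affine function of \<open>\<zeta>\<close> (\<open>derivative_tangent_inverse\<close>), and all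
  questions on charts reduce to the single coordinate \<open>\<zeta>\<close>. The inverse of the map from the quotient is
  holomorphic because it is locally inverse to a map with nonzero derivative.

  Regularity is a property of the space forms alone. The disc and the plane are convex, and the
  projective line is homeomorphic to the 2-sphere (\<open>homeomorphic_map_to_sphere\<close>), hence all three are
  simply connected. The densities of the metrics are rational functions in the real coordinates, and
  real-analytic functions are closed under products and, where they do not vanish, reciprocals
  (\<open>analytic_near_inverse\<close>).
  Completeness follows from a map \<open>u\<close> to a Banach space that is Lipschitz for the Riemannian
  distance and along which limits can be pulled back (\<open>complete_manifoldI\<close>): Cauchy sequences are then
  mapped to Cauchy sequences, and convergence in a chart implies convergence in the Riemannian
  distance, by comparison with segments.
\<close>

section \<open>Smooth maps\<close>

lemma Ck_on_cong:
  assumes "open S" "\<And>x. x \<in> S \<Longrightarrow> f x = g x"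
  shows "Ck_on k f S \<longleftrightarrow> Ck_on k g S"
  using assms(2)
proof (induction k arbitrary: f g)
  case 0
  then show ?case by (auto cong: continuous_on_cong)
next
  case (Suc k)
  have D: "(f has_derivative D) (at x) \<longleftrightarrow> (g has_derivative D) (at x)" if "x \<in> S" for x D
    using Suc.prems assms(1) that
    by (metis (no_types, lifting) has_derivative_transform_within_open)
  have "f differentiable (at x) \<longleftrightarrow> g differentiable (at x)" if "x \<in> S" for x
    using D[OF that] by (simp add: differentiable_def)
  moreover have "frechet_derivative f (at x) = frechet_derivative g (at x)" if "x \<in> S" for x
    using D[OF that] by (simp add: frechet_derivative_def)
  then have "Ck_on k (\<lambda>x. frechet_derivative f (at x) v) S \<longleftrightarrow>
      Ck_on k (\<lambda>x. frechet_derivative g (at x) v) S" for v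
    by (intro Suc.IH) simp
  ultimately show ?case by auto
qed

lemma Ck_on_subset: "Ck_on k f S \<Longrightarrow> T \<subseteq> S \<Longrightarrow> Ck_on k f T"
  by (induction k arbitrary: f) (auto intro: continuous_on_subset)

lemma Ck_on_Suc_imp: "Ck_on (Suc k) f S \<Longrightarrow> Ck_on k f S"
proof (induction k arbitrary: f)
  case 0
  then show ?case
    by (auto intro!: continuous_at_imp_continuous_on differentiable_imp_continuous_within)
next
  case (Suc k)
  then show ?case by (metis Ck_on.simps(2))
qed

lemma Ck_on_const: "Ck_on k (\<lambda>_. c) S"
  by (induction k arbitrary: c) (auto simp: frechet_derivative_const)

text \<open>Reduces a claim about the derivative of a map to one about any formula for it.\<close>

lemma Ck_on_SucI:
  assumes "open S" "\<And>x. x \<in> S \<Longrightarrow> (f has_derivative F x) (at x)"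
    and "\<And>v. Ck_on k (\<lambda>x. F x v) S"
  shows "Ck_on (Suc k) f S"
proof -
  have "frechet_derivative f (at x) = F x" if "x \<in> S" for x
    using frechet_derivative_at[OF assms(2)[OF that]] by simp
  then have "Ck_on k (\<lambda>x. frechet_derivative f (at x) v) S \<longleftrightarrow> Ck_on k (\<lambda>x. F x v) S" for v
    by (intro Ck_on_cong assms(1)) simp
  then show ?thesis
    using assms(2,3) by (auto simp: differentiable_def)
qed

lemma Ck_on_bounded_linear:
  assumes "open S" "bounded_linear f"
  shows "Ck_on k f S"
proof (cases k)
  case 0
  then show ?thesis
    using assms(2) by (simp add: bounded_linear.linear linear_continuous_on)
next
  case (Suc m)
  then show ?thesis
    using Ck_on_SucI[OF assms(1), of f "\<lambda>_. f" m] assms(2)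
    by (simp add: bounded_linear_imp_has_derivative Ck_on_const)
qed

lemma Ck_on_has_frechet_derivative:
  "Ck_on (Suc k) f S \<Longrightarrow> x \<in> S \<Longrightarrow> (f has_derivative frechet_derivative f (at x)) (at x)"
  by (simp add: frechet_derivative_works)

lemma Ck_on_add:
  assumes "open S" "Ck_on k f S" "Ck_on k g S"
  shows "Ck_on k (\<lambda>x. f x + g x) S"
  using assms(2,3)
proof (induction k arbitrary: f g)
  case (Suc k)
  show ?case
    by (rule Ck_on_SucI[OF assms(1) has_derivative_add
        [OF Ck_on_has_frechet_derivative[OF Suc.prems(1)] Ck_on_has_frechet_derivative[OF Suc.prems(2)]]])
      (use Suc in auto)
qed (simp add: continuous_on_add)

lemma Ck_on_sum:
  assumes "open S" "\<And>b. b \<in> B \<Longrightarrow> Ck_on k (f b) S"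
  shows "Ck_on k (\<lambda>x. \<Sum>b\<in>B. f b x) S"
  using assms(2) by (induction B rule: infinite_finite_induct) (auto intro: Ck_on_const Ck_on_add assms(1))

text \<open>By the Leibniz rule the derivative of a product is a sum of products of lower order.\<close>

lemma Ck_on_bilinear:
  assumes "open S" "bounded_bilinear prd" "Ck_on k f S" "Ck_on k g S"
  shows "Ck_on k (\<lambda>x. prd (f x) (g x)) S"
  using assms(3,4)
proof (induction k arbitrary: f g)
  case 0
  then show ?case by (simp add: bounded_bilinear.continuous_on[OF assms(2)])
next
  case (Suc k)
  note low = Suc.prems[THEN Ck_on_Suc_imp]
  show ?case
    by (rule Ck_on_SucI[OF assms(1) bounded_bilinear.FDERIV[OF assms(2)
        Ck_on_has_frechet_derivative[OF Suc.prems(1)] Ck_on_has_frechet_derivative[OF Suc.prems(2)]]])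
      (use Suc low in \<open>auto intro!: Ck_on_add assms(1) Suc.IH\<close>)
qed

text \<open>The chain rule \<open>D(f \<circ> g)(x) v = \<Sum>\<^sub>b (Dg(x) v \<bullet> b) Df(g x) b\<close> expresses the derivative of a
  composition through compositions and products of lower order.\<close>

lemma Ck_on_compose:
  assumes "open S" "open T" "g ` S \<subseteq> T" "Ck_on k f T" "Ck_on k g S"
  shows "Ck_on k (\<lambda>x. f (g x)) S"
  using assms(4,5)
proof (induction k arbitrary: f)
  case 0
  then show ?case using assms(3) by (auto intro: continuous_on_compose2)
next
  case (Suc k)
  have lin: "linear (frechet_derivative f (at (g x)))" if "x \<in> S" for x
    using Suc.prems(1) that assms(3) by (auto intro!: linear_frechet_derivative)
  show ?case
  proof (rule Ck_on_SucI[OF assms(1)])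
    fix x assume x: "x \<in> S"
    have "((\<lambda>x. f (g x)) has_derivative
        (\<lambda>v. frechet_derivative f (at (g x)) (frechet_derivative g (at x) v))) (at x)"
      using Ck_on_has_frechet_derivative[OF Suc.prems(1)] Ck_on_has_frechet_derivative[OF Suc.prems(2) x]
        x assms(3) has_derivative_compose by blast
    also have "(\<lambda>v. frechet_derivative f (at (g x)) (frechet_derivative g (at x) v)) =
        (\<lambda>v. \<Sum>b\<in>Basis. (frechet_derivative g (at x) v \<bullet> b) *\<^sub>R frechet_derivative f (at (g x)) b)"
    proof
      fix v
      show "frechet_derivative f (at (g x)) (frechet_derivative g (at x) v) =
        (\<Sum>b\<in>Basis. (frechet_derivative g (at x) v \<bullet> b) *\<^sub>R frechet_derivative f (at (g x)) b)"
        using lin[OF x]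
        by (subst euclidean_representation[symmetric, of "frechet_derivative g (at x) v"])
          (simp only: linear_sum linear_cmul)
    qed
    finally show "((\<lambda>x. f (g x)) has_derivative \<dots>) (at x)" .
  next
    fix v
    have "Ck_on k (\<lambda>x. frechet_derivative g (at x) v \<bullet> b) S" for b
      using Suc.prems(2)
      by (intro Ck_on_bilinear[OF assms(1) bounded_bilinear_inner _ Ck_on_const]) simp
    then show "Ck_on k (\<lambda>x. \<Sum>b\<in>Basis.
        (frechet_derivative g (at x) v \<bullet> b) *\<^sub>R frechet_derivative f (at (g x)) b) S"
      using Suc.prems(1) Ck_on_Suc_imp[OF Suc.prems(2)]
      by (intro Ck_on_sum assms(1) Ck_on_bilinear[OF assms(1) bounded_bilinear_scaleR])
        (auto intro!: Suc.IH)
  qed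
qed

lemma smooth_on_cong:
  "open S \<Longrightarrow> (\<And>x. x \<in> S \<Longrightarrow> f x = g x) \<Longrightarrow> smooth_on f S \<longleftrightarrow> smooth_on g S"
  unfolding smooth_on_def using Ck_on_cong by blast

lemma smooth_on_subset: "smooth_on f S \<Longrightarrow> T \<subseteq> S \<Longrightarrow> smooth_on f T"
  unfolding smooth_on_def using Ck_on_subset by blast

lemma smooth_on_imp_continuous_on: "smooth_on f S \<Longrightarrow> continuous_on S f"
  unfolding smooth_on_def using Ck_on.simps(1) by metis

lemma smooth_on_has_frechet_derivative:
  "smooth_on f S \<Longrightarrow> x \<in> S \<Longrightarrow> (f has_derivative frechet_derivative f (at x)) (at x)"
  unfolding smooth_on_def using Ck_on_has_frechet_derivative by blast

lemma smooth_on_frechet_derivative: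
  "smooth_on f S \<Longrightarrow> smooth_on (\<lambda>x. frechet_derivative f (at x) v) S"
  unfolding smooth_on_def by (metis Ck_on.simps(2))

lemma smooth_on_const: "smooth_on (\<lambda>_. c) S"
  by (simp add: smooth_on_def Ck_on_const)

lemma smooth_on_bounded_linear: "open S \<Longrightarrow> bounded_linear f \<Longrightarrow> smooth_on f S"
  by (simp add: smooth_on_def Ck_on_bounded_linear)

lemma smooth_on_add:
  "open S \<Longrightarrow> smooth_on f S \<Longrightarrow> smooth_on g S \<Longrightarrow> smooth_on (\<lambda>x. f x + g x) S"
  by (simp add: smooth_on_def Ck_on_add)

lemma smooth_on_bilinear:
  "open S \<Longrightarrow> bounded_bilinear prd \<Longrightarrow> smooth_on f S \<Longrightarrow> smooth_on g S \<Longrightarrow>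
    smooth_on (\<lambda>x. prd (f x) (g x)) S"
  by (simp add: smooth_on_def Ck_on_bilinear)

lemma smooth_on_mult:
  fixes f g :: "'a::euclidean_space \<Rightarrow> 'b::{euclidean_space, real_normed_algebra}"
  shows "open S \<Longrightarrow> smooth_on f S \<Longrightarrow> smooth_on g S \<Longrightarrow> smooth_on (\<lambda>x. f x * g x) S"
  by (rule smooth_on_bilinear[OF _ bounded_bilinear_mult])

lemma smooth_on_compose:
  "open S \<Longrightarrow> open T \<Longrightarrow> g ` S \<subseteq> T \<Longrightarrow> smooth_on f T \<Longrightarrow> smooth_on g S \<Longrightarrow>
    smooth_on (\<lambda>x. f (g x)) S"
  unfolding smooth_on_def using Ck_on_compose by blast

lemma smooth_on_compose_linear:
  "open S \<Longrightarrow> bounded_linear l \<Longrightarrow> smooth_on g S \<Longrightarrow> smooth_on (\<lambda>x. l (g x)) S"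
  by (rule smooth_on_compose[OF _ open_UNIV _ smooth_on_bounded_linear[OF open_UNIV]]) auto

text \<open>The functions \<open>exp\<close> and \<open>inverse\<close> solve differential equations whose right-hand sides are
  polynomials in the function itself, so each order of differentiability yields the next.\<close>

lemma smooth_on_exp:
  "smooth_on (exp :: 'a \<Rightarrow> 'a::{euclidean_space, real_normed_field}) UNIV"
proof -
  have "Ck_on k (exp :: 'a \<Rightarrow> 'a) UNIV" for k
  proof (induction k)
    case 0
    show ?case by (simp add: continuous_on_exp)
  next
    case (Suc k)
    have "((exp :: 'a \<Rightarrow> 'a) has_derivative (\<lambda>v. exp x * v)) (at x)" for x
      using DERIV_exp[of x] by (simp add: has_field_derivative_def)
    then show ?case
      by (rule Ck_on_SucI[OF open_UNIV])
        (intro Ck_on_bilinear[OF open_UNIV bounded_bilinear_mult Suc Ck_on_const])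
  qed
  then show ?thesis by (simp add: smooth_on_def)
qed

lemma smooth_on_inverse:
  "smooth_on (inverse :: 'a \<Rightarrow> 'a::{euclidean_space, real_normed_field}) (- {0})"
proof -
  have op: "open (- {0 :: 'a})" by auto
  have "Ck_on k (inverse :: 'a \<Rightarrow> 'a) (- {0})" for k
  proof (induction k)
    case 0
    show ?case by (auto intro!: continuous_intros)
  next
    case (Suc k)
    have "((inverse :: 'a \<Rightarrow> 'a) has_derivative (\<lambda>v. inverse x * inverse x * (- v))) (at x)"
      if "x \<in> - {0}" for x
      using has_derivative_inverse'[of x] that
      by (simp add: mult.commute mult.left_commute)
    then show ?case
      by (rule Ck_on_SucI[OF op _ Ck_on_bilinear[OF op bounded_bilinear_mult
          Ck_on_bilinear[OF op bounded_bilinear_mult Suc Suc] Ck_on_const]])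
  qed
  then show ?thesis by (simp add: smooth_on_def)
qed

lemma smooth_on_inverse':
  fixes g :: "'a::euclidean_space \<Rightarrow> 'b::{euclidean_space, real_normed_field}"
  assumes "open S" "smooth_on g S" "\<And>x. x \<in> S \<Longrightarrow> g x \<noteq> 0"
  shows "smooth_on (\<lambda>x. inverse (g x)) S"
  by (rule smooth_on_compose[OF assms(1) _ _ smooth_on_inverse assms(2)]) (use assms(3) in auto)

section \<open>Charts of a manifold\<close>

locale top_manifold =
  fixes M :: "('p, 'i, 'e::euclidean_space, 'z) riemannian_scheme"
  assumes tm: "topological_manifold M"
begin

lemma chart_open: "i \<in> charts M \<Longrightarrow> openin (mtop M) (cdom M i)"
  and cimage_open: "i \<in> charts M \<Longrightarrow> open (cimage M i)"
  and chart_homeo: "i \<in> charts M \<Longrightarrow>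
    homeomorphic_map (subtopology (mtop M) (cdom M i)) (top_of_set (cimage M i)) (cmap M i)"
  and points_covered: "p \<in> points M \<Longrightarrow> \<exists>i\<in>charts M. p \<in> cdom M i"
  using tm unfolding topological_manifold_def by auto

lemma cdom_subset: "i \<in> charts M \<Longrightarrow> cdom M i \<subseteq> points M"
  using chart_open openin_subset by blast

lemma topspace_chart: "i \<in> charts M \<Longrightarrow> topspace (subtopology (mtop M) (cdom M i)) = cdom M i"
  using cdom_subset by (auto simp: topspace_subtopology)

lemma cmap_inj: "i \<in> charts M \<Longrightarrow> inj_on (cmap M i) (cdom M i)"
  using homeomorphic_imp_injective_map[OF chart_homeo] topspace_chart by simp

lemma cinv_cmap: "i \<in> charts M \<Longrightarrow> p \<in> cdom M i \<Longrightarrow> cinv M i (cmap M i p) = p"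
  by (simp add: cinv_def cmap_inj)

lemma cinv_in: "z \<in> cimage M i \<Longrightarrow> cinv M i z \<in> cdom M i"
  and cmap_cinv: "z \<in> cimage M i \<Longrightarrow> cmap M i (cinv M i z) = z"
  by (simp_all add: cimage_def cinv_def inv_into_into f_inv_into_f)

lemma cmap_in: "p \<in> cdom M i \<Longrightarrow> cmap M i p \<in> cimage M i"
  by (simp add: cimage_def)

lemma open_chart_image:
  assumes "i \<in> charts M" "openin (mtop M) W" "W \<subseteq> cdom M i"
  shows "open (cmap M i ` W)"
proof -
  have "openin (subtopology (mtop M) (cdom M i)) W"
    using assms by (simp add: openin_open_subtopology chart_open)
  then have "openin (top_of_set (cimage M i)) (cmap M i ` W)"
    using homeomorphic_map_openness[OF chart_homeo[OF assms(1)], of W] assms(3)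
      cdom_subset[OF assms(1)] topspace_chart[OF assms(1)] by auto
  then show ?thesis using cimage_open[OF assms(1)] by (simp add: openin_open_eq)
qed

lemma continuous_map_cinv:
  assumes "i \<in> charts M"
  shows "continuous_map (top_of_set (cimage M i)) (mtop M) (cinv M i)"
  unfolding continuous_map_def
proof (intro conjI allI impI)
  show "cinv M i \<in> topspace (top_of_set (cimage M i)) \<rightarrow> points M"
    using cinv_in cdom_subset[OF assms] by auto
  fix U assume U: "openin (mtop M) U"
  have "{z \<in> cimage M i. cinv M i z \<in> U} = cmap M i ` (U \<inter> cdom M i)"
    using cinv_in cmap_cinv cmap_in cinv_cmap[OF assms] by (force simp: image_iff)
  moreover have "open \<dots>"
    using U chart_open[OF assms] by (intro open_chart_image assms) auto
  ultimately show "openin (top_of_set (cimage M i)) {z \<in> topspace (top_of_set (cimage M i)). cinv M i z \<in> U}"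
    using cimage_open[OF assms] cmap_in by (auto simp: openin_open_eq)
qed

lemma cmap_in_overlap: "p \<in> cdom M i \<Longrightarrow> p \<in> cdom M j \<Longrightarrow> cmap M i p \<in> overlap M i j"
  by (auto simp: overlap_def)

lemma transition_cmap:
  "i \<in> charts M \<Longrightarrow> p \<in> cdom M i \<Longrightarrow> transition M i j (cmap M i p) = cmap M j p"
  by (simp add: transition_def cinv_cmap)

lemma rep_domainD:
  assumes "i \<in> charts M" "z \<in> rep_domain M N f i j"
  shows "z \<in> cimage M i" "cinv M i z \<in> cdom M i" "f (cinv M i z) \<in> cdom N j"
  using assms by (auto simp: rep_domain_def cinv_cmap cimage_def)

lemma rep_domain_open:
  assumes "i \<in> charts M" "openin (mtop N) (cdom N j)" "continuous_map (mtop M) (mtop N) f"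
  shows "open (rep_domain M N f i j)"
  unfolding rep_domain_def
proof (rule open_chart_image[OF assms(1)])
  have "{p \<in> cdom M i. f p \<in> cdom N j} = cdom M i \<inter> {p \<in> points M. f p \<in> cdom N j}"
    using cdom_subset[OF assms(1)] by auto
  then show "openin (mtop M) {p \<in> cdom M i. f p \<in> cdom N j}"
    using openin_continuous_map_preimage[OF assms(3,2)] chart_open[OF assms(1)] by auto
qed auto

end

section \<open>One-dimensional charts\<close>

lemma vec_nth_1: "vec (z $ 1) = (z :: 'a^1)"
  by (simp add: vec_eq_iff)

lemma vec_image_1: "vec ` S = {z :: 'a^1. z $ 1 \<in> S}"
  by (auto simp: image_iff) (metis vec_nth_1)

lemma bounded_linear_vec_1: "bounded_linear (vec :: 'a::real_normed_vector \<Rightarrow> 'a^1)"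
  by (rule bounded_linear_intro[of _ 1]) (auto simp: vec_eq_iff norm_vector_1)

lemma bounded_linear_nth_1: "bounded_linear (\<lambda>z :: 'a::real_normed_vector^1. z $ 1)"
  by (rule bounded_linear_vec_nth)

lemma open_nth_1:
  assumes "open S"
  shows "open {z :: 'a::real_normed_vector^1. z $ 1 \<in> S}"
  using open_vimage[OF assms, of "\<lambda>z :: 'a^1. z $ 1"] by (simp add: vimage_def continuous_on_component)

lemma open_vec_image_1: "open S \<Longrightarrow> open (vec ` S :: ('a::real_normed_vector^1) set)"
  by (simp add: vec_image_1 open_nth_1)

lemma inner_1: "(v :: 'a::real_inner^1) \<bullet> w = v $ 1 \<bullet> w $ 1"
  by (simp add: inner_vec_def sum_1)

lemma homeomorphic_map_vec_1:
  "homeomorphic_map (top_of_set S) (top_of_set (vec ` S :: ('a::real_normed_vector^1) set)) vec"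
  unfolding homeomorphic_map_maps homeomorphic_maps_def
  by (rule exI[of _ "\<lambda>z. z $ 1"])
    (auto simp: continuous_map_in_subtopology linear_continuous_on[OF bounded_linear_vec_1]
      linear_continuous_on[OF bounded_linear_nth_1])

lemma has_derivative_vec_1:
  assumes "(g has_derivative G) (at (z $ 1))"
  shows "((\<lambda>z :: 'a::real_normed_vector^1. vec (g (z $ 1)) :: 'b::real_normed_vector^1)
    has_derivative (\<lambda>v. vec (G (v $ 1)))) (at z)"
  using has_derivative_compose[OF bounded_linear_imp_has_derivative[OF bounded_linear_nth_1] assms]
  by (rule bounded_linear.has_derivative[OF bounded_linear_vec_1])

lemma has_derivative_vec_1_transform:
  assumes "open \<Omega>" "z \<in> \<Omega>" "\<And>z. z \<in> \<Omega> \<Longrightarrow> f z = vec (g (z $ 1))"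
    and "(g has_field_derivative a) (at (z $ 1))"
  shows "(f has_derivative (\<lambda>v :: complex^1. vec (a * v $ 1) :: complex^1)) (at z)"
  using has_derivative_vec_1[OF assms(4)[unfolded has_field_derivative_def]]
  by (rule has_derivative_transform_within_open[OF _ assms(1,2)]) (simp add: assms(3))

lemma cholomorphic_on_1I:
  fixes f :: "complex^1 \<Rightarrow> complex^1"
  assumes "\<And>z. z \<in> S \<Longrightarrow> \<exists>a. (f has_derivative (\<lambda>v. vec (a * v $ 1))) (at z)"
  shows "cholomorphic_on f S"
  unfolding cholomorphic_on_def
proof
  fix z assume "z \<in> S"
  then obtain a where "(f has_derivative (\<lambda>v. vec (a * v $ 1))) (at z)" using assms by blast
  moreover have "(\<lambda>v. vec (a * v $ 1)) = (\<lambda>v. (\<chi> i j. a :: complex^1^1) *v v)"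
    by (auto simp: fun_eq_iff vec_eq_iff matrix_vector_mult_def sum_1)
  ultimately show "\<exists>A :: complex^1^1. (f has_derivative (\<lambda>v. A *v v)) (at z)" by metis
qed

lemma inner_mult_complex: "(a * v) \<bullet> (a * w) = (cmod a)\<^sup>2 * (v \<bullet> w)" for a v w :: complex
  by (simp add: inner_complex_def cmod_power2) (simp add: power2_eq_square algebra_simps)

lemma smooth_on_vec_1:
  assumes "open S" "smooth_on g S"
  shows "smooth_on (\<lambda>z :: 'a::euclidean_space^1. vec (g (z $ 1)) :: 'b::euclidean_space^1) {z. z $ 1 \<in> S}"
    and "smooth_on (\<lambda>z :: 'a^1. g (z $ 1)) {z. z $ 1 \<in> S}"
proof -
  show "smooth_on (\<lambda>z :: 'a^1. g (z $ 1)) {z. z $ 1 \<in> S}"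
    by (rule smooth_on_compose[OF open_nth_1 assms(1) _ assms(2)
          smooth_on_bounded_linear[OF open_nth_1 bounded_linear_nth_1]]) (use assms(1) in auto)
  then show "smooth_on (\<lambda>z :: 'a^1. vec (g (z $ 1)) :: 'b^1) {z. z $ 1 \<in> S}"
    by (rule smooth_on_compose_linear[OF open_nth_1[OF assms(1)] bounded_linear_vec_1])
qed

section \<open>Conformal metrics on Riemann surfaces\<close>

text \<open>All metrics below have the form \<open>\<rho>(\<zeta>) \<bar>d\<zeta>\<bar>\<^sup>2\<close> in every holomorphic coordinate \<open>\<zeta>\<close>.\<close>

definition conformal_metric ::
  "('p, 'i, complex^1, 'z) riemannian_scheme \<Rightarrow> ('i \<Rightarrow> complex \<Rightarrow> real) \<Rightarrow> bool" where
  "conformal_metric N \<rho> \<longleftrightarrow> (\<forall>i\<in>charts N. \<forall>z v w. metric N i z v w = \<rho> i (z $ 1) * (v \<bullet> w))"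

text \<open>The Cauchy--Riemann equations for \<open>f\<close> at \<open>z\<close>, together with \<open>f\<^sup>* (\<rho>' \<bar>d\<zeta>\<bar>\<^sup>2) = \<rho> \<bar>d\<zeta>\<bar>\<^sup>2\<close>
  there. Transition maps, rotations and the map onto the torification all have this property, which
  settles holomorphy and isometry in one step.\<close>

definition conformal_isometry_at ::
  "('i \<Rightarrow> complex \<Rightarrow> real) \<Rightarrow> ('j \<Rightarrow> complex \<Rightarrow> real) \<Rightarrow> 'i \<Rightarrow> 'j \<Rightarrow> (complex^1 \<Rightarrow> complex^1) \<Rightarrow> complex^1 \<Rightarrow> bool"
  where
  "conformal_isometry_at \<rho> \<rho>' i j f z \<longleftrightarrow> (\<exists>a. (f has_derivative (\<lambda>v. vec (a * v $ 1))) (at z) \<and>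
     \<rho>' j (f z $ 1) * (cmod a)\<^sup>2 = \<rho> i (z $ 1))"

lemma conformal_isometry_atI:
  assumes "open \<Omega>" "z \<in> \<Omega>" "\<And>z. z \<in> \<Omega> \<Longrightarrow> f z = vec (g (z $ 1))"
    and "(g has_field_derivative a) (at (z $ 1))"
    and "\<rho>' j (g (z $ 1)) * (cmod a)\<^sup>2 = \<rho> i (z $ 1)"
  shows "conformal_isometry_at \<rho> \<rho>' i j f z"
  unfolding conformal_isometry_at_def
  using has_derivative_vec_1_transform[OF assms(1-4)] assms(2,3,5) by auto

lemma conformal_isometry_at_metric:
  assumes "conformal_isometry_at \<rho> \<rho>' i j f z"
  shows "\<rho>' j (f z $ 1) * (frechet_derivative f (at z) v \<bullet> frechet_derivative f (at z) w) = \<rho> i (z $ 1) * (v \<bullet> w)"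
proof -
  obtain a where a: "(f has_derivative (\<lambda>v. vec (a * v $ 1))) (at z)"
    and r: "\<rho>' j (f z $ 1) * (cmod a)\<^sup>2 = \<rho> i (z $ 1)"
    using assms unfolding conformal_isometry_at_def by blast
  show ?thesis
    unfolding frechet_derivative_at[OF a, symmetric] r[symmetric] by (simp add: inner_1 inner_mult_complex)
qed

lemma conformal_holomorphic_isometric_map:
  assumes M: "\<And>i z v w. i \<in> charts M \<Longrightarrow> z \<in> cimage M i \<Longrightarrow> metric M i z v w = \<rho> i (z $ 1) * (v \<bullet> w)"
    and N: "conformal_metric N \<rho>'"
    and "continuous_map (mtop M) (mtop N) f"
    and loc: "\<And>i j z. i \<in> charts M \<Longrightarrow> j \<in> charts N \<Longrightarrow> z \<in> rep_domain M N f i j \<Longrightarrow>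
      conformal_isometry_at \<rho> \<rho>' i j (local_rep M N f i j) z"
  shows "holomorphic_map M N f" "isometric_map M N f"
proof -
  show "holomorphic_map M N f"
    unfolding holomorphic_map_def using assms(3) loc
    by (auto intro!: cholomorphic_on_1I simp: conformal_isometry_at_def) blast
  show "isometric_map M N f"
    unfolding isometric_map_def
  proof (intro ballI allI)
    fix i j z v w assume ij: "i \<in> charts M" "j \<in> charts N" and z: "z \<in> rep_domain M N f i j"
    have "z \<in> cimage M i" using z by (auto simp: rep_domain_def cimage_def)
    then show "metric N j (local_rep M N f i j z) (frechet_derivative (local_rep M N f i j) (at z) v)
        (frechet_derivative (local_rep M N f i j) (at z) w) = metric M i z v w"
      using conformal_isometry_at_metric[OF loc[OF ij z]] N M ij by (simp add: conformal_metric_def)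
  qed
qed

text \<open>The Kaehler form \<open>\<rho> \<omega>\<close> with the constant area form \<open>\<omega>\<close> is closed because
  \<open>d\<rho> \<and> \<omega>\<close> is a 3-form on a surface.\<close>

lemma kaehler_manifold_conformal:
  assumes N: "topological_manifold N" and met: "conformal_metric N \<rho>"
    and pos: "\<And>i z. i \<in> charts N \<Longrightarrow> z \<in> cimage N i \<Longrightarrow> 0 < \<rho> i (z $ 1)"
    and smooth: "\<And>i. i \<in> charts N \<Longrightarrow> smooth_on (\<lambda>z. \<rho> i (z $ 1)) (cimage N i)"
    and trans: "\<And>i j z. i \<in> charts N \<Longrightarrow> j \<in> charts N \<Longrightarrow> z \<in> overlap N i j \<Longrightarrow>
      conformal_isometry_at \<rho> \<rho> i j (transition N i j) z"
  shows "kaehler_manifold N"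
proof -
  interpret top_manifold N by (rule top_manifold.intro[OF N])
  have met: "metric N i z v w = \<rho> i (z $ 1) * (v \<bullet> w)" if "i \<in> charts N" for i z v w
    using met that by (simp add: conformal_metric_def)
  have "complex_manifold N"
    unfolding complex_manifold_def using N trans
    by (auto intro!: cholomorphic_on_1I simp: conformal_isometry_at_def) blast
  moreover have "riemannian_metric N"
    unfolding riemannian_metric_def
  proof (intro conjI ballI allI impI)
    fix i assume i: "i \<in> charts N"
    show "smooth_on (\<lambda>z. metric N i z v w) (cimage N i)" for v w
      unfolding met[OF i] by (intro smooth_on_mult cimage_open i smooth smooth_on_const)
    fix z assume z: "z \<in> cimage N i"
    show "bilinear (metric N i z)"
      unfolding bilinear_def met[OF i]
      by (auto intro!: linearI simp: inner_add_left inner_add_right algebra_simps)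
    show "metric N i z v w = metric N i z w v" for v w
      by (simp add: met[OF i] inner_commute)
    show "0 < metric N i z v v" if "v \<noteq> 0" for v
      using pos[OF i z] that by (simp add: met[OF i])
  next
    fix i j z v w assume i: "i \<in> charts N" and j: "j \<in> charts N" and z: "z \<in> overlap N i j"
    show "metric N j (transition N i j z) (frechet_derivative (transition N i j) (at z) v)
        (frechet_derivative (transition N i j) (at z) w) = metric N i z v w"
      using conformal_isometry_at_metric[OF trans[OF i j z]] by (simp add: met i j)
  qed
  moreover have "metric N i z (\<i> *s v) (\<i> *s w) = metric N i z v w" if "i \<in> charts N" for i z v w
    using inner_mult_complex[of \<i>] by (simp add: met[OF that] inner_1)
  moreover have "frechet_derivative (\<lambda>y. kaehler_form N i y v w) (at z) u +
        frechet_derivative (\<lambda>y. kaehler_form N i y w u) (at z) v +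
        frechet_derivative (\<lambda>y. kaehler_form N i y u v) (at z) w = 0"
    if i: "i \<in> charts N" and z: "z \<in> cimage N i" for i z u v w
  proof -
    define D where "D = frechet_derivative (\<lambda>z. \<rho> i (z $ 1)) (at z)"
    have D: "((\<lambda>z. \<rho> i (z $ 1)) has_derivative D) (at z)"
      unfolding D_def by (rule smooth_on_has_frechet_derivative[OF smooth[OF i] z])
    have form: "frechet_derivative (\<lambda>y. kaehler_form N i y v w) (at z) =
        (\<lambda>u. D u * ((\<i> * v $ 1) \<bullet> w $ 1))" for v w
      using has_derivative_mult_left[OF D, of "(\<i> * v $ 1) \<bullet> w $ 1"]
      by (simp add: kaehler_form_def met[OF i] inner_1 frechet_derivative_at[symmetric])
    define p q where "p = D (vec 1)" and "q = D (vec \<i>)"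
    have Dpq: "D x = Re (x $ 1) * p + Im (x $ 1) * q" for x
    proof -
      have "x = Re (x $ 1) *\<^sub>R vec 1 + Im (x $ 1) *\<^sub>R vec \<i>"
        by (simp add: vec_eq_iff complex_eq_iff)
      then have "D x = D (Re (x $ 1) *\<^sub>R vec 1 + Im (x $ 1) *\<^sub>R vec \<i>)" by simp
      also have "\<dots> = Re (x $ 1) * p + Im (x $ 1) * q"
        using has_derivative_linear[OF D] by (simp add: linear_add linear_cmul p_def q_def)
      finally show ?thesis .
    qed
    show ?thesis
      unfolding form Dpq by (simp add: inner_complex_def algebra_simps)
  qed
  ultimately show ?thesis unfolding kaehler_manifold_def by blast
qed

section \<open>Real-analytic functions\<close>

abbreviation multi_indices :: "('a::euclidean_space \<Rightarrow> nat) set" where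
  "multi_indices \<equiv> Basis \<rightarrow>\<^sub>E UNIV"

definition monomial :: "('a::euclidean_space \<Rightarrow> nat) \<Rightarrow> 'a \<Rightarrow> real" where
  "monomial \<alpha> h = (\<Prod>b\<in>Basis. (h \<bullet> b) ^ \<alpha> b)"

definition order_of :: "('a::euclidean_space \<Rightarrow> nat) \<Rightarrow> nat" where
  "order_of \<alpha> = (\<Sum>b\<in>Basis. \<alpha> b)"

text \<open>Power series whose coefficients satisfy \<open>\<Sum>\<^sub>\<alpha> \<bar>a\<^sub>\<alpha>\<bar> \<rho>\<^bsup>\<bar>\<alpha>\<bar>\<^esup> \<le> m\<close> form, for fixed \<open>\<rho>\<close>, a Banach
  algebra with this sum as norm. Recording the bound \<open>m\<close> allows geometric series to be summed,
  which is how reciprocals are obtained.\<close>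

definition majorized_series :: "'a::euclidean_space \<Rightarrow> real \<Rightarrow> real \<Rightarrow> ('a \<Rightarrow> real) \<Rightarrow> bool" where
  "majorized_series x \<rho> m f \<longleftrightarrow> (\<exists>a.
     (\<exists>s\<le>m. ((\<lambda>\<alpha>. \<bar>a \<alpha>\<bar> * \<rho> ^ order_of \<alpha>) has_sum s) multi_indices) \<and>
     (\<forall>y\<in>ball x \<rho>. ((\<lambda>\<alpha>. a \<alpha> * monomial \<alpha> (y - x)) has_sum f y) multi_indices))"

lemma abs_monomial_le:
  assumes "norm h \<le> \<rho>"
  shows "\<bar>monomial \<alpha> h\<bar> \<le> \<rho> ^ order_of \<alpha>"
proof -
  have "\<bar>monomial \<alpha> h\<bar> = (\<Prod>b\<in>Basis. \<bar>h \<bullet> b\<bar> ^ \<alpha> b)"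
    by (simp add: monomial_def abs_prod power_abs)
  also have "\<dots> \<le> (\<Prod>b\<in>Basis. \<rho> ^ \<alpha> b)"
    by (intro prod_mono conjI zero_le_power power_mono abs_ge_zero)
      (use assms Basis_le_norm[of _ h] in fastforce)
  also have "\<dots> = \<rho> ^ order_of \<alpha>" by (simp add: order_of_def power_sum)
  finally show ?thesis .
qed

text \<open>Any absolutely convergent family of monomials may be collected into a power series, whatever
  its index set; all closure properties reduce to this.\<close>

lemma majorized_series_regroup:
  fixes c :: "'j \<Rightarrow> real" and e :: "'j \<Rightarrow> 'a::euclidean_space \<Rightarrow> nat"
  assumes rho: "\<rho> > 0" and e: "\<And>j. j \<in> J \<Longrightarrow> e j \<in> multi_indices"
    and maj: "((\<lambda>j. \<bar>c j\<bar> * \<rho> ^ order_of (e j)) has_sum s) J" and s: "s \<le> m"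
    and f: "\<And>y. y \<in> ball x \<rho> \<Longrightarrow> ((\<lambda>j. c j * monomial (e j) (y - x)) has_sum f y) J"
  shows "majorized_series x \<rho> m f"
proof -
  define fib where "fib \<alpha> = {j\<in>J. e j = \<alpha>}" for \<alpha>
  define a where "a \<alpha> = infsum c (fib \<alpha>)" for \<alpha>
  have regroup: "(g has_sum S) J \<longleftrightarrow> ((\<lambda>(\<alpha>, j). g j) has_sum S) (Sigma multi_indices fib)"
    for g :: "'j \<Rightarrow> real" and S
    by (rule has_sum_reindex_bij_witness[of _ snd "\<lambda>j. (e j, j)"]) (use e in \<open>auto simp: fib_def\<close>)
  have "(\<lambda>j. \<bar>c j\<bar> * \<rho> ^ order_of (e j)) summable_on fib \<alpha>" for \<alpha>
    by (rule summable_on_subset_banach[OF has_sum_imp_summable[OF maj]]) (auto simp: fib_def)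
  moreover have "(\<lambda>j. \<bar>c j\<bar> * \<rho> ^ order_of (e j)) summable_on fib \<alpha> \<longleftrightarrow>
      (\<lambda>j. \<bar>c j\<bar> * \<rho> ^ order_of \<alpha>) summable_on fib \<alpha>" for \<alpha>
    by (rule summable_on_cong) (auto simp: fib_def)
  ultimately have "(\<lambda>j. \<bar>c j\<bar> * \<rho> ^ order_of \<alpha>) summable_on fib \<alpha>" for \<alpha>
    by blast
  then have abs_c: "(\<lambda>j. \<bar>c j\<bar>) summable_on fib \<alpha>" for \<alpha>
    using summable_on_cmult_left'[of "\<rho> ^ order_of \<alpha>" "\<lambda>j. \<bar>c j\<bar>" "fib \<alpha>"] rho by simp
  then have c: "(c has_sum a \<alpha>) (fib \<alpha>)" for \<alpha>
    unfolding a_def using abs_summable_summable[of c] by (intro has_sum_infsum) simp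
  define t where "t \<alpha> = infsum (\<lambda>j. \<bar>c j\<bar>) (fib \<alpha>)" for \<alpha>
  have t: "((\<lambda>j. \<bar>c j\<bar>) has_sum t \<alpha>) (fib \<alpha>)" for \<alpha>
    unfolding t_def by (intro has_sum_infsum abs_c)
  have at: "\<bar>a \<alpha>\<bar> \<le> t \<alpha>" for \<alpha>
    using norm_has_sum_bound[of c "fib \<alpha>"] t c by simp
  have ts: "((\<lambda>\<alpha>. t \<alpha> * \<rho> ^ order_of \<alpha>) has_sum s) multi_indices"
  proof (rule has_sum_SigmaD)
    show "((\<lambda>(\<alpha>, j). \<bar>c j\<bar> * \<rho> ^ order_of (e j)) has_sum s) (Sigma multi_indices fib)"
      using maj regroup by blast
    fix \<alpha>
    have "((\<lambda>j. \<bar>c j\<bar> * \<rho> ^ order_of \<alpha>) has_sum t \<alpha> * \<rho> ^ order_of \<alpha>) (fib \<alpha>)"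
      by (rule has_sum_cmult_left[OF t])
    also have "?this \<longleftrightarrow> ((\<lambda>j. case (\<alpha>, j) of (\<alpha>, j) \<Rightarrow> \<bar>c j\<bar> * \<rho> ^ order_of (e j)) has_sum
        t \<alpha> * \<rho> ^ order_of \<alpha>) (fib \<alpha>)"
      by (rule has_sum_cong) (auto simp: fib_def)
    finally show \<dots> .
  qed
  have "(\<lambda>\<alpha>. \<bar>a \<alpha>\<bar> * \<rho> ^ order_of \<alpha>) summable_on multi_indices"
    by (rule summable_on_comparison_test[OF has_sum_imp_summable[OF ts]])
      (use rho at in \<open>auto intro: mult_right_mono\<close>)
  then obtain s' where s': "((\<lambda>\<alpha>. \<bar>a \<alpha>\<bar> * \<rho> ^ order_of \<alpha>) has_sum s') multi_indices"
    by (auto simp: summable_on_def)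
  have "s' \<le> s"
    by (rule has_sum_mono[OF s' ts]) (use rho at in \<open>auto intro: mult_right_mono\<close>)
  moreover have "((\<lambda>\<alpha>. a \<alpha> * monomial \<alpha> (y - x)) has_sum f y) multi_indices" if "y \<in> ball x \<rho>" for y
  proof (rule has_sum_SigmaD)
    show "((\<lambda>(\<alpha>, j). c j * monomial (e j) (y - x)) has_sum f y) (Sigma multi_indices fib)"
      using f[OF that] regroup by blast
    fix \<alpha>
    have "((\<lambda>j. c j * monomial \<alpha> (y - x)) has_sum a \<alpha> * monomial \<alpha> (y - x)) (fib \<alpha>)"
      by (rule has_sum_cmult_left[OF c])
    also have "?this \<longleftrightarrow> ((\<lambda>j. case (\<alpha>, j) of (\<alpha>, j) \<Rightarrow> c j * monomial (e j) (y - x)) has_sum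
        a \<alpha> * monomial \<alpha> (y - x)) (fib \<alpha>)"
      by (rule has_sum_cong) (auto simp: fib_def)
    finally show \<dots> .
  qed
  ultimately show ?thesis
    unfolding majorized_series_def using s' s by (intro exI[of _ a]) (auto intro: order_trans)
qed

lemma majorized_series_monomial:
  assumes "\<rho> > 0" "\<beta> \<in> multi_indices"
  shows "majorized_series x \<rho> (\<bar>c\<bar> * \<rho> ^ order_of \<beta>) (\<lambda>y. c * monomial \<beta> (y - x))"
  by (rule majorized_series_regroup[where J = "{()}" and c = "\<lambda>_. c" and e = "\<lambda>_. \<beta>", OF _ _ _ order_refl])
    (use assms in \<open>auto intro!: has_sum_finiteI\<close>)

lemma majorized_series_const:
  assumes "\<rho> > 0"
  shows "majorized_series x \<rho> \<bar>c\<bar> (\<lambda>y. c)"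
  using majorized_series_monomial[OF assms, of "\<lambda>b\<in>Basis. 0" x c]
  by (simp add: monomial_def order_of_def)

lemma majorized_series_coordinate:
  assumes "\<rho> > 0" "b \<in> Basis"
  shows "majorized_series x \<rho> \<rho> (\<lambda>y. (y - x) \<bullet> b)"
proof -
  define \<beta> where "\<beta> = (\<lambda>b'\<in>Basis. if b' = b then 1 else 0 :: nat)"
  have "monomial \<beta> h = (\<Prod>b'\<in>Basis. if b' = b then h \<bullet> b' else 1)" for h
    unfolding monomial_def \<beta>_def by (rule prod.cong) auto
  moreover have "order_of \<beta> = (\<Sum>b'\<in>Basis. if b' = b then 1 else 0)"
    unfolding order_of_def \<beta>_def by (rule sum.cong) auto
  ultimately show ?thesis
    using majorized_series_monomial[OF assms(1), of \<beta> x 1] assms(2)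
    by (simp add: \<beta>_def)
qed

text \<open>The bounds make the double series over \<open>n\<close> and the multi-index absolutely convergent, so that it
  may be summed in either order.\<close>

lemma majorized_series_sum:
  fixes f :: "'n \<Rightarrow> 'a::euclidean_space \<Rightarrow> real"
  assumes rho: "\<rho> > 0" and f: "\<And>n. n \<in> N \<Longrightarrow> majorized_series x \<rho> (m n) (f n)"
    and m: "(m has_sum m') N"
    and F: "\<And>y. y \<in> ball x \<rho> \<Longrightarrow> ((\<lambda>n. f n y) has_sum F y) N"
  shows "majorized_series x \<rho> m' F"
proof -
  have "\<forall>n\<in>N. \<exists>a. (\<exists>s\<le>m n. ((\<lambda>\<alpha>. \<bar>a \<alpha>\<bar> * \<rho> ^ order_of \<alpha>) has_sum s) multi_indices) \<and>
     (\<forall>y\<in>ball x \<rho>. ((\<lambda>\<alpha>. a \<alpha> * monomial \<alpha> (y - x)) has_sum f n y) multi_indices)"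
    using f unfolding majorized_series_def by blast
  from bchoice[OF this] obtain a where a:
    "\<forall>n\<in>N. (\<exists>s\<le>m n. ((\<lambda>\<alpha>. \<bar>a n \<alpha>\<bar> * \<rho> ^ order_of \<alpha>) has_sum s) multi_indices) \<and>
     (\<forall>y\<in>ball x \<rho>. ((\<lambda>\<alpha>. a n \<alpha> * monomial \<alpha> (y - x)) has_sum f n y) multi_indices)" ..
  define s where "s n = infsum (\<lambda>\<alpha>. \<bar>a n \<alpha>\<bar> * \<rho> ^ order_of \<alpha>) multi_indices" for n
  have as: "s n \<le> m n" "((\<lambda>\<alpha>. \<bar>a n \<alpha>\<bar> * \<rho> ^ order_of \<alpha>) has_sum s n) multi_indices"
      "\<And>y. y \<in> ball x \<rho> \<Longrightarrow> ((\<lambda>\<alpha>. a n \<alpha> * monomial \<alpha> (y - x)) has_sum f n y) multi_indices"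
    if "n \<in> N" for n
    using a that infsumI unfolding s_def by fastforce+
  have s0: "s n \<ge> 0" if "n \<in> N" for n
    using has_sum_nonneg[OF as(2)[OF that]] rho by simp
  have "s summable_on N"
    by (rule summable_on_comparison_test[OF has_sum_imp_summable[OF m]]) (use as(1) s0 in auto)
  then obtain s' where s': "(s has_sum s') N" by (auto simp: summable_on_def)
  let ?J = "N \<times> (multi_indices :: ('a \<Rightarrow> nat) set)"
  have sm: "(\<lambda>(n, \<alpha>). \<bar>a n \<alpha>\<bar> * \<rho> ^ order_of \<alpha>) summable_on ?J"
    by (rule summable_on_SigmaI[OF _ has_sum_imp_summable[OF s']]) (use as(2) rho in auto)
  show ?thesis
  proof (rule majorized_series_regroup[OF rho, where J = ?J and c = "\<lambda>(n, \<alpha>). a n \<alpha>" and e = snd and s = s'])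
    have "((\<lambda>(n, \<alpha>). \<bar>a n \<alpha>\<bar> * \<rho> ^ order_of \<alpha>) has_sum s') ?J"
      by (rule has_sum_SigmaI[OF _ s' sm]) (use as(2) in simp)
    then show "((\<lambda>j. \<bar>case j of (n, \<alpha>) \<Rightarrow> a n \<alpha>\<bar> * \<rho> ^ order_of (snd j)) has_sum s') ?J"
      by (simp add: case_prod_unfold)
    show "s' \<le> m'" by (rule has_sum_mono[OF s' m as(1)])
    show "((\<lambda>j. (case j of (n, \<alpha>) \<Rightarrow> a n \<alpha>) * monomial (snd j) (y - x)) has_sum F y) ?J"
      if y: "y \<in> ball x \<rho>" for y
    proof (rule has_sum_SigmaI[OF _ F[OF y]])
      show "((\<lambda>\<alpha>. (case (n, \<alpha>) of (n, \<alpha>) \<Rightarrow> a n \<alpha>) * monomial (snd (n, \<alpha>)) (y - x)) has_sum f n y)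
          multi_indices" if "n \<in> N" for n
        using as(3)[OF that y] by simp
      show "(\<lambda>j. (case j of (n, \<alpha>) \<Rightarrow> a n \<alpha>) * monomial (snd j) (y - x)) summable_on ?J"
      proof (rule abs_summable_summable, rule summable_on_comparison_test[OF sm])
        fix j assume "j \<in> ?J"
        show "norm ((case j of (n, \<alpha>) \<Rightarrow> a n \<alpha>) * monomial (snd j) (y - x)) \<le>
            (case j of (n, \<alpha>) \<Rightarrow> \<bar>a n \<alpha>\<bar> * \<rho> ^ order_of \<alpha>)"
          using y abs_monomial_le[of "y - x" \<rho> "snd j"]
          by (auto simp: case_prod_unfold abs_mult dist_norm norm_minus_commute intro!: mult_left_mono)
      qed simp
    qed
  qed auto
qed

lemma majorized_series_monomial_mult:
  assumes rho: "\<rho> > 0" and \<beta>: "\<beta> \<in> multi_indices" and g: "majorized_series x \<rho> m g"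
  shows "majorized_series x \<rho> (\<bar>c\<bar> * \<rho> ^ order_of \<beta> * m) (\<lambda>y. c * monomial \<beta> (y - x) * g y)"
proof -
  obtain a s where s: "s \<le> m" and a: "((\<lambda>\<alpha>. \<bar>a \<alpha>\<bar> * \<rho> ^ order_of \<alpha>) has_sum s) multi_indices"
    and ag: "\<And>y. y \<in> ball x \<rho> \<Longrightarrow> ((\<lambda>\<alpha>. a \<alpha> * monomial \<alpha> (y - x)) has_sum g y) multi_indices"
    using g unfolding majorized_series_def by blast
  let ?e = "\<lambda>\<alpha>. \<lambda>b\<in>Basis. \<alpha> b + \<beta> b"
  have ord: "order_of (?e \<alpha>) = order_of \<alpha> + order_of \<beta>" for \<alpha>
    by (simp add: order_of_def sum.distrib)
  have mon: "monomial (?e \<alpha>) h = monomial \<alpha> h * monomial \<beta> h" for \<alpha> h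
    by (simp add: monomial_def power_add prod.distrib)
  show ?thesis
  proof (rule majorized_series_regroup[OF rho, where J = multi_indices and c = "\<lambda>\<alpha>. c * a \<alpha>" and e = ?e
      and s = "\<bar>c\<bar> * \<rho> ^ order_of \<beta> * s"])
    show "((\<lambda>\<alpha>. \<bar>c * a \<alpha>\<bar> * \<rho> ^ order_of (?e \<alpha>)) has_sum \<bar>c\<bar> * \<rho> ^ order_of \<beta> * s) multi_indices"
      using has_sum_cmult_right[OF a, of "\<bar>c\<bar> * \<rho> ^ order_of \<beta>"]
      unfolding ord by (simp add: abs_mult power_add mult_ac)
    show "((\<lambda>\<alpha>. c * a \<alpha> * monomial (?e \<alpha>) (y - x)) has_sum c * monomial \<beta> (y - x) * g y) multi_indices"
      if "y \<in> ball x \<rho>" for y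
      using has_sum_cmult_right[OF ag[OF that], of "c * monomial \<beta> (y - x)"]
      unfolding mon by (simp add: mult_ac)
  qed (use s rho in \<open>auto intro!: mult_left_mono\<close>)
qed

text \<open>The product is the sum of the multiples of \<open>g\<close> by the single terms of \<open>f\<close>.\<close>

lemma majorized_series_mult:
  assumes rho: "\<rho> > 0" and f: "majorized_series x \<rho> m f" and g: "majorized_series x \<rho> m' g"
  shows "majorized_series x \<rho> (m * m') (\<lambda>y. f y * g y)"
proof -
  obtain a s where s: "s \<le> m" and a: "((\<lambda>\<alpha>. \<bar>a \<alpha>\<bar> * \<rho> ^ order_of \<alpha>) has_sum s) multi_indices"
    and af: "\<And>y. y \<in> ball x \<rho> \<Longrightarrow> ((\<lambda>\<alpha>. a \<alpha> * monomial \<alpha> (y - x)) has_sum f y) multi_indices"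
    using f unfolding majorized_series_def by blast
  have m': "0 \<le> m'"
  proof -
    obtain b :: "('a \<Rightarrow> nat) \<Rightarrow> real" and s' where "s' \<le> m'" "((\<lambda>\<alpha>. \<bar>b \<alpha>\<bar> * \<rho> ^ order_of \<alpha>) has_sum s') multi_indices"
      using g unfolding majorized_series_def by blast
    with has_sum_nonneg[OF this(2)] rho show ?thesis by fastforce
  qed
  have "majorized_series x \<rho> (s * m') (\<lambda>y. f y * g y)"
  proof (rule majorized_series_sum[OF rho majorized_series_monomial_mult[OF rho _ g]])
    show "((\<lambda>\<alpha>. \<bar>a \<alpha>\<bar> * \<rho> ^ order_of \<alpha> * m') has_sum s * m') multi_indices"
      by (rule has_sum_cmult_left[OF a])
    show "((\<lambda>\<alpha>. a \<alpha> * monomial \<alpha> (y - x) * g y) has_sum f y * g y) multi_indices"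
      if "y \<in> ball x \<rho>" for y
      by (rule has_sum_cmult_left[OF af[OF that]])
  qed
  moreover have "s * m' \<le> m * m'" using s m' by (rule mult_right_mono)
  ultimately show ?thesis
    unfolding majorized_series_def by (meson order_trans)
qed

lemma majorized_series_add:
  assumes rho: "\<rho> > 0" and f: "majorized_series x \<rho> m f" and g: "majorized_series x \<rho> m' g"
  shows "majorized_series x \<rho> (m + m') (\<lambda>y. f y + g y)"
  by (rule majorized_series_sum[OF rho, where N = "UNIV :: bool set"
      and f = "\<lambda>b. if b then f else g" and m = "\<lambda>b. if b then m else m'"])
    (use f g in \<open>auto simp: UNIV_bool intro!: has_sum_finiteI\<close>)

lemma majorized_series_power:
  assumes rho: "\<rho> > 0" and f: "majorized_series x \<rho> m f"
  shows "majorized_series x \<rho> (m ^ n) (\<lambda>y. f y ^ n)"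
proof (induction n)
  case 0
  show ?case using majorized_series_const[OF rho, of x 1] by simp
next
  case (Suc n)
  then show ?case using majorized_series_mult[OF rho f] by simp
qed

lemma majorized_series_bound:
  assumes "majorized_series x \<rho> m f" "y \<in> ball x \<rho>"
  shows "\<bar>f y\<bar> \<le> m"
proof -
  obtain a s where s: "s \<le> m" and a: "((\<lambda>\<alpha>. \<bar>a \<alpha>\<bar> * \<rho> ^ order_of \<alpha>) has_sum s) multi_indices"
    and af: "((\<lambda>\<alpha>. a \<alpha> * monomial \<alpha> (y - x)) has_sum f y) multi_indices"
    using assms unfolding majorized_series_def by blast
  have "norm (f y) \<le> s"
    by (rule norm_infsum_le[OF af a])
      (use assms(2) in \<open>auto simp: abs_mult dist_norm norm_minus_commute intro!: mult_left_mono abs_monomial_le\<close>)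
  with s show ?thesis by simp
qed

lemma majorized_series_geometric:
  assumes rho: "\<rho> > 0" and g: "majorized_series x \<rho> m g" and m: "m < 1"
  shows "majorized_series x \<rho> (1 / (1 - m)) (\<lambda>y. 1 / (1 - g y))"
proof (rule majorized_series_sum[OF rho majorized_series_power[OF rho g]])
  have geo: "((\<lambda>n. t ^ n) has_sum 1 / (1 - t)) UNIV" if "\<bar>t\<bar> < 1" for t :: real
    using that
    by (intro norm_summable_imp_has_sum geometric_sums) (auto simp: power_abs intro!: summable_geometric)
  have m0: "0 \<le> m" using majorized_series_bound[OF g, of x] rho by simp
  show "((\<lambda>n. m ^ n) has_sum 1 / (1 - m)) UNIV" using m0 m by (intro geo) auto
  show "((\<lambda>n. g y ^ n) has_sum 1 / (1 - g y)) UNIV" if "y \<in> ball x \<rho>" for y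
    using majorized_series_bound[OF g that] m by (intro geo) auto
qed

text \<open>Shrinking the radius by a factor \<open>t\<close> shrinks the norm by \<open>t\<close> as soon as the constant term
  vanishes, and never enlarges it.\<close>

lemma majorized_series_shrink:
  assumes rho: "\<rho> > 0" and f: "majorized_series x \<rho> m f" and t: "0 < t" "t \<le> 1"
  shows "majorized_series x (t * \<rho>) m f" and "f x = 0 \<Longrightarrow> majorized_series x (t * \<rho>) (t * m) f"
proof -
  obtain a s where s: "s \<le> m" and a: "((\<lambda>\<alpha>. \<bar>a \<alpha>\<bar> * \<rho> ^ order_of \<alpha>) has_sum s) multi_indices"
    and af: "\<And>y. y \<in> ball x \<rho> \<Longrightarrow> ((\<lambda>\<alpha>. a \<alpha> * monomial \<alpha> (y - x)) has_sum f y) multi_indices"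
    using f unfolding majorized_series_def by blast
  have sub: "ball x (t * \<rho>) \<subseteq> ball x \<rho>"
    using t rho by (intro subset_ball) (simp add: mult_le_cancel_right1)
  have le: "majorized_series x (t * \<rho>) (u * m) f"
    if u: "0 \<le> u" and le: "\<And>\<alpha>. \<alpha> \<in> multi_indices \<Longrightarrow>
      \<bar>a \<alpha>\<bar> * (t * \<rho>) ^ order_of \<alpha> \<le> u * (\<bar>a \<alpha>\<bar> * \<rho> ^ order_of \<alpha>)" for u
  proof -
    have us: "((\<lambda>\<alpha>. u * (\<bar>a \<alpha>\<bar> * \<rho> ^ order_of \<alpha>)) has_sum u * s) multi_indices"
      by (rule has_sum_cmult_right[OF a])
    have "(\<lambda>\<alpha>. \<bar>a \<alpha>\<bar> * (t * \<rho>) ^ order_of \<alpha>) summable_on multi_indices"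
      by (rule summable_on_comparison_test[OF has_sum_imp_summable[OF us] le]) (use t rho in auto)
    then obtain s' where s': "((\<lambda>\<alpha>. \<bar>a \<alpha>\<bar> * (t * \<rho>) ^ order_of \<alpha>) has_sum s') multi_indices"
      by (auto simp: summable_on_def)
    moreover have "s' \<le> u * m"
      using has_sum_mono[OF s' us le] mult_left_mono[OF s u] by simp
    ultimately show ?thesis
      unfolding majorized_series_def using af sub by blast
  qed
  have pow: "t ^ n \<le> 1" for n using t by (simp add: power_le_one)
  show "majorized_series x (t * \<rho>) m f"
  proof -
    have "\<bar>a \<alpha>\<bar> * (t * \<rho>) ^ n \<le> \<bar>a \<alpha>\<bar> * \<rho> ^ n" for \<alpha> n
      using t rho by (intro mult_left_mono power_mono) (auto simp: mult_le_cancel_right1)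
    then show ?thesis using le[of 1] by simp
  qed
  assume fx: "f x = 0"
  show "majorized_series x (t * \<rho>) (t * m) f"
  proof (rule le)
    fix \<alpha> :: "'a \<Rightarrow> nat" assume \<alpha>: "\<alpha> \<in> multi_indices"
    let ?z = "\<lambda>b\<in>(Basis :: 'a set). 0 :: nat"
    have nz: "order_of \<beta> > 0" "monomial \<beta> (0 :: 'a) = 0" if "\<beta> \<in> multi_indices" "\<beta> \<noteq> ?z" for \<beta> :: "'a \<Rightarrow> nat"
    proof -
      have "\<exists>b\<in>Basis. \<beta> b \<noteq> 0"
      proof (rule ccontr)
        assume "\<not> (\<exists>b\<in>Basis. \<beta> b \<noteq> 0)"
        then have "\<beta> = ?z"
          using that(1) by (auto simp: PiE_iff extensional_def restrict_def)
        then show False using that(2) by blast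
      qed
      then obtain b where b: "b \<in> Basis" "\<beta> b > 0" by auto
      then show "order_of \<beta> > 0"
        by (auto simp: order_of_def sum_pos2)
      show "monomial \<beta> (0 :: 'a) = 0"
        using b by (auto simp: monomial_def)
    qed
    show "\<bar>a \<alpha>\<bar> * (t * \<rho>) ^ order_of \<alpha> \<le> t * (\<bar>a \<alpha>\<bar> * \<rho> ^ order_of \<alpha>)"
    proof (cases "\<alpha> = ?z")
      case True
      have "((\<lambda>\<beta>. a \<beta> * monomial \<beta> 0) has_sum a ?z) multi_indices"
        by (rule has_sum_finite_neutralI[where B = "{?z}"]) (use nz in \<open>auto simp: monomial_def\<close>)
      moreover have "((\<lambda>\<beta>. a \<beta> * monomial \<beta> 0) has_sum 0) multi_indices"
        using af[of x] rho fx by simp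
      ultimately have "a ?z = 0" by (rule has_sum_unique)
      then show ?thesis using True by simp
    next
      case False
      then obtain n where "order_of \<alpha> = Suc n" using nz(1)[OF \<alpha>] gr0_implies_Suc by blast
      then have "t ^ order_of \<alpha> \<le> t" using pow t by (simp add: mult_left_le)
      then have "t ^ order_of \<alpha> * (\<bar>a \<alpha>\<bar> * \<rho> ^ order_of \<alpha>) \<le> t * (\<bar>a \<alpha>\<bar> * \<rho> ^ order_of \<alpha>)"
        using rho by (intro mult_right_mono) auto
      then show ?thesis by (simp add: power_mult_distrib mult_ac)
    qed
  qed (use t in simp)
qed

definition analytic_near :: "'a::euclidean_space \<Rightarrow> ('a \<Rightarrow> real) \<Rightarrow> bool" where
  "analytic_near x f \<longleftrightarrow> (\<exists>\<rho>>0. \<exists>m. majorized_series x \<rho> m f)"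

lemma analytic_nearI: "\<rho> > 0 \<Longrightarrow> majorized_series x \<rho> m f \<Longrightarrow> analytic_near x f"
  unfolding analytic_near_def by blast

lemma real_analytic_onI:
  assumes "\<And>x. x \<in> S \<Longrightarrow> analytic_near x f"
  shows "real_analytic_on f S"
  unfolding real_analytic_on_def
proof
  fix x assume "x \<in> S"
  then obtain \<rho> m where "\<rho> > 0" "majorized_series x \<rho> m f"
    using assms unfolding analytic_near_def by blast
  then obtain a where "\<forall>y\<in>ball x \<rho>. ((\<lambda>\<alpha>. a \<alpha> * monomial \<alpha> (y - x)) has_sum f y) multi_indices"
    unfolding majorized_series_def by blast
  with \<open>\<rho> > 0\<close> show "\<exists>r>0. \<exists>a :: ('a \<Rightarrow> nat) \<Rightarrow> real. \<forall>y\<in>ball x r.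
     ((\<lambda>\<alpha>. a \<alpha> * (\<Prod>b\<in>Basis. ((y - x) \<bullet> b) ^ \<alpha> b)) has_sum f y) multi_indices"
    unfolding monomial_def by (intro exI[of _ \<rho>] conjI exI[of _ a])
qed

lemma analytic_near_const: "analytic_near x (\<lambda>_. c)"
  by (rule analytic_nearI[OF zero_less_one majorized_series_const[OF zero_less_one]])

lemma analytic_near_common_radius:
  assumes "analytic_near x f" "analytic_near x g"
  obtains \<rho> m m' where "\<rho> > 0" "majorized_series x \<rho> m f" "majorized_series x \<rho> m' g"
proof -
  obtain r r' m m' where r: "r > 0" "r' > 0" "majorized_series x r m f" "majorized_series x r' m' g"
    using assms unfolding analytic_near_def by blast
  let ?\<rho> = "min r r'"
  have "majorized_series x ?\<rho> m f" "majorized_series x ?\<rho> m' g"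
    using majorized_series_shrink(1)[OF r(1,3), of "?\<rho> / r"]
      majorized_series_shrink(1)[OF r(2,4), of "?\<rho> / r'"] r by simp_all
  then show ?thesis using that[of ?\<rho>] r by simp
qed

lemma analytic_near_add:
  assumes "analytic_near x f" "analytic_near x g"
  shows "analytic_near x (\<lambda>y. f y + g y)"
  by (rule analytic_near_common_radius[OF assms]) (rule analytic_nearI[OF _ majorized_series_add])

lemma analytic_near_mult:
  assumes "analytic_near x f" "analytic_near x g"
  shows "analytic_near x (\<lambda>y. f y * g y)"
  by (rule analytic_near_common_radius[OF assms]) (rule analytic_nearI[OF _ majorized_series_mult])

lemma analytic_near_coordinate:
  assumes "b \<in> Basis"
  shows "analytic_near x (\<lambda>y. y \<bullet> b)"
proof -
  have "analytic_near x (\<lambda>y. (y - x) \<bullet> b)"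
    by (rule analytic_nearI[OF zero_less_one majorized_series_coordinate[OF zero_less_one assms]])
  from analytic_near_add[OF this analytic_near_const[of x "x \<bullet> b"]] show ?thesis
    by (simp add: inner_diff_left)
qed

text \<open>Near a point where \<open>f\<close> does not vanish, \<open>f = f(x) (1 - g)\<close> with \<open>g(x) = 0\<close>, and \<open>g\<close> has norm
  below 1 on a small ball.\<close>

lemma analytic_near_inverse:
  assumes "analytic_near x f" "f x \<noteq> 0"
  shows "analytic_near x (\<lambda>y. 1 / f y)"
proof -
  define g where "g y = 1 + (- 1 / f x) * f y" for y
  have "analytic_near x g"
    unfolding g_def by (intro analytic_near_add analytic_near_mult analytic_near_const assms)
  then obtain \<rho> m where rho: "\<rho> > 0" and g: "majorized_series x \<rho> m g"
    unfolding analytic_near_def by blast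
  have gx: "g x = 0" using assms(2) by (simp add: g_def)
  have m0: "0 \<le> m" using majorized_series_bound[OF g, of x] rho by simp
  define t where "t = 1 / (m + 2)"
  have t: "0 < t" "t \<le> 1" "t * m < 1" using m0 by (auto simp: t_def field_simps)
  have "analytic_near x (\<lambda>y. 1 / (1 - g y))"
    using rho t(1)
    by (intro analytic_nearI[OF _ majorized_series_geometric[OF _
          majorized_series_shrink(2)[OF rho g t(1,2) gx] t(3)]]) simp_all
  from analytic_near_mult[OF analytic_near_const[of x "1 / f x"] this]
  show ?thesis using assms(2) by (simp add: g_def)
qed

section \<open>Length of curves and Riemannian distance\<close>

locale smooth_riemannian = top_manifold +
  assumes smooth_transition: "i \<in> charts M \<Longrightarrow> j \<in> charts M \<Longrightarrow> smooth_on (transition M i j) (overlap M i j)"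
    and metric: "riemannian_metric M"
begin

lemma metric_bilinear: "i \<in> charts M \<Longrightarrow> z \<in> cimage M i \<Longrightarrow> bilinear (metric M i z)"
  and metric_pos: "i \<in> charts M \<Longrightarrow> z \<in> cimage M i \<Longrightarrow> v \<noteq> 0 \<Longrightarrow> 0 < metric M i z v v"
  and metric_smooth: "i \<in> charts M \<Longrightarrow> smooth_on (\<lambda>z. metric M i z v w) (cimage M i)"
  and metric_transition: "i \<in> charts M \<Longrightarrow> j \<in> charts M \<Longrightarrow> z \<in> overlap M i j \<Longrightarrow>
        metric M j (transition M i j z)
          (frechet_derivative (transition M i j) (at z) v)
          (frechet_derivative (transition M i j) (at z) w) = metric M i z v w"
  using metric unfolding riemannian_metric_def by blast+

lemma metric_nonneg:
  assumes "i \<in> charts M" "z \<in> cimage M i"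
  shows "0 \<le> metric M i z v v"
proof (cases "v = 0")
  case True
  then show ?thesis using bilinear_lzero[OF metric_bilinear[OF assms]] by simp
next
  case False
  then show ?thesis using metric_pos[OF assms] by (simp add: less_imp_le)
qed

lemma metric_expand:
  assumes "i \<in> charts M" "z \<in> cimage M i"
  shows "metric M i z v v = (\<Sum>b\<in>Basis. \<Sum>b'\<in>Basis. (v \<bullet> b) * (v \<bullet> b') * metric M i z b b')"
proof -
  have "metric M i z v v =
      metric M i z (\<Sum>b\<in>Basis. (v \<bullet> b) *\<^sub>R b) (\<Sum>b'\<in>Basis. (v \<bullet> b') *\<^sub>R b')"
    by (simp only: euclidean_representation)
  also have "\<dots> = (\<Sum>(b, b')\<in>Basis \<times> Basis. metric M i z ((v \<bullet> b) *\<^sub>R b) ((v \<bullet> b') *\<^sub>R b'))"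
    by (rule bilinear_sum[OF metric_bilinear[OF assms]])
  also have "\<dots> = (\<Sum>b\<in>Basis. \<Sum>b'\<in>Basis. (v \<bullet> b) * (v \<bullet> b') * metric M i z b b')"
    by (simp add: sum.cartesian_product bilinear_lmul[OF metric_bilinear[OF assms]]
        bilinear_rmul[OF metric_bilinear[OF assms]] mult_ac case_prod_unfold)
  finally show ?thesis .
qed

lemma continuous_on_metric:
  assumes i: "i \<in> charts M" and z: "continuous_on T z" "z ` T \<subseteq> cimage M i" and v: "continuous_on T v"
  shows "continuous_on T (\<lambda>t. metric M i (z t) (v t) (v t))"
proof -
  have "continuous_on T (\<lambda>t. metric M i (z t) b b')" for b b'
    using smooth_on_imp_continuous_on[OF metric_smooth[OF i, of b b']] z
    by (rule continuous_on_compose2)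
  then have "continuous_on T (\<lambda>t. \<Sum>b\<in>Basis. \<Sum>b'\<in>Basis. (v t \<bullet> b) * (v t \<bullet> b') * metric M i (z t) b b')"
    by (intro continuous_intros v)
  then show ?thesis
    by (rule continuous_on_eq) (use z(2) in \<open>simp add: metric_expand[OF i] image_subset_iff\<close>)
qed

lemma metric_bounded_on_compact:
  assumes i: "i \<in> charts M" and K: "compact K" "K \<subseteq> cimage M i"
  obtains C where "C \<ge> 0" "\<And>z v. z \<in> K \<Longrightarrow> sqrt (metric M i z v v) \<le> C * norm v"
proof -
  have "\<exists>B. \<forall>z\<in>K. \<bar>metric M i z b b'\<bar> \<le> B" for b b'
  proof -
    have "continuous_on K (\<lambda>z. metric M i z b b')"
      using smooth_on_imp_continuous_on[OF metric_smooth[OF i]] K(2) continuous_on_subset by blast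
    then have "bounded ((\<lambda>z. metric M i z b b') ` K)"
      using K(1) compact_continuous_image compact_imp_bounded by blast
    then show ?thesis by (simp add: bounded_iff)
  qed
  then obtain B where B: "\<And>b b' z. z \<in> K \<Longrightarrow> \<bar>metric M i z b b'\<bar> \<le> B b b'" by metis
  define S where "S = (\<Sum>b\<in>Basis. \<Sum>b'\<in>Basis. \<bar>B b b'\<bar>)"
  have "sqrt (metric M i z v v) \<le> sqrt S * norm v" if z: "z \<in> K" for z v
  proof -
    have "metric M i z v v = (\<Sum>b\<in>Basis. \<Sum>b'\<in>Basis. (v \<bullet> b) * (v \<bullet> b') * metric M i z b b')"
      using metric_expand[OF i] K(2) z by blast
    also have "\<dots> \<le> (\<Sum>b\<in>Basis. \<Sum>b'\<in>Basis. (norm v * norm v) * \<bar>B b b'\<bar>)"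
    proof (intro sum_mono)
      fix b b' :: 'c assume b: "b \<in> Basis" "b' \<in> Basis"
      have "(v \<bullet> b) * (v \<bullet> b') * metric M i z b b' \<le> \<bar>v \<bullet> b\<bar> * \<bar>v \<bullet> b'\<bar> * \<bar>metric M i z b b'\<bar>"
        by (metis abs_ge_self abs_mult)
      also have "\<dots> \<le> (norm v * norm v) * \<bar>B b b'\<bar>"
        using B[OF z, of b b'] b by (intro mult_mono Basis_le_norm) auto
      finally show "(v \<bullet> b) * (v \<bullet> b') * metric M i z b b' \<le> (norm v * norm v) * \<bar>B b b'\<bar>" .
    qed
    also have "\<dots> = S * (norm v)\<^sup>2"
      by (simp add: S_def sum_distrib_left sum_distrib_right power2_eq_square mult_ac)
    finally have "sqrt (metric M i z v v) \<le> sqrt (S * (norm v)\<^sup>2)" by simp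
    then show ?thesis by (simp add: real_sqrt_mult)
  qed
  then show ?thesis using that[of "sqrt S"] by (simp add: S_def sum_nonneg)
qed

end

text \<open>A curve on a time interval on which it is continuously differentiable, with a choice of its
  velocities \<open>D i\<close> in the charts.\<close>

locale C1_arc = smooth_riemannian M
  for M :: "('p, 'i, 'e::euclidean_space, 'z) riemannian_scheme" +
  fixes \<gamma> :: "real \<Rightarrow> 'p" and a b :: real and D :: "'i \<Rightarrow> real \<Rightarrow> 'e"
  assumes path: "pathin (mtop M) \<gamma>" and interval: "0 \<le> a" "a < b" "b \<le> 1"
    and D_cont: "i \<in> charts M \<Longrightarrow> continuous_on {t\<in>{a..b}. \<gamma> t \<in> cdom M i} (D i)"
    and D: "i \<in> charts M \<Longrightarrow> t \<in> {a..b} \<Longrightarrow> \<gamma> t \<in> cdom M i \<Longrightarrow>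
      ((cmap M i \<circ> \<gamma>) has_vector_derivative D i t) (at t within {a..b})"
begin

lemma stays_in_chart:
  assumes "i \<in> charts M" "t \<in> {a..b}" "\<gamma> t \<in> cdom M i"
  obtains d where "d > 0" "\<And>s. s \<in> {a..b} \<Longrightarrow> dist s t < d \<Longrightarrow> \<gamma> s \<in> cdom M i"
proof -
  have "openin (top_of_set {0..1}) {s \<in> {0..1}. \<gamma> s \<in> cdom M i}"
    using openin_continuous_map_preimage[OF path[unfolded pathin_def] chart_open[OF assms(1)]] by simp
  then obtain T where T: "open T" "{s \<in> {0..1}. \<gamma> s \<in> cdom M i} = {0..1} \<inter> T"
    by (auto simp: openin_open)
  have ab: "s \<in> {0..1}" if "s \<in> {a..b}" for s using that interval by auto
  then have "t \<in> T" using T(2) assms by blast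
  then obtain d where "d > 0" "ball t d \<subseteq> T" using T(1) openE by blast
  then show ?thesis using that[of d] T(2) ab by (force simp: dist_commute)
qed

lemma on_path: "t \<in> {a..b} \<Longrightarrow> \<gamma> t \<in> points M"
  using path interval by (auto simp: pathin_def continuous_map_def)

lemma chart_at_path:
  assumes "t \<in> {a..b}"
  shows "chart_at M (\<gamma> t) \<in> charts M" "\<gamma> t \<in> cdom M (chart_at M (\<gamma> t))"
  using someI_ex[of "\<lambda>i. i \<in> charts M \<and> \<gamma> t \<in> cdom M i"] points_covered[OF on_path[OF assms]]
  unfolding chart_at_def by blast+

lemma velocity_transition:
  assumes i: "i \<in> charts M" "\<gamma> t \<in> cdom M i" and j: "j \<in> charts M" "\<gamma> t \<in> cdom M j" and t: "t \<in> {a..b}"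
  shows "D j t = frechet_derivative (transition M i j) (at (cmap M i (\<gamma> t))) (D i t)"
proof -
  let ?\<tau> = "transition M i j" and ?z = "cmap M i (\<gamma> t)"
  obtain d where d: "d > 0" "\<And>s. s \<in> {a..b} \<Longrightarrow> dist s t < d \<Longrightarrow> \<gamma> s \<in> cdom M i"
    using stays_in_chart[OF i(1) t i(2)] by blast
  have "(?\<tau> has_derivative frechet_derivative ?\<tau> (at ?z)) (at ?z)"
    using smooth_on_has_frechet_derivative[OF smooth_transition[OF i(1) j(1)]] cmap_in_overlap i j by blast
  then have "(?\<tau> has_derivative frechet_derivative ?\<tau> (at ?z)) (at ?z within (cmap M i \<circ> \<gamma>) ` {a..b})"
    by (rule has_derivative_at_withinI)
  then have "((?\<tau> \<circ> (cmap M i \<circ> \<gamma>)) has_vector_derivative frechet_derivative ?\<tau> (at ?z) (D i t)) (at t within {a..b})"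
    using vector_derivative_diff_chain_within[OF D[OF i(1) t i(2)]] by simp
  then have "((cmap M j \<circ> \<gamma>) has_vector_derivative frechet_derivative ?\<tau> (at ?z) (D i t)) (at t within {a..b})"
    by (rule has_vector_derivative_transform_within[OF _ d(1) t]) (simp add: transition_cmap i(1) d(2))
  then show ?thesis
    using vector_derivative_unique_within_closed_interval[OF interval(2), of t] t D[OF j(1) t j(2)]
    by simp
qed

text \<open>The speed computed from the one-sided velocities. It is continuous on the whole closed interval,
  whereas \<open>speed\<close> uses two-sided derivatives and has no prescribed values at the end points.\<close>

definition arc_speed :: "real \<Rightarrow> real" where
  "arc_speed t = (let k = chart_at M (\<gamma> t) in sqrt (metric M k (cmap M k (\<gamma> t)) (D k t) (D k t)))"

lemma arc_speed_eq:
  assumes i: "i \<in> charts M" "\<gamma> t \<in> cdom M i" and t: "t \<in> {a..b}"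
  shows "arc_speed t = sqrt (metric M i (cmap M i (\<gamma> t)) (D i t) (D i t))"
proof -
  let ?k = "chart_at M (\<gamma> t)"
  note k = chart_at_path[OF t]
  have "metric M i (cmap M i (\<gamma> t)) (D i t) (D i t) = metric M ?k (cmap M ?k (\<gamma> t)) (D ?k t) (D ?k t)"
    using metric_transition[OF k(1) i(1) cmap_in_overlap[OF k(2) i(2)]]
    unfolding velocity_transition[OF k i t] transition_cmap[OF k] .
  then show ?thesis by (simp add: arc_speed_def Let_def)
qed

lemma continuous_on_arc_speed: "continuous_on {a..b} arc_speed"
  unfolding continuous_on_eq_continuous_within
proof
  fix t assume t: "t \<in> {a..b}"
  define i where "i = chart_at M (\<gamma> t)"
  have i: "i \<in> charts M" "\<gamma> t \<in> cdom M i" using chart_at_path[OF t] by (simp_all add: i_def)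
  obtain d where d: "d > 0" "\<And>s. s \<in> {a..b} \<Longrightarrow> dist s t < d \<Longrightarrow> \<gamma> s \<in> cdom M i"
    using stays_in_chart[OF i(1) t i(2)] by blast
  let ?A = "{a..b} \<inter> ball t d"
  have A: "s \<in> {a..b}" "\<gamma> s \<in> cdom M i" if "s \<in> ?A" for s
    using that d(2)[of s] by (auto simp: dist_commute)
  have "continuous_on ?A (cmap M i \<circ> \<gamma>)"
    unfolding continuous_on_eq_continuous_within
  proof
    fix s assume "s \<in> ?A"
    then show "continuous (at s within ?A) (cmap M i \<circ> \<gamma>)"
      using continuous_within_subset[OF has_vector_derivative_continuous[OF D[OF i(1) A]]] by blast
  qed
  moreover have "continuous_on ?A (D i)"
    by (rule continuous_on_subset[OF D_cont[OF i(1)]]) (use A in blast)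
  ultimately have cont: "continuous_on ?A (\<lambda>s. sqrt (metric M i ((cmap M i \<circ> \<gamma>) s) (D i s) (D i s)))"
    using A(2) cmap_in by (intro continuous_on_real_sqrt continuous_on_metric i) auto
  have "arc_speed s = sqrt (metric M i ((cmap M i \<circ> \<gamma>) s) (D i s) (D i s))" if "s \<in> ?A" for s
    using arc_speed_eq[OF i(1)] A[OF that] by simp
  then have "continuous_on ?A arc_speed" by (intro continuous_on_eq[OF cont]) simp
  moreover have "t \<in> ?A" using t d(1) by simp
  ultimately have "continuous (at t within ?A) arc_speed"
    unfolding continuous_on_eq_continuous_within by blast
  moreover have "at t within ?A = at t within {a..b}"
  proof (rule at_within_nhd)
    show "t \<in> ball t d" using d(1) by simp
    show "?A \<inter> ball t d - {t} = {a..b} \<inter> ball t d - {t}" by blast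
  qed (rule open_ball)
  ultimately show "continuous (at t within {a..b}) arc_speed" by argo
qed

lemma speed_eq_arc_speed:
  assumes "t \<in> {a<..<b}"
  shows "speed M \<gamma> t = arc_speed t"
proof -
  have t: "t \<in> {a..b}" using assms by auto
  have "((cmap M k \<circ> \<gamma>) has_vector_derivative D k t) (at t)"
    if "k = chart_at M (\<gamma> t)" for k
    using D[OF _ t, of k] chart_at_path[OF t] assms that by (simp add: at_within_Icc_at)
  then show ?thesis
    by (simp add: speed_def arc_speed_def Let_def vector_derivative_at)
qed

lemma speed_integrable: "speed M \<gamma> integrable_on {a..b}"
  and integral_speed: "integral {a..b} (speed M \<gamma>) = integral {a..b} arc_speed"
proof -
  have eq: "speed M \<gamma> t = arc_speed t" if "t \<in> {a..b} - {a, b}" for t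
    using speed_eq_arc_speed that by auto
  show "speed M \<gamma> integrable_on {a..b}"
    by (rule integrable_spike_finite[of "{a, b}", OF _ eq
          integrable_continuous_real[OF continuous_on_arc_speed]]) auto
  show "integral {a..b} (speed M \<gamma>) = integral {a..b} arc_speed"
    by (rule integral_spike[of "{a, b}"]) (use eq in auto)
qed

text \<open>The curve \<open>u \<circ> \<gamma>\<close> has velocity at most \<open>K\<close> times the speed of \<open>\<gamma>\<close>, and the primitive of the speed
  is the length; the mean value inequality compares the two.\<close>

lemma displacement_le_length:
  fixes u :: "'p \<Rightarrow> 'b::real_normed_vector"
  assumes u: "\<And>i z. i \<in> charts M \<Longrightarrow> z \<in> cimage M i \<Longrightarrow>
      \<exists>U. ((u \<circ> cinv M i) has_derivative U) (at z) \<and> (\<forall>v. norm (U v) \<le> K * sqrt (metric M i z v v))"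
  shows "dist (u (\<gamma> a)) (u (\<gamma> b)) \<le> K * integral {a..b} (speed M \<gamma>)"
proof -
  have "\<exists>d. ((u \<circ> \<gamma>) has_vector_derivative d) (at t within {a..b}) \<and> norm d \<le> K * arc_speed t"
    if t: "t \<in> {a..b}" for t
  proof -
    define i where "i = chart_at M (\<gamma> t)"
    have i: "i \<in> charts M" "\<gamma> t \<in> cdom M i" using chart_at_path[OF t] by (simp_all add: i_def)
    obtain r where r: "r > 0" "\<And>s. s \<in> {a..b} \<Longrightarrow> dist s t < r \<Longrightarrow> \<gamma> s \<in> cdom M i"
      using stays_in_chart[OF i(1) t i(2)] by blast
    obtain U where U: "((u \<circ> cinv M i) has_derivative U) (at (cmap M i (\<gamma> t)))"
      "norm (U v) \<le> K * sqrt (metric M i (cmap M i (\<gamma> t)) v v)" for v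
      using u[OF i(1) cmap_in[OF i(2)]] by blast
    have "(((u \<circ> cinv M i) \<circ> (cmap M i \<circ> \<gamma>)) has_vector_derivative U (D i t)) (at t within {a..b})"
      using vector_derivative_diff_chain_within[OF D[OF i(1) t i(2)], of "u \<circ> cinv M i" U]
        has_derivative_at_withinI[OF U(1)] unfolding comp_apply by blast
    then have "((u \<circ> \<gamma>) has_vector_derivative U (D i t)) (at t within {a..b})"
      by (rule has_vector_derivative_transform_within[OF _ r(1) t]) (simp add: cinv_cmap i(1) r(2))
    moreover have "norm (U (D i t)) \<le> K * arc_speed t"
      using U(2)[of "D i t"] by (simp add: arc_speed_eq[OF i t])
    ultimately show ?thesis by blast
  qed
  then obtain d where d: "\<And>t. t \<in> {a..b} \<Longrightarrow> ((u \<circ> \<gamma>) has_vector_derivative d t) (at t within {a..b})"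
    "\<And>t. t \<in> {a..b} \<Longrightarrow> norm (d t) \<le> K * arc_speed t"
    by metis
  have phi: "((\<lambda>x. K * integral {a..x} arc_speed) has_vector_derivative K * arc_speed t) (at t within {a..b})"
    if "t \<in> {a..b}" for t
    using has_vector_derivative_mult_right[OF integral_has_vector_derivative[OF continuous_on_arc_speed that]] .
  have "norm ((u \<circ> \<gamma>) b - (u \<circ> \<gamma>) a) \<le> K * integral {a..b} arc_speed - K * integral {a..a} arc_speed"
  proof (rule differentiable_bound_general[OF interval(2)])
    show "continuous_on {a..b} (u \<circ> \<gamma>)"
      unfolding continuous_on_eq_continuous_within using d(1) has_vector_derivative_continuous by blast
    show "continuous_on {a..b} (\<lambda>x. K * integral {a..x} arc_speed)"
      unfolding continuous_on_eq_continuous_within using phi has_vector_derivative_continuous by blast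
    fix t assume t: "a < t" "t < b"
    then have "at t within {a..b} = at t" by (simp add: at_within_Icc_at)
    then show "((u \<circ> \<gamma>) has_vector_derivative d t) (at t)"
      "((\<lambda>x. K * integral {a..x} arc_speed) has_vector_derivative K * arc_speed t) (at t)"
      "norm (d t) \<le> K * arc_speed t"
      using d[of t] phi[of t] t by simp_all
  qed
  then show ?thesis by (simp add: integral_speed dist_norm norm_minus_commute)
qed

end

text \<open>Estimates for a piecewise differentiable curve are first proved on the arcs between its break
  points and then added up.\<close>

lemma interval_subdivision_induct:
  fixes l r :: real
  assumes "finite S" "l < r"
    and arc: "\<And>a b. l \<le> a \<Longrightarrow> a < b \<Longrightarrow> b \<le> r \<Longrightarrow> {a<..<b} \<inter> S = {} \<Longrightarrow> Q a b"
    and join: "\<And>a b c. a < b \<Longrightarrow> b < c \<Longrightarrow> Q a b \<Longrightarrow> Q b c \<Longrightarrow> Q a c"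
  shows "Q l r"
  using assms(2) arc
proof (induction "card ({l<..<r} \<inter> S)" arbitrary: l r rule: less_induct)
  case less
  show ?case
  proof (cases "{l<..<r} \<inter> S = {}")
    case True
    then show ?thesis using less.prems by simp
  next
    case False
    then obtain s where s: "l < s" "s < r" "s \<in> S" by auto
    have fin: "finite ({l<..<r} \<inter> S)" using assms(1) by simp
    have "{l<..<s} \<inter> S \<subset> {l<..<r} \<inter> S" "{s<..<r} \<inter> S \<subset> {l<..<r} \<inter> S" using s by auto
    from this[THEN psubset_card_mono[OF fin]] have "Q l s" "Q s r"
      using less.hyps[of l s] less.hyps[of s r] less.prems s by auto
    then show ?thesis using join s by blast
  qed
qed

context smooth_riemannian
begin

lemma C1_arcI:
  assumes "pathin (mtop M) \<gamma>" "0 \<le> a" "a < b" "b \<le> 1" "C1_curve_on M a b \<gamma>"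
  obtains D where "C1_arc M \<gamma> a b D"
proof -
  have "\<forall>i\<in>charts M. \<exists>D. continuous_on {t\<in>{a..b}. \<gamma> t \<in> cdom M i} D \<and>
        (\<forall>t\<in>{t\<in>{a..b}. \<gamma> t \<in> cdom M i}. ((cmap M i \<circ> \<gamma>) has_vector_derivative D t) (at t within {a..b}))"
    using assms(5) by (simp add: C1_curve_on_def)
  from bchoice[OF this] obtain D where D: "\<forall>i\<in>charts M. continuous_on {t\<in>{a..b}. \<gamma> t \<in> cdom M i} (D i) \<and>
        (\<forall>t\<in>{t\<in>{a..b}. \<gamma> t \<in> cdom M i}. ((cmap M i \<circ> \<gamma>) has_vector_derivative D i t) (at t within {a..b}))" ..
  have "C1_arc M \<gamma> a b D" by unfold_locales (use assms D in auto)
  then show ?thesis using that by blast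
qed

lemma displacement_le_curve_length:
  fixes u :: "'a \<Rightarrow> 'v::real_normed_vector"
  assumes u: "\<And>i z. i \<in> charts M \<Longrightarrow> z \<in> cimage M i \<Longrightarrow>
      \<exists>U. ((u \<circ> cinv M i) has_derivative U) (at z) \<and> (\<forall>v. norm (U v) \<le> K * sqrt (metric M i z v v))"
    and \<gamma>: "piecewise_C1_curve M \<gamma>"
  shows "dist (u (\<gamma> 0)) (u (\<gamma> 1)) \<le> K * integral {0..1} (speed M \<gamma>)"
proof -
  obtain S where S: "finite S" "pathin (mtop M) \<gamma>"
    "\<And>a b. 0 \<le> a \<Longrightarrow> a < b \<Longrightarrow> b \<le> 1 \<Longrightarrow> {a<..<b} \<inter> S = {} \<Longrightarrow> C1_curve_on M a b \<gamma>"
    using \<gamma> unfolding piecewise_C1_curve_def by blast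
  define Q where "Q a b \<longleftrightarrow> speed M \<gamma> integrable_on {a..b} \<and>
      dist (u (\<gamma> a)) (u (\<gamma> b)) \<le> K * integral {a..b} (speed M \<gamma>)" for a b
  have "Q 0 1"
  proof (rule interval_subdivision_induct[OF S(1)])
    fix a b :: real assume ab: "0 \<le> a" "a < b" "b \<le> 1" "{a<..<b} \<inter> S = {}"
    obtain D where "C1_arc M \<gamma> a b D" using C1_arcI[OF S(2) ab(1-3) S(3)[OF ab]] .
    then interpret C1_arc M \<gamma> a b D .
    show "Q a b" unfolding Q_def using speed_integrable displacement_le_length[OF u] by blast
  next
    fix a b c assume abc: "a < b" "b < c" and Q: "Q a b" "Q b c"
    have "speed M \<gamma> integrable_on {a..c}"
      using Q abc by (intro Henstock_Kurzweil_Integration.integrable_combine[of a b c]) (auto simp: Q_def)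
    moreover from this have "integral {a..c} (speed M \<gamma>) =
        integral {a..b} (speed M \<gamma>) + integral {b..c} (speed M \<gamma>)"
      using abc Henstock_Kurzweil_Integration.integral_combine[of a b c "speed M \<gamma>"] by simp
    moreover have "dist (u (\<gamma> a)) (u (\<gamma> c)) \<le> dist (u (\<gamma> a)) (u (\<gamma> b)) + dist (u (\<gamma> b)) (u (\<gamma> c))"
      by (rule dist_triangle)
    ultimately show "Q a c" using Q by (simp add: Q_def distrib_left)
  qed simp
  then show ?thesis by (simp add: Q_def)
qed

lemma speed_nonneg:
  assumes "\<gamma> t \<in> points M"
  shows "0 \<le> speed M \<gamma> t"
  using someI_ex[of "\<lambda>i. i \<in> charts M \<and> \<gamma> t \<in> cdom M i"] points_covered[OF assms]
  by (auto simp: speed_def Let_def chart_at_def intro!: metric_nonneg cmap_in)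

lemma length_nonneg:
  assumes "piecewise_C1_curve M \<gamma>"
  shows "0 \<le> integral {0..1} (speed M \<gamma>)"
proof (cases "speed M \<gamma> integrable_on {0..1}")
  case True
  have "\<gamma> t \<in> points M" if "t \<in> {0..1}" for t
    using assms that by (auto simp: piecewise_C1_curve_def pathin_def continuous_map_def)
  then show ?thesis using True speed_nonneg by (intro integral_nonneg) auto
next
  case False
  then show ?thesis by (simp add: not_integrable_integral)
qed

text \<open>The distance of two points is an infimum over the curves between them and carries information only
  if there are such curves.\<close>

definition joined :: "'a \<Rightarrow> 'a \<Rightarrow> bool" where
  "joined p q \<longleftrightarrow> (\<exists>\<gamma>. piecewise_C1_curve M \<gamma> \<and> \<gamma> 0 = p \<and> \<gamma> 1 = q)"

lemma dist_le_riemannian_dist: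
  fixes u :: "'a \<Rightarrow> 'v::real_normed_vector"
  assumes u: "\<And>i z. i \<in> charts M \<Longrightarrow> z \<in> cimage M i \<Longrightarrow>
      \<exists>U. ((u \<circ> cinv M i) has_derivative U) (at z) \<and> (\<forall>v. norm (U v) \<le> K * sqrt (metric M i z v v))"
    and "joined p q" and K: "K > 0"
  shows "dist (u p) (u q) \<le> K * riemannian_dist M p q"
proof -
  have "dist (u p) (u q) / K \<le> riemannian_dist M p q"
    unfolding riemannian_dist_def
  proof (rule cInf_greatest)
    show "{integral {0..1} (speed M \<gamma>) |\<gamma>. piecewise_C1_curve M \<gamma> \<and> \<gamma> 0 = p \<and> \<gamma> 1 = q} \<noteq> {}"
      using assms(2) by (auto simp: joined_def)
  qed (use displacement_le_curve_length[OF u] K in \<open>auto simp: divide_le_eq mult.commute\<close>)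
  then show ?thesis using K by (simp add: divide_le_eq mult.commute)
qed

lemma riemannian_dist_nonneg:
  assumes "joined p q"
  shows "0 \<le> riemannian_dist M p q"
  unfolding riemannian_dist_def
  by (rule cInf_greatest) (use assms length_nonneg in \<open>auto simp: joined_def\<close>)

lemma riemannian_dist_le:
  assumes "piecewise_C1_curve M \<gamma>"
  shows "riemannian_dist M (\<gamma> 0) (\<gamma> 1) \<le> integral {0..1} (speed M \<gamma>)"
  unfolding riemannian_dist_def
  by (rule cInf_lower) (use assms length_nonneg in \<open>auto intro!: bdd_belowI[of _ 0]\<close>)

text \<open>Segments in a chart provide the upper bounds for distances. In every other chart the velocity of a
  segment is the image of its direction under the derivative of the transition map, hence continuous.\<close>

lemma chart_segment:
  assumes i: "i \<in> charts M" and seg: "closed_segment x y \<subseteq> cimage M i"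
  shows "piecewise_C1_curve M (\<lambda>t. cinv M i (linepath x y t))"
    and "(\<And>z. z \<in> closed_segment x y \<Longrightarrow> sqrt (metric M i z (y - x) (y - x)) \<le> B) \<Longrightarrow>
      integral {0..1} (speed M (\<lambda>t. cinv M i (linepath x y t))) \<le> B"
proof -
  let ?\<gamma> = "\<lambda>t. cinv M i (linepath x y t)"
  have in_i: "linepath x y t \<in> cimage M i" if "t \<in> {0..1}" for t
    using that seg linepath_in_path by fastforce
  have path: "pathin (mtop M) ?\<gamma>"
    unfolding pathin_def
    by (rule continuous_map_compose[OF _ continuous_map_cinv[OF i], unfolded o_def])
      (use in_i in \<open>auto simp: continuous_map_in_subtopology image_subset_iff intro!: continuous_intros\<close>)
  define D where "D j t = frechet_derivative (transition M i j) (at (linepath x y t)) (y - x)" for j t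
  have arc: "C1_arc M ?\<gamma> 0 1 D"
  proof unfold_locales
    fix j assume j: "j \<in> charts M"
    have ov: "linepath x y t \<in> overlap M i j" if "t \<in> {0..1}" "?\<gamma> t \<in> cdom M j" for t
      using cmap_in_overlap[OF cinv_in[OF in_i[OF that(1)]] that(2)] cmap_cinv[OF in_i[OF that(1)]] by simp
    have "continuous_on (overlap M i j) (\<lambda>z. frechet_derivative (transition M i j) (at z) (y - x))"
      by (rule smooth_on_imp_continuous_on[OF smooth_on_frechet_derivative[OF smooth_transition[OF i j]]])
    then show "continuous_on {t\<in>{0..1}. ?\<gamma> t \<in> cdom M j} (D j)"
      unfolding D_def by (rule continuous_on_compose2) (use ov in \<open>auto intro!: continuous_intros\<close>)
    fix t :: real assume t: "t \<in> {0..1}" "?\<gamma> t \<in> cdom M j"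
    have "(linepath x y has_vector_derivative y - x) (at t within {0..1})"
      by (rule has_vector_derivative_linepath_within)
    moreover have "(transition M i j has_derivative frechet_derivative (transition M i j) (at (linepath x y t)))
        (at (linepath x y t) within linepath x y ` {0..1})"
      using smooth_on_has_frechet_derivative[OF smooth_transition[OF i j] ov[OF t]]
      by (rule has_derivative_at_withinI)
    ultimately have "((transition M i j \<circ> linepath x y) has_vector_derivative D j t) (at t within {0..1})"
      unfolding D_def by (rule vector_derivative_diff_chain_within)
    then show "((cmap M j \<circ> ?\<gamma>) has_vector_derivative D j t) (at t within {0..1})"
      by (simp add: transition_def o_def)
  qed (use path in auto)
  then interpret C1_arc M ?\<gamma> 0 1 D .
  have "C1_curve_on M a b ?\<gamma>" if "0 \<le> a" "b \<le> 1" for a b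
    unfolding C1_curve_on_def
  proof (intro ballI exI conjI)
    fix j assume j: "j \<in> charts M"
    show "continuous_on {t \<in> {a..b}. ?\<gamma> t \<in> cdom M j} (D j)"
      by (rule continuous_on_subset[OF D_cont[OF j]]) (use that in auto)
    show "((cmap M j \<circ> ?\<gamma>) has_vector_derivative D j t) (at t within {a..b})"
      if "t \<in> {t \<in> {a..b}. ?\<gamma> t \<in> cdom M j}" for t
      by (rule has_vector_derivative_within_subset[OF D[OF j]]) (use that \<open>0 \<le> a\<close> \<open>b \<le> 1\<close> in auto)
  qed
  with path show "piecewise_C1_curve M ?\<gamma>"
    unfolding piecewise_C1_curve_def by blast
  assume B: "\<And>z. z \<in> closed_segment x y \<Longrightarrow> sqrt (metric M i z (y - x) (y - x)) \<le> B"
  have "arc_speed t \<le> B" if t: "t \<in> {0..1}" for t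
  proof -
    have z: "cmap M i (?\<gamma> t) = linepath x y t" "?\<gamma> t \<in> cdom M i"
      using cmap_cinv cinv_in in_i[OF t] by auto
    have "((cmap M i \<circ> ?\<gamma>) has_vector_derivative y - x) (at t within {0..1})"
      by (rule has_vector_derivative_transform[OF t _ has_vector_derivative_linepath_within])
        (simp add: cmap_cinv in_i)
    then have "D i t = y - x"
      using vector_derivative_unique_within_closed_interval[of 0 1 t] t D[OF i t z(2)] by simp
    then show ?thesis
      using B[OF linepath_in_path[OF t]] by (simp add: arc_speed_eq[OF i z(2) t] z(1))
  qed
  then have "integral {0..1} arc_speed \<le> integral {0..1} (\<lambda>_ :: real. B)"
    using continuous_on_arc_speed by (intro integral_le integrable_continuous_real) auto
  then show "integral {0..1} (speed M ?\<gamma>) \<le> B" by (simp add: integral_speed)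
qed

lemma joined_in_chart:
  assumes "i \<in> charts M" "p \<in> cdom M i" "q \<in> cdom M i"
    and "closed_segment (cmap M i p) (cmap M i q) \<subseteq> cimage M i"
  shows "joined p q"
  unfolding joined_def using chart_segment(1)[OF assms(1,4)] assms(1-3)
  by (intro exI[of _ "\<lambda>t. cinv M i (linepath (cmap M i p) (cmap M i q) t)"])
    (simp add: linepath_0' linepath_1' cinv_cmap)

text \<open>On a small closed ball of a chart the metric is at most a multiple of the Euclidean one, so
  segments ending at the limit point become short.\<close>

lemma riemannian_dist_tendsto_0:
  assumes i: "i \<in> charts M" "l \<in> cdom M i"
    and \<sigma>: "eventually (\<lambda>n. \<sigma> n \<in> cdom M i) sequentially" "(\<lambda>n. cmap M i (\<sigma> n)) \<longlonglongrightarrow> cmap M i l"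
  shows "(\<lambda>n. riemannian_dist M (\<sigma> n) l) \<longlonglongrightarrow> 0"
proof -
  obtain r where r: "r > 0" "cball (cmap M i l) r \<subseteq> cimage M i"
    using cimage_open[OF i(1)] cmap_in[OF i(2)] open_contains_cball by blast
  obtain C where C: "C \<ge> 0" "\<And>z v. z \<in> cball (cmap M i l) r \<Longrightarrow> sqrt (metric M i z v v) \<le> C * norm v"
    using metric_bounded_on_compact[OF i(1) compact_cball r(2)] by blast
  have close: "eventually (\<lambda>n. dist (cmap M i (\<sigma> n)) (cmap M i l) < r) sequentially"
    using \<sigma>(2) r(1) by (simp add: tendsto_iff)
  have bound: "eventually (\<lambda>n. norm (riemannian_dist M (\<sigma> n) l) \<le> C * norm (cmap M i l - cmap M i (\<sigma> n))) sequentially"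
    using \<sigma>(1) close
  proof eventually_elim
    case (elim n)
    let ?x = "cmap M i (\<sigma> n)" and ?y = "cmap M i l"
    have seg: "closed_segment ?x ?y \<subseteq> cball ?y r"
      using elim(2) r(1) by (intro closed_segment_subset) (auto simp: dist_commute)
    let ?\<gamma> = "\<lambda>t. cinv M i (linepath ?x ?y t)"
    have \<gamma>: "piecewise_C1_curve M ?\<gamma>" "?\<gamma> 0 = \<sigma> n" "?\<gamma> 1 = l"
      using chart_segment(1)[OF i(1) order_trans[OF seg r(2)]] elim(1) i
      by (simp_all add: linepath_0' linepath_1' cinv_cmap)
    have "integral {0..1} (speed M ?\<gamma>) \<le> C * norm (?y - ?x)"
      by (rule chart_segment(2)[OF i(1) order_trans[OF seg r(2)]]) (use C(2) seg in blast)
    then have "riemannian_dist M (\<sigma> n) l \<le> C * norm (?y - ?x)"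
      using riemannian_dist_le[OF \<gamma>(1)] \<gamma>(2,3) by simp
    moreover have "0 \<le> riemannian_dist M (\<sigma> n) l"
      by (rule riemannian_dist_nonneg) (use \<gamma> in \<open>auto simp: joined_def\<close>)
    ultimately show ?case by simp
  qed
  have "(\<lambda>n. C * norm (cmap M i l - cmap M i (\<sigma> n))) \<longlonglongrightarrow> C * norm (cmap M i l - cmap M i l)"
    by (intro tendsto_intros \<sigma>(2))
  then show ?thesis
    by (intro Lim_null_comparison[OF bound]) simp
qed

text \<open>Completeness is thus detected by a Lipschitz map \<open>u\<close> into a complete space along which limits
  can be pulled back.\<close>

lemma complete_manifoldI:
  fixes u :: "'a \<Rightarrow> 'v::banach"
  assumes joined: "\<And>p q. p \<in> points M \<Longrightarrow> q \<in> points M \<Longrightarrow> joined p q"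
    and u: "\<And>i z. i \<in> charts M \<Longrightarrow> z \<in> cimage M i \<Longrightarrow>
      \<exists>U. ((u \<circ> cinv M i) has_derivative U) (at z) \<and> (\<forall>v. norm (U v) \<le> K * sqrt (metric M i z v v))"
    and K: "K > 0"
    and lim: "\<And>\<sigma> x. range \<sigma> \<subseteq> points M \<Longrightarrow> (\<lambda>n :: nat. u (\<sigma> n)) \<longlonglongrightarrow> x \<Longrightarrow>
      \<exists>i\<in>charts M. \<exists>l\<in>cdom M i. eventually (\<lambda>n. \<sigma> n \<in> cdom M i) sequentially \<and>
        (\<lambda>n. cmap M i (\<sigma> n)) \<longlonglongrightarrow> cmap M i l"
  shows "complete_manifold M"
  unfolding complete_manifold_def
proof (intro allI impI, elim conjE)
  fix \<sigma> :: "nat \<Rightarrow> 'a"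
  assume ran: "range \<sigma> \<subseteq> points M"
    and cauchy: "\<forall>e>0. \<exists>N. \<forall>m\<ge>N. \<forall>n\<ge>N. riemannian_dist M (\<sigma> m) (\<sigma> n) < e"
  have "Cauchy (\<lambda>n. u (\<sigma> n))"
  proof (rule metric_CauchyI)
    fix e :: real assume "e > 0"
    then have "e / K > 0" using K by simp
    then obtain N where N: "\<And>m n. m \<ge> N \<Longrightarrow> n \<ge> N \<Longrightarrow> riemannian_dist M (\<sigma> m) (\<sigma> n) < e / K"
      using cauchy by blast
    have "dist (u (\<sigma> m)) (u (\<sigma> n)) < e" if "m \<ge> N" "n \<ge> N" for m n
    proof -
      have "dist (u (\<sigma> m)) (u (\<sigma> n)) \<le> K * riemannian_dist M (\<sigma> m) (\<sigma> n)"
        using ran by (intro dist_le_riemannian_dist[OF u] joined K) auto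
      also have "\<dots> < K * (e / K)" using N[OF that] K by (intro mult_strict_left_mono)
      finally show ?thesis using K by simp
    qed
    then show "\<exists>N. \<forall>m\<ge>N. \<forall>n\<ge>N. dist (u (\<sigma> m)) (u (\<sigma> n)) < e" by blast
  qed
  then obtain x where "(\<lambda>n. u (\<sigma> n)) \<longlonglongrightarrow> x"
    using Cauchy_convergent convergent_def by blast
  from lim[OF ran this] obtain i l where "i \<in> charts M" "l \<in> cdom M i"
    "eventually (\<lambda>n. \<sigma> n \<in> cdom M i) sequentially" "(\<lambda>n. cmap M i (\<sigma> n)) \<longlonglongrightarrow> cmap M i l"
    by blast
  then show "\<exists>l\<in>points M. (\<lambda>n. riemannian_dist M (\<sigma> n) l) \<longlonglongrightarrow> 0"
    using riemannian_dist_tendsto_0 cdom_subset by blast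
qed

end

section \<open>The dually flat models\<close>

lemma second_countable_top_of_set:
  "second_countable_top (top_of_set (S :: 'a::second_countable_topology set))"
proof -
  obtain B :: "'a set set" where B: "countable B" "topological_basis B"
    using ex_countable_basis by blast
  show ?thesis
    unfolding second_countable_top_def
  proof (rule exI[of _ "(\<lambda>b. S \<inter> b) ` B"], intro conjI allI impI ballI)
    show "countable ((\<lambda>b. S \<inter> b) ` B)" using B(1) by simp
    show "openin (top_of_set S) V" if "V \<in> (\<lambda>b. S \<inter> b) ` B" for V
      using that B(2) topological_basis_open by (auto intro: openin_open_Int)
    fix U assume "openin (top_of_set S) U"
    then obtain T where T: "open T" "U = S \<inter> T" by (auto simp: openin_open)
    then obtain C where "C \<subseteq> B" "\<Union>C = T"
      using B(2) unfolding topological_basis_def by blast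
    then show "\<exists>C\<subseteq>(\<lambda>b. S \<inter> b) ` B. U = \<Union>C"
      using T(2) by (intro exI[of _ "(\<lambda>b. S \<inter> b) ` C"]) auto
  qed
qed

lemma smooth_on_cosh: "smooth_on (cosh :: real \<Rightarrow> real) UNIV"
  and smooth_on_sinh: "smooth_on (sinh :: real \<Rightarrow> real) UNIV"
proof -
  have e: "smooth_on (exp :: real \<Rightarrow> real) UNIV" by (rule smooth_on_exp)
  have e': "smooth_on (\<lambda>x :: real. exp (- x)) UNIV"
    by (rule smooth_on_compose[OF _ _ _ e smooth_on_bounded_linear])
      (auto intro: bounded_linear_minus bounded_linear_ident)
  have "smooth_on (\<lambda>x :: real. (1/2) * (exp x + exp (- x))) UNIV"
    by (intro smooth_on_mult smooth_on_add smooth_on_const e e' open_UNIV)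
  then show "smooth_on (cosh :: real \<Rightarrow> real) UNIV" by (simp add: cosh_def[abs_def])
  have "smooth_on (\<lambda>x :: real. (1/2) * (exp x + (- 1) * exp (- x))) UNIV"
    by (intro smooth_on_mult smooth_on_add smooth_on_const e e' open_UNIV)
  then show "smooth_on (sinh :: real \<Rightarrow> real) UNIV" by (simp add: sinh_def[abs_def])
qed

lemma open_model_set: "open (model_set c)"
  and connected_model_set: "connected (model_set c)"
  by (auto simp: model_set_def)

lemma model_metric_pos: "\<theta> \<in> model_set c \<Longrightarrow> 0 < model_metric c \<theta>"
  by (auto simp: model_set_def model_metric_def divide_neg_neg mult_neg_pos split: if_splits)

lemma smooth_on_model_metric: "smooth_on (model_metric c) (model_set c)"
proof -
  consider "c > 0" | "c = 0" | "c < 0" by linarith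
  then show ?thesis
  proof cases
    case 1
    have "smooth_on (\<lambda>\<theta> :: real. (1 / c) * inverse (cosh \<theta> * cosh \<theta>)) UNIV"
      by (intro smooth_on_mult smooth_on_inverse' smooth_on_const smooth_on_cosh) auto
    moreover have "model_metric c = (\<lambda>\<theta>. (1 / c) * inverse (cosh \<theta> * cosh \<theta>))"
      using 1 by (simp add: model_metric_def fun_eq_iff power2_eq_square divide_simps)
    ultimately show ?thesis using 1 by (simp add: model_set_def)
  next
    case 2
    then show ?thesis using smooth_on_exp[where 'a = real] by (simp add: model_metric_def[abs_def] model_set_def)
  next
    case 3
    have "smooth_on (\<lambda>\<theta> :: real. (- 1 / c) * inverse (sinh \<theta> * sinh \<theta>)) {..<0}"
      by (intro smooth_on_mult smooth_on_inverse' smooth_on_const smooth_on_subset[OF smooth_on_sinh]) auto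
    moreover have "model_metric c = (\<lambda>\<theta>. (- 1 / c) * inverse (sinh \<theta> * sinh \<theta>))"
      using 3 by (simp add: model_metric_def fun_eq_iff power2_eq_square divide_simps)
    ultimately show ?thesis using 3 by (simp add: model_set_def)
  qed
qed

lemma model_simps [simp]:
  "mtop (model c) = top_of_set (model_set c)" "charts (model c) = {()}"
  "cdom (model c) i = model_set c" "cmap (model c) i = vec"
  "metric (model c) i x u v = model_metric c (x $ 1) * (u $ 1) * (v $ 1)"
  "conn (model c) i x u v = 0"
  "cimage (model c) i = {x. x $ 1 \<in> model_set c}"
  by (simp_all add: model_def cimage_def vec_image_1)

lemma cinv_model: "x $ 1 \<in> model_set c \<Longrightarrow> cinv (model c) i x = x $ 1"
  unfolding cinv_def by (rule inv_into_f_eq) (auto simp: inj_on_def vec_nth_1)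

lemma transition_model: "x $ 1 \<in> model_set c \<Longrightarrow> transition (model c) i j x = x"
  by (simp add: transition_def cinv_model vec_nth_1)

lemma overlap_model [simp]: "overlap (model c) i j = {x. x $ 1 \<in> model_set c}"
  by (simp add: overlap_def vec_image_1)

lemma open_model_cimage: "open {x :: real^1. x $ 1 \<in> model_set c}"
  by (rule open_nth_1[OF open_model_set])

lemma frechet_derivative_transform_open:
  assumes "open S" "x \<in> S" "\<And>y. y \<in> S \<Longrightarrow> f y = g y"
  shows "frechet_derivative f (at x) = frechet_derivative g (at x)"
proof -
  have "(f has_derivative D) (at x) \<longleftrightarrow> (g has_derivative D) (at x)" for D
    using has_derivative_transform_within_open[OF _ assms(1,2)] assms(3) by metis
  then show ?thesis by (simp add: frechet_derivative_def)
qed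

lemma frechet_transition_model:
  assumes "x $ 1 \<in> model_set c"
  shows "frechet_derivative (transition (model c) i j) (at x) = (\<lambda>v. v)"
  using frechet_derivative_transform_open[OF open_model_cimage, of x c _ "\<lambda>x. x"] assms
  by (simp add: transition_model)

lemma smooth_manifold_model: "smooth_manifold (model c)"
proof -
  have "homeomorphic_map (top_of_set (model_set c)) (top_of_set {x. x $ 1 \<in> model_set c}) (vec :: real \<Rightarrow> real^1)"
    using homeomorphic_map_vec_1[of "model_set c"] by (simp add: vec_image_1)
  then have "topological_manifold (model c)"
    by (simp add: topological_manifold_def second_countable_top_of_set Hausdorff_space_subtopology
        open_model_cimage subtopology_subtopology)
  moreover have "smooth_on (transition (model c) i j) {x. x $ 1 \<in> model_set c}" for i j
    using smooth_on_cong[OF open_model_cimage, of c "transition (model c) i j" "\<lambda>x. x"]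
      smooth_on_bounded_linear[OF open_model_cimage bounded_linear_ident]
    by (simp add: transition_model)
  ultimately show ?thesis by (simp add: smooth_manifold_def)
qed

lemma riemannian_metric_model: "riemannian_metric (model c)"
  unfolding riemannian_metric_def
proof (intro conjI ballI allI impI)
  fix i j v w
  show "smooth_on (\<lambda>z. metric (model c) i z v w) (cimage (model c) i)"
    unfolding model_simps
    by (intro smooth_on_mult smooth_on_const open_model_cimage
        smooth_on_vec_1(2)[OF open_model_set smooth_on_model_metric])
  fix z assume "z \<in> overlap (model c) i j"
  then show "metric (model c) j (transition (model c) i j z)
      (frechet_derivative (transition (model c) i j) (at z) v)
      (frechet_derivative (transition (model c) i j) (at z) w) = metric (model c) i z v w"
    by (simp add: frechet_transition_model transition_model)
next
  fix i z assume z: "z \<in> cimage (model c) i"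
  show "bilinear (metric (model c) i z)"
    unfolding bilinear_def by (auto intro!: linearI simp: algebra_simps)
  show "metric (model c) i z v w = metric (model c) i z w v" for v w by simp
  show "0 < metric (model c) i z v v" if "v \<noteq> 0" for v
    using model_metric_pos z that by (simp add: vec_eq_iff zero_less_mult_iff mult.assoc) (metis not_square_less_zero linorder_neqE_linordered_idom mult_eq_0_iff)
qed

text \<open>On an interval every smooth Christoffel symbol defines a flat connection, because curvature and
  torsion are 2-forms with values in a bundle, and there are no 2-forms in dimension one.\<close>

lemma flat_affine_connection_model:
  assumes "smooth_on k (model_set c)"
  defines "\<Gamma> \<equiv> \<lambda>(_ :: unit) (x :: real^1) (u :: real^1) (v :: real^1). (vec (k (x $ 1) * (u $ 1) * (v $ 1)) :: real^1)"
  shows "affine_connection (model c) \<Gamma>" "flat_connection (model c) \<Gamma>"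
proof -
  have smooth: "smooth_on (\<lambda>x. \<Gamma> i x u v) {x. x $ 1 \<in> model_set c}" for i u v
    unfolding \<Gamma>_def
    by (intro smooth_on_compose_linear[OF open_model_cimage bounded_linear_vec_1] smooth_on_mult
        smooth_on_const open_model_cimage smooth_on_vec_1(2)[OF open_model_set assms(1)])
  have sd: "second_derivative (transition (model c) i j) x u v = 0" if "x $ 1 \<in> model_set c" for i j x u v
    unfolding second_derivative_def
    using frechet_derivative_transform_open[OF open_model_cimage, of x c
        "\<lambda>y. frechet_derivative (transition (model c) i j) (at y) v" "\<lambda>y. v"] that
    by (simp add: frechet_transition_model)
  show "affine_connection (model c) \<Gamma>"
    unfolding affine_connection_def
  proof (intro conjI ballI allI)
    show "bilinear (\<Gamma> i x)" for i x
      unfolding bilinear_def \<Gamma>_def by (auto intro!: linearI simp: vec_eq_iff algebra_simps)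
    show "smooth_on (\<lambda>x. \<Gamma> i x u v) (cimage (model c) i)" for i u v
      using smooth by simp
    show "let \<tau> = transition (model c) i j; D = frechet_derivative \<tau> (at x)
        in D (\<Gamma> i x u v) = second_derivative \<tau> x u v + \<Gamma> j (\<tau> x) (D u) (D v)"
      if "x \<in> overlap (model c) i j" for i j x u v
      using that sd[of x] by (simp add: frechet_transition_model transition_model Let_def \<Gamma>_def)
  qed
  show "flat_connection (model c) \<Gamma>"
    unfolding flat_connection_def
  proof (intro conjI ballI allI)
    show "\<Gamma> i x u v = \<Gamma> i x v u" for i x u v by (simp add: \<Gamma>_def mult_ac)
    fix i x u v w assume "x \<in> cimage (model c) i"
    then have x: "x $ 1 \<in> model_set c" by simp
    have "(k has_derivative frechet_derivative k (at (x $ 1))) (at (x $ 1))"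
      by (rule smooth_on_has_frechet_derivative[OF assms(1) x])
    then obtain K where "(k has_real_derivative K) (at (x $ 1))"
      using has_field_derivative_def has_real_derivative by blast
    then have K: "(k has_derivative (\<lambda>t. K * t)) (at (x $ 1))" by (simp add: has_field_derivative_def)
    have "((\<lambda>y. \<Gamma> i y v w) has_derivative (\<lambda>u. vec (K * (u $ 1) * (v $ 1) * (w $ 1)))) (at x)" for v w
      unfolding \<Gamma>_def
      by (rule has_derivative_vec_1[of "\<lambda>t. k t * v $ 1 * w $ 1"])
        (intro has_derivative_mult_left K)
    then have "frechet_derivative (\<lambda>y. \<Gamma> i y v w) (at x) u = vec (K * (u $ 1) * (v $ 1) * (w $ 1))" for u v w
      using frechet_derivative_at by metis
    then show "(frechet_derivative (\<lambda>y. \<Gamma> i y v w) (at x) u + \<Gamma> i x u (\<Gamma> i x v w)) -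
           (frechet_derivative (\<lambda>y. \<Gamma> i y u w) (at x) v + \<Gamma> i x v (\<Gamma> i x u w)) = 0"
      by (simp add: \<Gamma>_def vec_eq_iff mult_ac)
  qed
qed

text \<open>For the metric \<open>h(\<theta>)\<close> and \<open>\<nabla> = d\<close>, the duality equation \<open>h' = 0 + h \<Gamma>'\<close> is solved by the logarithmic
  derivative of \<open>h\<close>.\<close>

lemma dually_flat_manifold_model: "dually_flat_manifold (model c)"
proof -
  have conn: "conn (model c) = (\<lambda>i x u v. vec ((0 :: real) * (u $ 1) * (v $ 1)))"
    by (simp add: fun_eq_iff vec_eq_iff)
  define h' where "h' \<theta> = frechet_derivative (model_metric c) (at \<theta>) 1" for \<theta>
  define k where "k \<theta> = h' \<theta> * inverse (model_metric c \<theta>)" for \<theta>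
  have "model_metric c \<theta> \<noteq> 0" if "\<theta> \<in> model_set c" for \<theta> using model_metric_pos[OF that] by simp
  then have k: "smooth_on k (model_set c)"
    unfolding k_def h'_def
    by (intro smooth_on_mult open_model_set smooth_on_frechet_derivative smooth_on_inverse' smooth_on_model_metric)
  define \<Gamma> where "\<Gamma> = (\<lambda>(_ :: unit) (x :: real^1) (u :: real^1) (v :: real^1). (vec (k (x $ 1) * (u $ 1) * (v $ 1)) :: real^1))"
  have "dual_connections (model c) (conn (model c)) \<Gamma>"
    unfolding dual_connections_def
  proof (intro ballI allI)
    fix i x u v w assume "x \<in> cimage (model c) i"
    then have x: "x $ 1 \<in> model_set c" by simp
    have D: "(model_metric c has_derivative frechet_derivative (model_metric c) (at (x $ 1))) (at (x $ 1))"
      by (rule smooth_on_has_frechet_derivative[OF smooth_on_model_metric x])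
    have lin: "frechet_derivative (model_metric c) (at (x $ 1)) t = t * h' (x $ 1)" for t
      using linear_cmul[OF has_derivative_linear[OF D], of t 1] by (simp add: h'_def)
    have "((\<lambda>y. model_metric c (y $ 1)) has_derivative (\<lambda>u. u $ 1 * h' (x $ 1))) (at x)"
      using has_derivative_compose[OF bounded_linear_imp_has_derivative[OF bounded_linear_nth_1] D]
      by (simp add: lin)
    then have "((\<lambda>y. metric (model c) i y v w) has_derivative (\<lambda>u. u $ 1 * h' (x $ 1) * v $ 1 * w $ 1)) (at x)"
      by (auto intro!: has_derivative_mult_left)
    then have "frechet_derivative (\<lambda>y. metric (model c) i y v w) (at x) u = u $ 1 * h' (x $ 1) * v $ 1 * w $ 1"
      using frechet_derivative_at by metis
    then show "frechet_derivative (\<lambda>y. metric (model c) i y v w) (at x) u =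
          metric (model c) i x (conn (model c) i x u v) w + metric (model c) i x v (\<Gamma> i x u w)"
      using model_metric_pos[OF x] by (simp add: \<Gamma>_def k_def mult_ac)
  qed
  moreover have "affine_connection (model c) (conn (model c))" "flat_connection (model c) (conn (model c))"
    unfolding conn
    using flat_affine_connection_model[OF smooth_on_const[where c = 0], of c] by simp_all
  moreover have "affine_connection (model c) \<Gamma>" "flat_connection (model c) \<Gamma>"
    unfolding \<Gamma>_def using flat_affine_connection_model[OF k] by simp_all
  ultimately show ?thesis
    unfolding dually_flat_manifold_def using smooth_manifold_model riemannian_metric_model by blast
qed

section \<open>The tangent bundle of a model as a domain in the complex plane\<close>

text \<open>Dombrowski's coordinate \<open>q + \<i> r\<close> for the standard affine coordinate \<open>\<theta>\<close>. It identifies the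
  tangent bundle with the points of the complex plane whose real part lies in the model.\<close>

definition tangent_coordinate :: "real \<times> (unit \<Rightarrow> real^1) \<Rightarrow> complex" where
  "tangent_coordinate q = Complex (fst q) (snd q () $ 1)"

lemma inj_tangent_coordinate: "inj tangent_coordinate"
  by (rule injI) (auto simp: tangent_coordinate_def prod_eq_iff fun_eq_iff vec_eq_iff)

lemma tangent_bundle_model: "tangent_bundle (model c) = model_set c \<times> UNIV"
proof -
  have "v \<in> tangent_space (model c) p" if "p \<in> model_set c" for p v
    using that by (auto simp: tangent_space_def frechet_transition_model)
  then show ?thesis by (auto simp: tangent_bundle_def)
qed

lemma tangent_coordinate_image:
  assumes "U \<subseteq> model_set c"
  shows "tangent_coordinate ` {(p, v) \<in> tangent_bundle (model c). p \<in> U} = {z. Re z \<in> U}"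
proof (intro subset_antisym subsetI)
  fix z assume "z \<in> {z. Re z \<in> U}"
  then show "z \<in> tangent_coordinate ` {(p, v) \<in> tangent_bundle (model c). p \<in> U}"
    using assms
    by (intro image_eqI[of _ _ "(Re z, \<lambda>_. vec (Im z))"]) (auto simp: tangent_coordinate_def tangent_bundle_model)
qed (auto simp: tangent_coordinate_def)

lemma tangent_coordinate_tangent_bundle:
  "tangent_coordinate ` tangent_bundle (model c) = {z. Re z \<in> model_set c}"
proof -
  have "{(p, v) \<in> tangent_bundle (model c). p \<in> model_set c} = tangent_bundle (model c)"
    by (auto simp: tangent_bundle_model)
  then show ?thesis using tangent_coordinate_image[of "model_set c" c] by simp
qed

text \<open>The inverse of an affine coordinate is locally affine, so its derivative is a locally
  constant \<open>slope\<close>. The inverse of the induced chart of the tangent bundle, expressed in the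
  coordinate above, then has the complex derivative \<open>slope\<close>; this is the compatibility of the
  complex structures of all the charts with that of the half-plane.\<close>

locale affine_chart =
  fixes c :: real and U :: "real set" and x :: "real \<Rightarrow> real^1"
  assumes chart: "(U, x) \<in> affine_coordinates (model c)"
begin

definition inv_chart :: "real^1 \<Rightarrow> real" where
  "inv_chart = inv_into U x"

definition slope :: "real \<Rightarrow> real" where
  "slope y = frechet_derivative (vec \<circ> inv_chart) (at (vec y)) (vec 1 :: real^1) $ (1 :: 1)"

definition tangent_inverse :: "complex \<Rightarrow> complex" where
  "tangent_inverse w = Complex (inv_chart (vec (Re w))) (slope (Re w) * Im w)"

definition tangent_domain :: "complex set" where
  "tangent_domain = {w. vec (Re w) \<in> x ` U}"

lemma U: "open U" "U \<subseteq> model_set c"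
  using chart open_model_set[of c] by (auto simp: affine_coordinates_def openin_open_eq)

lemma inj_x: "inj_on x U" and open_x: "open (x ` U)"
  using chart by (auto simp: affine_coordinates_def)

lemma inv_chart_x: "p \<in> U \<Longrightarrow> inv_chart (x p) = p"
  and inv_chart_in: "y \<in> x ` U \<Longrightarrow> inv_chart y \<in> U"
  and x_inv_chart: "y \<in> x ` U \<Longrightarrow> x (inv_chart y) = y"
  by (simp_all add: inv_chart_def inj_x inv_into_into f_inv_into_f)

lemma smooth_x: "smooth_on (x \<circ> cinv (model c) ()) (vec ` U)"
  and smooth_inv_chart: "smooth_on (vec \<circ> inv_chart :: real^1 \<Rightarrow> real^1) (x ` U)"
  and second_derivative_inv_chart: "y \<in> x ` U \<Longrightarrow> second_derivative (vec \<circ> inv_chart) y u (v :: real^1) = (0 :: real^1)"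
  using chart U(2) by (auto simp: affine_coordinates_def inv_chart_def Let_def Int_absorb2)

lemma derivative_inv_chart:
  assumes "y \<in> x ` U"
  shows "((vec \<circ> inv_chart) has_derivative (\<lambda>v :: real^1. vec (slope (y $ 1) * v $ 1) :: real^1)) (at y)"
proof -
  let ?D = "frechet_derivative (vec \<circ> inv_chart :: real^1 \<Rightarrow> real^1) (at y)"
  have D: "((vec \<circ> inv_chart) has_derivative ?D) (at y)"
    by (rule smooth_on_has_frechet_derivative[OF smooth_inv_chart assms])
  have "?D v = vec (slope (y $ 1) * v $ 1)" for v
  proof -
    have "v = (v $ 1) *\<^sub>R vec 1" by (simp add: vec_eq_iff)
    then have "?D v = (v $ 1) *\<^sub>R ?D (vec 1)"
      using linear_cmul[OF has_derivative_linear[OF D], of "v $ 1" "vec 1"] by metis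
    then show ?thesis by (simp only: slope_def vec_nth_1) (simp add: vec_eq_iff)
  qed
  then have "?D = (\<lambda>v. vec (slope (y $ 1) * v $ 1))" by blast
  then show ?thesis using D by simp
qed

lemma derivative_inv_chart_real:
  assumes "vec t \<in> x ` U"
  shows "((\<lambda>t. inv_chart (vec t)) has_real_derivative slope t) (at t)"
proof -
  have "((\<lambda>y. (vec \<circ> inv_chart) y $ 1) has_derivative (\<lambda>v :: real^1. slope t * v $ 1)) (at (vec t))"
    using bounded_linear.has_derivative[OF bounded_linear_nth_1 derivative_inv_chart[OF assms]] by simp
  then have "((\<lambda>t. (vec \<circ> inv_chart) (vec t :: real^1) $ (1 :: 1)) has_derivative (\<lambda>v. slope t * v)) (at t)"
    using has_derivative_compose[OF bounded_linear_imp_has_derivative[OF bounded_linear_vec_1]] by fastforce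
  then show ?thesis by (simp add: has_field_derivative_def)
qed

lemma derivative_slope:
  assumes "vec t \<in> x ` U"
  shows "(slope has_real_derivative 0) (at t)"
proof -
  let ?d = "\<lambda>y. frechet_derivative (vec \<circ> inv_chart :: real^1 \<Rightarrow> real^1) (at y) (vec 1)"
  have "(?d has_derivative frechet_derivative ?d (at (vec t))) (at (vec t))"
    by (rule smooth_on_has_frechet_derivative[OF smooth_on_frechet_derivative[OF smooth_inv_chart] assms])
  moreover have "frechet_derivative ?d (at (vec t)) = (\<lambda>u. 0)"
    using second_derivative_inv_chart[OF assms] by (auto simp: second_derivative_def)
  ultimately have "((\<lambda>y. ?d y $ 1) has_derivative (\<lambda>u. 0)) (at (vec t))"
    using bounded_linear.has_derivative[OF bounded_linear_nth_1, of ?d] by fastforce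
  then have "((\<lambda>t. ?d (vec t) $ 1) has_derivative (\<lambda>u. 0)) (at t)"
    using has_derivative_compose[OF bounded_linear_imp_has_derivative[OF bounded_linear_vec_1]] by fastforce
  moreover have "(*) (0 :: real) = (\<lambda>_. 0)" by auto
  ultimately show ?thesis by (simp only: has_field_derivative_def slope_def[abs_def])
qed

lemma open_tangent_domain: "open tangent_domain"
proof -
  have "tangent_domain = (\<lambda>w. vec (Re w)) -` (x ` U)" by (auto simp: tangent_domain_def)
  moreover have "open \<dots>"
    by (rule open_vimage[OF open_x])
      (intro linear_continuous_on bounded_linear_compose[OF bounded_linear_vec_1 bounded_linear_Re, unfolded o_def])
  ultimately show ?thesis by simp
qed

text \<open>Writing \<open>\<sigma>\<close> for the inverse of \<open>x\<close>, the map is \<open>\<sigma>(q) + \<i> \<sigma>'(q) r\<close>; as \<open>\<sigma>'' = 0\<close>, both partial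
  derivatives are governed by \<open>\<sigma>'\<close> and the Cauchy--Riemann equations hold.\<close>

lemma derivative_tangent_inverse:
  assumes "w \<in> tangent_domain"
  shows "(tangent_inverse has_field_derivative of_real (slope (Re w))) (at w)"
proof -
  have t: "vec (Re w) \<in> x ` U" using assms by (simp add: tangent_domain_def)
  have re: "(Re has_derivative Re) (at w)" and im: "(Im has_derivative Im) (at w)"
    by (simp_all add: bounded_linear_imp_has_derivative bounded_linear_Re bounded_linear_Im)
  have 1: "((\<lambda>w. inv_chart (vec (Re w))) has_derivative (\<lambda>v. slope (Re w) * Re v)) (at w)"
    using has_derivative_compose[OF re derivative_inv_chart_real[OF t, unfolded has_field_derivative_def]] by simp
  have 2: "((\<lambda>w. slope (Re w)) has_derivative (\<lambda>v. 0)) (at w)"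
    using has_derivative_compose[OF re derivative_slope[OF t, unfolded has_field_derivative_def]] by simp
  have 3: "((\<lambda>w. slope (Re w) * Im w) has_derivative (\<lambda>v. slope (Re w) * Im v)) (at w)"
    using has_derivative_mult[OF 2 im] by simp
  have "((\<lambda>w. of_real (inv_chart (vec (Re w))) + \<i> * of_real (slope (Re w) * Im w)) has_derivative
      (\<lambda>v. of_real (slope (Re w) * Re v) + \<i> * of_real (slope (Re w) * Im v))) (at w)"
    by (intro has_derivative_add has_derivative_mult_right has_derivative_of_real 1 3)
  then show ?thesis
    unfolding has_field_derivative_def tangent_inverse_def[abs_def] Complex_eq
    by (rule back_subst[of "\<lambda>D. (_ has_derivative D) _"]) (auto simp: fun_eq_iff complex_eq_iff)
qed

text \<open>The chart differentiates \<open>x\<close>, the map in the other direction multiplies by the derivative of its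
  inverse; by the chain rule the two cancel.\<close>

lemma tangent_chart_eq:
  assumes "(p, v) \<in> tangent_dom (model c) (U, x)"
  shows "tangent_chart (model c) (U, x) (p, v) $ 1 \<in> tangent_domain" (is ?in)
    and "tangent_inverse (tangent_chart (model c) (U, x) (p, v) $ 1) = tangent_coordinate (p, v)" (is ?inv)
    and "slope (x p $ 1) \<noteq> 0" (is ?slope)
proof -
  have p: "p \<in> U" using assms by (simp add: tangent_dom_def)
  let ?X = "frechet_derivative (x \<circ> cinv (model c) ()) (at (vec p))"
  have X: "((x \<circ> cinv (model c) ()) has_derivative ?X) (at (vec p))"
    by (rule smooth_on_has_frechet_derivative[OF smooth_x]) (use p in simp)
  have chart_p: "tangent_chart (model c) (U, x) (p, v) $ 1 = Complex (x p $ 1) (?X (v ()) $ 1)"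
    by (simp add: tangent_chart_def tangent_components_def)
  show ?in using p by (simp add: tangent_domain_def chart_p vec_nth_1)
  have "((vec \<circ> inv_chart :: real^1 \<Rightarrow> real^1) \<circ> (x \<circ> cinv (model c) ()) has_derivative
      (\<lambda>v. vec (slope (x p $ 1) * v $ 1)) \<circ> ?X) (at (vec p))"
    using derivative_inv_chart[of "x p"] U(2) p
    by (intro diff_chain_at[OF X]) (simp add: cinv_model subset_iff)
  then have "((\<lambda>y. y) has_derivative (\<lambda>v. vec (slope (x p $ 1) * v $ 1)) \<circ> ?X) (at (vec p))"
    by (rule has_derivative_transform_within_open[OF _ open_vec_image_1[OF U(1)]])
      (use p U(2) in \<open>auto simp: cinv_model inv_chart_x subset_iff\<close>)
  then have "(\<lambda>v. vec (slope (x p $ 1) * v $ 1)) \<circ> ?X = (\<lambda>y. y)"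
    by (rule has_derivative_unique) (rule has_derivative_ident)
  then have id: "vec (slope (x p $ 1) * ?X v $ 1) = v" for v by (auto simp: fun_eq_iff)
  then have id: "slope (x p $ 1) * ?X v $ 1 = v $ 1" for v by (metis vec_component)
  then show ?inv using p by (simp add: chart_p tangent_inverse_def tangent_coordinate_def vec_nth_1 inv_chart_x)
  show ?slope using id[of "vec 1"] by auto
qed

lemma slope_nonzero: "w \<in> tangent_domain \<Longrightarrow> slope (Re w) \<noteq> 0"
proof -
  assume "w \<in> tangent_domain"
  then obtain p where "p \<in> U" "x p = vec (Re w)" by (auto simp: tangent_domain_def)
  then show ?thesis using tangent_chart_eq(3)[of p undefined] U(2)
    by (auto simp: tangent_dom_def tangent_bundle_model)
qed

lemma tangent_chart_surj:
  assumes "w \<in> tangent_domain"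
  obtains q where "q \<in> tangent_dom (model c) (U, x)" "tangent_chart (model c) (U, x) q = vec w"
    "tangent_coordinate q = tangent_inverse w"
proof -
  let ?p = "inv_chart (vec (Re w))" and ?v = "\<lambda>_ :: unit. vec (slope (Re w) * Im w) :: real^1"
  have t: "vec (Re w) \<in> x ` U" using assms by (simp add: tangent_domain_def)
  then have p: "?p \<in> U" "x ?p = vec (Re w)" by (simp_all add: inv_chart_in x_inv_chart)
  then have q: "(?p, ?v) \<in> tangent_dom (model c) (U, x)"
    using U(2) by (auto simp: tangent_dom_def tangent_bundle_model)
  let ?w = "tangent_chart (model c) (U, x) (?p, ?v) $ 1"
  have "tangent_inverse ?w = tangent_inverse w"
    using tangent_chart_eq(2)[OF q] by (simp add: tangent_inverse_def tangent_coordinate_def)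
  moreover have "Re ?w = Re w" by (simp add: tangent_chart_def p(2))
  ultimately have "?w = w"
    using slope_nonzero[OF assms] by (auto simp: tangent_inverse_def complex_eq_iff)
  then have "tangent_chart (model c) (U, x) (?p, ?v) = vec w" by (metis vec_nth_1)
  then show ?thesis using that[OF q] by (simp add: tangent_inverse_def tangent_coordinate_def)
qed

lemma tangent_chart_inj: "inj_on (tangent_chart (model c) (U, x)) (tangent_dom (model c) (U, x))"
  by (rule inj_onI) (metis tangent_chart_eq(2) injD[OF inj_tangent_coordinate] surj_pair)

lemma tangent_chart_image:
  assumes "W \<subseteq> tangent_dom (model c) (U, x)"
  shows "tangent_chart (model c) (U, x) ` W =
    {z. z $ 1 \<in> tangent_domain \<and> tangent_inverse (z $ 1) \<in> tangent_coordinate ` W}"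
proof (intro subset_antisym subsetI)
  fix z assume "z \<in> tangent_chart (model c) (U, x) ` W"
  then show "z \<in> {z. z $ 1 \<in> tangent_domain \<and> tangent_inverse (z $ 1) \<in> tangent_coordinate ` W}"
    using assms tangent_chart_eq(1,2) by fastforce
next
  fix z :: "complex^1" assume z: "z \<in> {z. z $ 1 \<in> tangent_domain \<and> tangent_inverse (z $ 1) \<in> tangent_coordinate ` W}"
  then have "z $ 1 \<in> tangent_domain" by simp
  from tangent_chart_surj[OF this] obtain q where q: "tangent_chart (model c) (U, x) q = vec (z $ 1)"
    "tangent_coordinate q = tangent_inverse (z $ 1)"
    by blast
  then have "tangent_coordinate q \<in> tangent_coordinate ` W" using z by simp
  then have "q \<in> W" by (simp only: inj_image_mem_iff[OF inj_tangent_coordinate])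
  then show "z \<in> tangent_chart (model c) (U, x) ` W" using q(1) by (auto simp: vec_nth_1 image_iff)
qed

lemma open_tangent_chart_image:
  assumes "W \<subseteq> tangent_dom (model c) (U, x)" "open (tangent_coordinate ` W)"
  shows "open (tangent_chart (model c) (U, x) ` W)"
proof -
  have "continuous_on tangent_domain tangent_inverse"
    using derivative_tangent_inverse DERIV_isCont by (intro continuous_at_imp_continuous_on) blast
  then have "open (tangent_domain \<inter> tangent_inverse -` (tangent_coordinate ` W))"
    using open_tangent_domain assms(2) by (rule continuous_open_preimage)
  from open_nth_1[OF this] show ?thesis
    by (simp add: tangent_chart_image[OF assms(1)])
qed

text \<open>The conformal factor of Dombrowski's metric in the chart of \<open>(U, x)\<close>.\<close>

definition tangent_density :: "complex \<Rightarrow> real" where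
  "tangent_density w = model_metric c (Re (tangent_inverse w)) * (slope (Re w))\<^sup>2"

lemma dombrowski_metric:
  assumes "z $ 1 \<in> tangent_domain"
  shows "metric (dombrowski (model c)) (U, x) z v w = tangent_density (z $ 1) * (v \<bullet> w)"
proof -
  have y: "re_vec z = vec (Re (z $ 1))" by (simp add: re_vec_def vec_eq_iff)
  then have y': "re_vec z \<in> x ` U" using assms by (simp add: tangent_domain_def)
  have D: "frechet_derivative (vec \<circ> inv_chart) (at (vec (Re (z $ 1)))) =
      (\<lambda>v :: real^1. vec (slope (Re (z $ 1)) * v $ 1) :: real^1)"
    using frechet_derivative_at[OF derivative_inv_chart[OF y'[unfolded y]]] by simp
  have "metric_in_coordinates (model c) U x (re_vec z) a b =
      model_metric c (inv_chart (re_vec z)) * (slope (Re (z $ 1)))\<^sup>2 * (a $ 1 * b $ 1)" for a b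
    unfolding metric_in_coordinates_def Let_def inv_chart_def[symmetric] model_simps y D
    by (simp add: power2_eq_square)
  moreover have "re_vec v $ 1 = Re (v $ 1)" "im_vec v $ 1 = Im (v $ 1)" for v :: "complex^1"
    by (simp_all add: re_vec_def im_vec_def)
  ultimately show ?thesis
    by (simp add: dombrowski_def tangent_density_def tangent_inverse_def y inner_1 inner_complex_def algebra_simps)
qed

end

lemma standard_affine_coordinates: "(model_set c, vec) \<in> affine_coordinates (model c)"
proof -
  let ?V = "{x :: real^1. x $ 1 \<in> model_set c}"
  have inv: "inv_into (model_set c) vec y = y $ 1" if "y \<in> ?V" for y :: "real^1"
    by (rule inv_into_f_eq) (use that in \<open>auto simp: inj_on_def vec_eq_iff\<close>)
  have id: "smooth_on (\<lambda>x :: real^1. x) ?V"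
    by (rule smooth_on_bounded_linear[OF open_model_cimage bounded_linear_ident])
  have D: "frechet_derivative (vec \<circ> inv_into (model_set c) vec :: real^1 \<Rightarrow> real^1) (at y) = (\<lambda>v :: real^1. v)"
    if "y \<in> ?V" for y
    using frechet_derivative_transform_open[OF open_model_cimage, of y c _ "\<lambda>x. x"] that
    by (simp add: inv vec_nth_1)
  have "second_derivative (vec \<circ> inv_into (model_set c) vec :: real^1 \<Rightarrow> real^1) y u (v :: real^1) = 0" if "y \<in> ?V" for y u v
    unfolding second_derivative_def
    using frechet_derivative_transform_open[OF open_model_cimage, of y c
        "\<lambda>y. frechet_derivative (vec \<circ> inv_into (model_set c) vec :: real^1 \<Rightarrow> real^1) (at y) v" "\<lambda>_. v"] that D
    by simp
  moreover have "smooth_on (vec \<circ> cinv (model c) () :: real^1 \<Rightarrow> real^1) ?V \<longleftrightarrow> smooth_on (\<lambda>x :: real^1. x) ?V"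
    by (rule smooth_on_cong[OF open_model_cimage]) (simp add: cinv_model vec_nth_1)
  moreover have "smooth_on (vec \<circ> inv_into (model_set c) vec :: real^1 \<Rightarrow> real^1) ?V \<longleftrightarrow> smooth_on (\<lambda>x :: real^1. x) ?V"
    by (rule smooth_on_cong[OF open_model_cimage]) (simp add: inv vec_nth_1)
  moreover have "inj_on (vec :: real \<Rightarrow> real^1) (model_set c)"
    by (auto simp: inj_on_def vec_eq_iff)
  ultimately show ?thesis
    using id by (simp add: affine_coordinates_def vec_image_1 open_model_cimage Let_def)
qed

text \<open>The standard affine coordinate is global, so openness for its chart is the condition on the right;
  the other charts follow because their inverses are continuous.\<close>

lemma openin_dombrowski:
  "openin (mtop (dombrowski (model c))) W \<longleftrightarrow>
    W \<subseteq> tangent_bundle (model c) \<and> open (tangent_coordinate ` W)"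
proof -
  let ?T = "tangent_bundle (model c)"
  have eq: "(\<forall>\<xi>\<in>affine_coordinates (model c). open (tangent_chart (model c) \<xi> ` (W \<inter> tangent_dom (model c) \<xi>)))
      \<longleftrightarrow> open (tangent_coordinate ` W)" if W: "W \<subseteq> ?T" for W
  proof
    assume "\<forall>\<xi>\<in>affine_coordinates (model c). open (tangent_chart (model c) \<xi> ` (W \<inter> tangent_dom (model c) \<xi>))"
    then have "open (tangent_chart (model c) (model_set c, vec) ` (W \<inter> tangent_dom (model c) (model_set c, vec)))"
      using standard_affine_coordinates by blast
    moreover have "W \<inter> tangent_dom (model c) (model_set c, vec) = W"
      using W by (auto simp: tangent_dom_def tangent_bundle_model)
    moreover have "tangent_chart (model c) (model_set c, vec) q = vec (tangent_coordinate q)" if "q \<in> W" for q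
    proof -
      have "fst q \<in> model_set c" using that W by (auto simp: tangent_bundle_model)
      then have "frechet_derivative (vec \<circ> cinv (model c) ()) (at (vec (fst q))) = (\<lambda>v :: real^1. v)"
        using frechet_derivative_transform_open[OF open_model_cimage, of "vec (fst q)" c _ "\<lambda>x. x"]
        by (simp add: cinv_model vec_nth_1)
      then show ?thesis
        by (cases q) (simp add: tangent_chart_def tangent_components_def tangent_coordinate_def vec_eq_iff)
    qed
    ultimately have "open ((vec :: complex \<Rightarrow> complex^1) ` tangent_coordinate ` W)"
      by (simp add: image_image)
    from open_vimage[OF this linear_continuous_on[OF bounded_linear_vec_1]]
    have "open ((vec :: complex \<Rightarrow> complex^1) -` vec ` tangent_coordinate ` W)" by simp
    moreover have "(vec :: complex \<Rightarrow> complex^1) -` vec ` tangent_coordinate ` W = tangent_coordinate ` W"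
      by (rule inj_vimage_image_eq) (auto simp: inj_on_def vec_eq_iff)
    ultimately show "open (tangent_coordinate ` W)" by simp
  next
    assume op: "open (tangent_coordinate ` W)"
    show "\<forall>\<xi>\<in>affine_coordinates (model c). open (tangent_chart (model c) \<xi> ` (W \<inter> tangent_dom (model c) \<xi>))"
    proof
      fix \<xi> assume \<xi>: "\<xi> \<in> affine_coordinates (model c)"
      obtain U x where Ux: "\<xi> = (U, x)" by (cases \<xi>)
      interpret affine_chart c U x by unfold_locales (use \<xi> Ux in simp)
      have "tangent_coordinate ` (W \<inter> tangent_dom (model c) \<xi>) = tangent_coordinate ` W \<inter> {z. Re z \<in> U}"
        unfolding Ux tangent_dom_def using tangent_coordinate_image[OF U(2)]
        by (simp add: image_Int[OF inj_tangent_coordinate])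
      moreover have "open {z. Re z \<in> U}"
        using open_vimage[OF U(1), of Re] by (simp add: vimage_def continuous_on_Re)
      ultimately have "open (tangent_coordinate ` (W \<inter> tangent_dom (model c) \<xi>))" using op by auto
      then show "open (tangent_chart (model c) \<xi> ` (W \<inter> tangent_dom (model c) \<xi>))"
        unfolding Ux by (intro open_tangent_chart_image) auto
    qed
  qed
  then have "(\<lambda>W. W \<subseteq> ?T \<and>
        (\<forall>\<xi>\<in>affine_coordinates (model c). open (tangent_chart (model c) \<xi> ` (W \<inter> tangent_dom (model c) \<xi>)))) =
      (\<lambda>W. W \<subseteq> ?T \<and> open (tangent_coordinate ` W))"
    by (intro ext conj_cong refl eq)
  moreover have "istopology (\<lambda>W. W \<subseteq> ?T \<and> open (tangent_coordinate ` W))"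
    unfolding istopology_def
    by (auto simp: image_Int[OF inj_tangent_coordinate] image_Union)
  ultimately show ?thesis by (simp add: dombrowski_def topology_inverse')
qed

lemma points_dombrowski: "points (dombrowski (model c)) = tangent_bundle (model c)"
proof
  show "points (dombrowski (model c)) \<subseteq> tangent_bundle (model c)"
    using openin_dombrowski openin_topspace by blast
  have "open {z. Re z \<in> model_set c}"
    using open_vimage[OF open_model_set, of Re] by (simp add: vimage_def continuous_on_Re)
  then have "openin (mtop (dombrowski (model c))) (tangent_bundle (model c))"
    by (simp add: openin_dombrowski tangent_coordinate_tangent_bundle)
  then show "tangent_bundle (model c) \<subseteq> points (dombrowski (model c))" by (rule openin_subset)
qed

section \<open>The quotient of the tangent bundle by a parallel lattice\<close>

lemma openin_quotient_top:
  "openin (quotient_top X q) U \<longleftrightarrow> U \<subseteq> q ` topspace X \<and> openin X {x \<in> topspace X. q x \<in> U}"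
proof -
  have "openin X {x \<in> topspace X. q x \<in> S \<inter> T}"
    if "openin X {x \<in> topspace X. q x \<in> S}" "openin X {x \<in> topspace X. q x \<in> T}" for S T
  proof -
    have "{x \<in> topspace X. q x \<in> S \<inter> T} = {x \<in> topspace X. q x \<in> S} \<inter> {x \<in> topspace X. q x \<in> T}" by auto
    then show ?thesis using that by (simp add: openin_Int)
  qed
  moreover have "openin X {x \<in> topspace X. q x \<in> \<Union>\<K>}"
    if "\<And>K. K \<in> \<K> \<Longrightarrow> openin X {x \<in> topspace X. q x \<in> K}" for \<K>
  proof -
    have "{x \<in> topspace X. q x \<in> \<Union>\<K>} = \<Union>((\<lambda>K. {x \<in> topspace X. q x \<in> K}) ` \<K>)" by auto
    then show ?thesis using that by (auto intro: openin_Union)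
  qed
  ultimately have "istopology (\<lambda>U. U \<subseteq> q ` topspace X \<and> openin X {x \<in> topspace X. q x \<in> U})"
    unfolding istopology_def by (auto 0 3)
  then show ?thesis by (simp add: quotient_top_def topology_inverse')
qed

lemma topspace_quotient_top: "topspace (quotient_top X q) = q ` topspace X"
proof
  show "topspace (quotient_top X q) \<subseteq> q ` topspace X"
    using openin_quotient_top[of X q] openin_topspace by blast
  have "{x \<in> topspace X. q x \<in> q ` topspace X} = topspace X" by auto
  then have "openin (quotient_top X q) (q ` topspace X)" by (simp add: openin_quotient_top)
  then show "q ` topspace X \<subseteq> topspace (quotient_top X q)" by (rule openin_subset)
qed

lemma continuous_map_from_quotient_top:
  assumes "continuous_map X Y (f \<circ> q)"
  shows "continuous_map (quotient_top X q) Y f"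
proof -
  have "openin (quotient_top X q) {y \<in> q ` topspace X. f y \<in> U}" if "openin Y U" for U
  proof -
    have "{x \<in> topspace X. q x \<in> {y \<in> q ` topspace X. f y \<in> U}} = {x \<in> topspace X. (f \<circ> q) x \<in> U}" by auto
    then show ?thesis using openin_continuous_map_preimage[OF assms that] by (auto simp: openin_quotient_top)
  qed
  then show ?thesis
    using assms by (auto simp: continuous_map_def topspace_quotient_top)
qed

text \<open>A complex curve whose charts are all defined globally and factor through a single coordinate
  \<open>k\<close> onto a plane domain \<open>A\<close>, together with a covering \<open>\<zeta> \<mapsto> \<beta> exp (\<alpha> \<zeta>)\<close> of \<open>A\<close> by the tangent
  bundle of the model that pulls the metric back to that of the tangent bundle. The deck
  transformations of this covering are the translations by multiples of \<open>2 \<pi> \<i> / \<alpha>\<close>, so its fibres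
  are the orbits of the parallel lattice generated by \<open>(2 \<pi> / \<alpha>) \<partial>\<^sub>\<theta>\<close>.\<close>

locale exponential_covering =
  fixes c \<alpha> \<beta> :: real and N :: "('p, 'j, complex^1) riemannian" and A :: "complex set"
    and k :: "'p \<Rightarrow> complex" and g g' :: "'j \<Rightarrow> complex \<Rightarrow> complex" and \<rho> :: "'j \<Rightarrow> complex \<Rightarrow> real"
  assumes positive: "0 < \<alpha>" "0 < \<beta>"
    and covers: "(\<lambda>z. of_real \<beta> * exp (of_real \<alpha> * z)) ` {z. Re z \<in> model_set c} = A"
    and coordinate: "homeomorphic_map (mtop N) (top_of_set A) k"
    and global: "j \<in> charts N \<Longrightarrow> cdom N j = points N"
    and cmap_N: "j \<in> charts N \<Longrightarrow> p \<in> points N \<Longrightarrow> cmap N j p = vec (g j (k p))"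
    and g_inj: "j \<in> charts N \<Longrightarrow> inj_on (g j) A"
    and g_deriv: "j \<in> charts N \<Longrightarrow> w \<in> A \<Longrightarrow> (g j has_field_derivative g' j w) (at w)"
    and g'_nonzero: "j \<in> charts N \<Longrightarrow> w \<in> A \<Longrightarrow> g' j w \<noteq> 0"
    and conformal: "conformal_metric N \<rho>"
    and pullback: "j \<in> charts N \<Longrightarrow> Re z \<in> model_set c \<Longrightarrow> w = of_real \<beta> * exp (of_real \<alpha> * z) \<Longrightarrow>
      \<rho> j (g j w) * (cmod (g' j w) * (\<alpha> * cmod w))\<^sup>2 = model_metric c (Re z)"
begin

definition cover :: "complex \<Rightarrow> complex" where
  "cover z = of_real \<beta> * exp (of_real \<alpha> * z)"

definition period :: real where
  "period = 2 * pi / \<alpha>"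

definition frame :: "1 \<Rightarrow> real \<Rightarrow> unit \<Rightarrow> real^1" where
  "frame = (\<lambda>_ _ _. vec period)"

definition lattice :: "(real \<times> (unit \<Rightarrow> real^1)) set" where
  "lattice = generated_lattice (model c) frame"

abbreviation TM :: "(real \<times> (unit \<Rightarrow> real^1)) set" where
  "TM \<equiv> tangent_bundle (model c)"

abbreviation quotient where
  "quotient \<equiv> quotient_manifold (dombrowski (model c)) (lattice_orbit lattice)"

definition upstairs :: "real \<times> (unit \<Rightarrow> real^1) \<Rightarrow> complex" where
  "upstairs q = cover (tangent_coordinate q)"

lemma period_pos: "period > 0" using positive by (simp add: period_def)

lemma cover_image: "cover ` {z. Re z \<in> model_set c} = A"
  using covers by (simp add: cover_def[abs_def])

lemma upstairs_image: "upstairs ` TM = A"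
  by (simp add: upstairs_def[abs_def] image_image[symmetric] tangent_coordinate_tangent_bundle cover_image)

text \<open>The factor \<open>\<beta> > 0\<close> is absorbed in the exponent, which reduces statements on the covering to
  statements on \<open>exp\<close>.\<close>

lemma cover_as_exp: "cover z = exp (of_real (ln \<beta>) + \<alpha> *\<^sub>R z)"
proof -
  have "exp (of_real (ln \<beta>) :: complex) = of_real \<beta>"
    using positive by (simp add: exp_of_real)
  then show ?thesis by (simp add: cover_def exp_add scaleR_conv_of_real)
qed

lemma cover_nonzero: "cover z \<noteq> 0"
  by (simp add: cover_as_exp)

lemma cover_eq_iff: "cover z = cover z' \<longleftrightarrow> (\<exists>n :: int. z = z' + \<i> * of_real (of_int n * period))"
proof -
  have "cover z = cover z' \<longleftrightarrow> (\<exists>n :: int. \<alpha> *\<^sub>R z = \<alpha> *\<^sub>R z' + of_int (2 * n) * of_real pi * \<i>)"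
    unfolding cover_as_exp exp_eq by (simp add: add.assoc)
  moreover have "\<alpha> *\<^sub>R z = \<alpha> *\<^sub>R z' + of_int (2 * n) * of_real pi * \<i> \<longleftrightarrow> z = z' + \<i> * of_real (of_int n * period)" for n
    using positive by (simp add: complex_eq_iff period_def field_simps)
  ultimately show ?thesis by simp
qed

lemma derivative_cover: "(cover has_field_derivative of_real \<alpha> * cover z) (at z)"
  unfolding cover_def[abs_def] by (auto intro!: derivative_eq_intros)

lemma open_cover_image:
  assumes "open S"
  shows "open (cover ` S)"
proof -
  have "open ((\<lambda>z. of_real (ln \<beta>) + \<alpha> *\<^sub>R z) ` S)"
    by (rule open_affinity) (use assms positive in auto)
  then have "openin (top_of_set (- {0})) (exp ` (\<lambda>z. of_real (ln \<beta>) + \<alpha> *\<^sub>R z) ` S)"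
    by (intro covering_space_open_map[OF covering_space_exp_punctured_plane]) simp
  then have "open (exp ` (\<lambda>z. of_real (ln \<beta>) + \<alpha> *\<^sub>R z) ` S)"
    by (rule openin_open_trans) auto
  then show ?thesis by (simp add: image_image cover_as_exp[abs_def])
qed

lemma open_half_plane: "open {z. Re z \<in> model_set c}"
  using open_vimage[OF open_model_set, of Re] by (simp add: vimage_def continuous_on_Re)

lemma open_A: "open A"
  using open_cover_image[OF open_half_plane] by (simp add: cover_image)

text \<open>Adding the lattice vector \<open>n (2 \<pi> / \<alpha>) \<partial>\<^sub>\<theta>\<close> adds a period of the covering map to the coordinate, so
  the orbits are the fibres.\<close>

lemma lattice_orbit_iff:
  assumes "q \<in> TM"
  shows "q' \<in> lattice_orbit lattice q \<longleftrightarrow> q' \<in> TM \<and> upstairs q' = upstairs q"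
proof -
  obtain p v p' v' where q: "q = (p, v)" "q' = (p', v')" by (cases q, cases q')
  have p: "p \<in> model_set c" using assms by (simp add: q tangent_bundle_model)
  have "q' \<in> lattice_orbit lattice q \<longleftrightarrow> p' = p \<and> (\<exists>n :: int. v' = (\<lambda>i. v i + of_int n *\<^sub>R vec period))"
  proof -
    have "(p, l) \<in> lattice \<longleftrightarrow> (\<exists>n :: int. l = (\<lambda>i. of_int n *\<^sub>R vec period))" for l
    proof
      assume "(p, l) \<in> lattice"
      then show "\<exists>n :: int. l = (\<lambda>i. of_int n *\<^sub>R vec period)"
        by (auto simp: lattice_def generated_lattice_def frame_def sum_1)
    next
      assume "\<exists>n :: int. l = (\<lambda>i. of_int n *\<^sub>R vec period)"
      then obtain n :: int where "l = (\<lambda>i. of_int n *\<^sub>R vec period)" ..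
      then show "(p, l) \<in> lattice"
        using p unfolding lattice_def generated_lattice_def frame_def
        by (intro CollectI exI[of _ p] exI[of _ "\<lambda>_. n"]) (simp add: sum_1)
    qed
    then show ?thesis by (auto simp: lattice_orbit_def q)
  qed
  also have "\<dots> \<longleftrightarrow> p' = p \<and> (\<exists>n :: int. v' () $ 1 = v () $ 1 + of_int n * period)"
    by (simp add: fun_eq_iff vec_eq_iff)
  also have "\<dots> \<longleftrightarrow> q' \<in> TM \<and>
      (\<exists>n :: int. tangent_coordinate q' = tangent_coordinate q + \<i> * of_real (of_int n * period))"
    using p by (auto simp: tangent_coordinate_def q complex_eq_iff tangent_bundle_model)
  finally show ?thesis by (simp add: upstairs_def cover_eq_iff)
qed

lemma lattice_orbit_eq_iff:
  assumes "q \<in> TM" "q' \<in> TM"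
  shows "lattice_orbit lattice q = lattice_orbit lattice q' \<longleftrightarrow> upstairs q = upstairs q'"
proof
  assume "lattice_orbit lattice q = lattice_orbit lattice q'"
  then have "q \<in> lattice_orbit lattice q'" using lattice_orbit_iff[OF assms(1)] assms(1) by blast
  then show "upstairs q = upstairs q'" using lattice_orbit_iff[OF assms(2)] by blast
next
  assume "upstairs q = upstairs q'"
  then show "lattice_orbit lattice q = lattice_orbit lattice q'"
    using lattice_orbit_iff[OF assms(1)] lattice_orbit_iff[OF assms(2)] by (intro set_eqI) simp
qed

text \<open>The map induced on orbits by the covering; it does not depend on the representative because orbits
  are fibres.\<close>

definition torify :: "(real \<times> (unit \<Rightarrow> real^1)) set \<Rightarrow> 'p" where
  "torify Q = inv_into (points N) k (upstairs (SOME q. q \<in> Q))"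

lemma coordinate_bij: "bij_betw k (points N) A"
  using homeomorphic_imp_injective_map[OF coordinate] homeomorphic_imp_surjective_map[OF coordinate]
  by (simp add: bij_betw_def)

lemma k_inv: "w \<in> A \<Longrightarrow> k (inv_into (points N) k w) = w"
  and inv_in: "w \<in> A \<Longrightarrow> inv_into (points N) k w \<in> points N"
  and inv_k: "p \<in> points N \<Longrightarrow> inv_into (points N) k (k p) = p"
  and k_in: "p \<in> points N \<Longrightarrow> k p \<in> A"
  using coordinate_bij by (auto simp: bij_betw_def f_inv_into_f inv_into_into)

lemma upstairs_in: "q \<in> TM \<Longrightarrow> upstairs q \<in> A"
  using upstairs_image by blast

lemma torify_orbit:
  assumes "q \<in> TM"
  shows "torify (lattice_orbit lattice q) = inv_into (points N) k (upstairs q)"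
proof -
  have "q \<in> lattice_orbit lattice q" using lattice_orbit_iff[OF assms] assms by simp
  then have "(SOME q'. q' \<in> lattice_orbit lattice q) \<in> lattice_orbit lattice q" by (rule someI)
  then show ?thesis using lattice_orbit_iff[OF assms] by (simp add: torify_def)
qed

lemma k_torify: "q \<in> TM \<Longrightarrow> k (torify (lattice_orbit lattice q)) = upstairs q"
  by (simp add: torify_orbit k_inv upstairs_in)

lemma points_quotient: "points quotient = lattice_orbit lattice ` TM"
  by (simp add: quotient_manifold_def topspace_quotient_top points_dombrowski)

lemma torify_bij: "bij_betw torify (points quotient) (points N)"
  unfolding bij_betw_def points_quotient
proof
  show "inj_on torify (lattice_orbit lattice ` TM)"
    by (rule inj_onI, clarify) (metis k_torify lattice_orbit_eq_iff)
  show "torify ` lattice_orbit lattice ` TM = points N"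
  proof (intro subset_antisym subsetI)
    fix p assume "p \<in> points N"
    then obtain q where "q \<in> TM" "upstairs q = k p" using k_in upstairs_image by (metis imageE)
    then have "torify (lattice_orbit lattice q) = p" using torify_orbit inv_k \<open>p \<in> points N\<close> by simp
    then show "p \<in> torify ` lattice_orbit lattice ` TM" using \<open>q \<in> TM\<close> by blast
  qed (auto simp: torify_orbit inv_in upstairs_in)
qed

lemma openin_N: "U \<subseteq> points N \<Longrightarrow> openin (mtop N) U \<longleftrightarrow> open (k ` U)"
  using homeomorphic_map_openness[OF coordinate, of U] open_A k_in by (auto simp: openin_open_eq)

lemma torify_continuous: "continuous_map (mtop quotient) (mtop N) torify"
proof -
  have "continuous_map (mtop (dombrowski (model c))) (mtop N) (torify \<circ> lattice_orbit lattice)"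
    unfolding continuous_map_def
  proof (intro conjI allI impI)
    show "torify \<circ> lattice_orbit lattice \<in> points (dombrowski (model c)) \<rightarrow> points N"
      by (auto simp: points_dombrowski torify_orbit inv_in upstairs_in)
    fix U assume U: "openin (mtop N) U"
    have "tangent_coordinate ` {q \<in> TM. (torify \<circ> lattice_orbit lattice) q \<in> U} =
        {z. Re z \<in> model_set c} \<inter> cover -` (k ` U)"
    proof -
      have "(torify \<circ> lattice_orbit lattice) q \<in> U \<longleftrightarrow> cover (tangent_coordinate q) \<in> k ` U" if "q \<in> TM" for q
      proof -
        let ?p = "torify (lattice_orbit lattice q)"
        have "?p \<in> points N" using that by (simp add: torify_orbit inv_in upstairs_in)
        then have "?p \<in> U \<longleftrightarrow> k ?p \<in> k ` U"
          using coordinate_bij openin_subset[OF U] inj_on_image_mem_iff by (metis bij_betw_def)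
        then show ?thesis using k_torify[OF that] by (simp add: upstairs_def)
      qed
      then have "tangent_coordinate ` {q \<in> TM. (torify \<circ> lattice_orbit lattice) q \<in> U} =
          tangent_coordinate ` TM \<inter> cover -` (k ` U)"
        by blast
      then show ?thesis by (simp only: tangent_coordinate_tangent_bundle)
    qed
    moreover have "open \<dots>"
    proof (rule continuous_open_preimage[OF _ open_half_plane])
      show "continuous_on {z. Re z \<in> model_set c} cover"
        using derivative_cover DERIV_isCont by (intro continuous_at_imp_continuous_on) blast
      show "open (k ` U)" using openin_N[OF openin_subset[OF U]] U by simp
    qed
    ultimately show "openin (mtop (dombrowski (model c)))
        {q \<in> points (dombrowski (model c)). (torify \<circ> lattice_orbit lattice) q \<in> U}"
      by (simp add: openin_dombrowski points_dombrowski)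
  qed
  then show ?thesis
    unfolding quotient_manifold_def by (simp add: continuous_map_from_quotient_top)
qed

definition untorify :: "'p \<Rightarrow> (real \<times> (unit \<Rightarrow> real^1)) set" where
  "untorify = inv_into (points quotient) torify"

lemma untorify_torify: "q \<in> TM \<Longrightarrow> untorify (torify (lattice_orbit lattice q)) = lattice_orbit lattice q"
  unfolding untorify_def using torify_bij
  by (intro inv_into_f_f) (auto simp: bij_betw_def points_quotient)

lemma torify_untorify: "p \<in> points N \<Longrightarrow> torify (untorify p) = p"
  and untorify_in: "p \<in> points N \<Longrightarrow> untorify p \<in> points quotient"
  unfolding untorify_def using torify_bij by (auto simp: bij_betw_def f_inv_into_f inv_into_into)

lemma untorify_continuous: "continuous_map (mtop N) (mtop quotient) untorify"
  unfolding continuous_map_def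
proof (intro conjI allI impI)
  show "untorify \<in> points N \<rightarrow> points quotient" using untorify_in by blast
  fix U assume U: "openin (mtop quotient) U"
  let ?W = "{q \<in> TM. lattice_orbit lattice q \<in> U}"
  have "openin (mtop (dombrowski (model c))) ?W" and sub: "U \<subseteq> lattice_orbit lattice ` TM"
    using U by (simp_all add: quotient_manifold_def openin_quotient_top points_dombrowski)
  then have "open (tangent_coordinate ` ?W)" by (simp add: openin_dombrowski)
  then have "open (cover ` tangent_coordinate ` ?W)" by (rule open_cover_image)
  moreover have "cover ` tangent_coordinate ` ?W = k ` {p \<in> points N. untorify p \<in> U}"
  proof (intro subset_antisym subsetI)
    fix w assume "w \<in> cover ` tangent_coordinate ` ?W"
    then obtain q where q: "q \<in> TM" "lattice_orbit lattice q \<in> U" "w = upstairs q"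
      by (auto simp: upstairs_def)
    then show "w \<in> k ` {p \<in> points N. untorify p \<in> U}"
      using untorify_torify[OF q(1)] k_torify[OF q(1)] torify_orbit[OF q(1)] inv_in[OF upstairs_in[OF q(1)]]
      by (intro image_eqI[of _ _ "torify (lattice_orbit lattice q)"]) auto
  next
    fix w assume "w \<in> k ` {p \<in> points N. untorify p \<in> U}"
    then obtain p where p: "p \<in> points N" "untorify p \<in> U" "w = k p" by blast
    then obtain q where q: "q \<in> TM" "untorify p = lattice_orbit lattice q" using sub by blast
    then have "w = upstairs q" using p torify_untorify[OF p(1)] k_torify[OF q(1)] by simp
    then show "w \<in> cover ` tangent_coordinate ` ?W" using p q by (auto simp: upstairs_def)
  qed
  ultimately show "openin (mtop N) {p \<in> points N. untorify p \<in> U}"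
    by (simp add: openin_N)
qed

end

text \<open>A chart of the quotient comes from affine coordinates \<open>(U, x)\<close> and an open set \<open>V\<close> of tangent
  vectors on which the projection to the quotient is injective.\<close>

locale quotient_chart = exponential_covering c \<alpha> \<beta> N A k g g' \<rho> + affine_chart c U x
  for c \<alpha> \<beta> :: real and N :: "('p, 'j, complex^1) riemannian" and A k g g' \<rho> U x +
  fixes V :: "(real \<times> (unit \<Rightarrow> real^1)) set"
  assumes V_open: "openin (mtop (dombrowski (model c))) V" and V_sub: "V \<subseteq> tangent_dom (model c) (U, x)"
    and V_inj: "inj_on (lattice_orbit lattice) V"
begin

abbreviation tchart :: "real \<times> (unit \<Rightarrow> real^1) \<Rightarrow> complex^1" where
  "tchart \<equiv> tangent_chart (model c) (U, x)"

lemma V_TM: "q \<in> V \<Longrightarrow> q \<in> TM"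
  using V_sub by (auto simp: tangent_dom_def)

lemma tchart_in: "q \<in> V \<Longrightarrow> tchart q $ 1 \<in> tangent_domain"
  and tangent_inverse_tchart: "q \<in> V \<Longrightarrow> tangent_inverse (tchart q $ 1) = tangent_coordinate q"
  using V_sub tangent_chart_eq by (metis subsetD surj_pair)+

lemma open_tchart_V: "open (tchart ` V)"
  using V_open by (intro open_tangent_chart_image V_sub) (simp add: openin_dombrowski)

lemma tchart_inj: "inj_on tchart V"
  using tangent_chart_inj V_sub by (rule inj_on_subset)

lemma cdom_quotient: "cdom quotient ((U, x), V) = lattice_orbit lattice ` V"
  by (simp add: quotient_manifold_def)

lemma cmap_quotient:
  assumes "q \<in> V"
  shows "cmap quotient ((U, x), V) (lattice_orbit lattice q) = tchart q"
  using assms V_inj by (simp add: quotient_manifold_def dombrowski_def)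

lemma cimage_quotient: "cimage quotient ((U, x), V) = tchart ` V"
  by (simp add: cimage_def cdom_quotient image_image cmap_quotient)

lemma cinv_quotient:
  assumes "q \<in> V"
  shows "cinv quotient ((U, x), V) (tchart q) = lattice_orbit lattice q"
  unfolding cinv_def
proof (rule inv_into_f_eq)
  show "inj_on (cmap quotient ((U, x), V)) (cdom quotient ((U, x), V))"
    unfolding cdom_quotient
    by (rule inj_onI, clarify) (metis cmap_quotient inj_onD[OF tchart_inj])
qed (use assms cmap_quotient cdom_quotient in auto)

definition torify_loc :: "'j \<Rightarrow> complex \<Rightarrow> complex" where
  "torify_loc j w = g j (cover (tangent_inverse w))"

lemma derivative_torify_loc:
  assumes "j \<in> charts N" "z \<in> tchart ` V"
  defines "w \<equiv> cover (tangent_inverse (z $ 1))"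
  shows "(torify_loc j has_field_derivative g' j w * (of_real \<alpha> * w * of_real (slope (Re (z $ 1))))) (at (z $ 1))"
    and "g' j w * (of_real \<alpha> * w * of_real (slope (Re (z $ 1)))) \<noteq> 0"
proof -
  obtain q where q: "q \<in> V" "z = tchart q" using assms(2) by blast
  have w: "w \<in> A" using upstairs_in[OF V_TM[OF q(1)]] tangent_inverse_tchart[OF q(1)]
    by (simp add: w_def q upstairs_def)
  have D1: "(tangent_inverse has_field_derivative of_real (slope (Re (z $ 1)))) (at (z $ 1))"
    using derivative_tangent_inverse tchart_in[OF q(1)] q(2) by blast
  have D2: "((\<lambda>z. cover (tangent_inverse z)) has_field_derivative
      of_real \<alpha> * w * of_real (slope (Re (z $ 1)))) (at (z $ 1))"
    using DERIV_chain2[OF derivative_cover D1] by (simp add: w_def)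
  show "(torify_loc j has_field_derivative g' j w * (of_real \<alpha> * w * of_real (slope (Re (z $ 1))))) (at (z $ 1))"
    unfolding torify_loc_def[abs_def]
    using DERIV_chain2[OF _ D2, of "g j" "g' j w"] g_deriv[OF assms(1) w] by (simp add: w_def)
  show "g' j w * (of_real \<alpha> * w * of_real (slope (Re (z $ 1)))) \<noteq> 0"
    using g'_nonzero[OF assms(1) w] positive slope_nonzero tchart_in[OF q(1)] q(2)
    by (simp add: w_def cover_nonzero)
qed

lemma rep_domain_torify: "j \<in> charts N \<Longrightarrow> rep_domain quotient N torify ((U, x), V) j = tchart ` V"
proof -
  assume j: "j \<in> charts N"
  have "{Q \<in> cdom quotient ((U, x), V). torify Q \<in> cdom N j} = lattice_orbit lattice ` V"
    using torify_orbit inv_in upstairs_in V_TM by (auto simp: cdom_quotient global[OF j])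
  then show ?thesis by (simp add: rep_domain_def image_image cmap_quotient)
qed

lemma local_rep_torify:
  assumes "j \<in> charts N" "z \<in> tchart ` V"
  shows "local_rep quotient N torify ((U, x), V) j z = vec (torify_loc j (z $ 1))"
proof -
  obtain q where q: "q \<in> V" "z = tchart q" using assms(2) by blast
  note TM = V_TM[OF q(1)]
  have "torify (lattice_orbit lattice q) \<in> points N" using TM by (simp add: torify_orbit inv_in upstairs_in)
  then show ?thesis
    using assms(1)
    by (simp add: local_rep_def q(2) cinv_quotient[OF q(1)] cmap_N k_torify[OF TM] torify_loc_def
        tangent_inverse_tchart[OF q(1)] upstairs_def)
qed

lemma metric_quotient:
  assumes "z \<in> tchart ` V"
  shows "metric quotient ((U, x), V) z v w = tangent_density (z $ 1) * (v \<bullet> w)"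
proof -
  have "z $ 1 \<in> tangent_domain" using assms tchart_in by blast
  from dombrowski_metric[OF this] show ?thesis by (simp add: quotient_manifold_def)
qed

lemma torify_conformal:
  assumes "j \<in> charts N" "z \<in> tchart ` V"
  shows "conformal_isometry_at (\<lambda>_. tangent_density) \<rho> i j (local_rep quotient N torify ((U, x), V) j) z"
proof (rule conformal_isometry_atI[OF open_tchart_V assms(2) local_rep_torify[OF assms(1)]
      derivative_torify_loc(1)[OF assms]])
  obtain q where q: "q \<in> V" "z = tchart q" using assms(2) by blast
  let ?w = "cover (tangent_inverse (z $ 1))"
  have Re: "Re (tangent_inverse (z $ 1)) \<in> model_set c"
    using V_TM[OF q(1)] tangent_coordinate_tangent_bundle[of c] tangent_inverse_tchart[OF q(1)] q(2) by auto
  have "\<rho> j (g j ?w) * (cmod (g' j ?w * (of_real \<alpha> * ?w * of_real (slope (Re (z $ 1))))))\<^sup>2 =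
      \<rho> j (g j ?w) * (cmod (g' j ?w) * (\<alpha> * cmod ?w))\<^sup>2 * (slope (Re (z $ 1)))\<^sup>2"
    using positive by (simp add: norm_mult power_mult_distrib mult_ac)
  also have "\<dots> = tangent_density (z $ 1)"
    unfolding tangent_density_def by (subst pullback[OF assms(1) Re]) (simp_all add: cover_def)
  finally show "\<rho> j (torify_loc j (z $ 1)) *
      (cmod (g' j ?w * (of_real \<alpha> * ?w * of_real (slope (Re (z $ 1))))))\<^sup>2 = tangent_density (z $ 1)"
    by (simp add: torify_loc_def)
qed

text \<open>In charts, the inverse map is a local inverse of a map with nonzero complex derivative.\<close>

lemma untorify_holomorphic:
  assumes j: "j \<in> charts N" and z: "z \<in> rep_domain N quotient untorify j ((U, x), V)"
  shows "\<exists>a. (local_rep N quotient untorify j ((U, x), V) has_derivative (\<lambda>v. vec (a * v $ 1))) (at z)"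
proof -
  let ?\<psi> = "local_rep quotient N torify ((U, x), V) j" and ?f = "local_rep N quotient untorify j ((U, x), V)"
  have cinv: "cinv N j (cmap N j p) = p" if "p \<in> points N" for p
    unfolding cinv_def global[OF j]
  proof (rule inv_into_f_f[OF _ that], rule inj_onI)
    fix p p' assume "p \<in> points N" "p' \<in> points N" "cmap N j p = cmap N j p'"
    then show "p = p'"
      using cmap_N[OF j] inj_onD[OF g_inj[OF j]] k_in inv_k by (metis vec_component)
  qed
  have inverse: "?f (?\<psi> y) = y" if y: "y \<in> tchart ` V" for y
  proof -
    obtain q where q: "q \<in> V" "y = tchart q" using y by blast
    have p: "torify (lattice_orbit lattice q) \<in> points N"
      using V_TM[OF q(1)] by (simp add: torify_orbit inv_in upstairs_in)
    have "?\<psi> y = cmap N j (torify (lattice_orbit lattice q))"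
      by (simp add: local_rep_def q(2) cinv_quotient[OF q(1)])
    then show ?thesis
      by (simp add: local_rep_def[of N] cinv[OF p] untorify_torify V_TM q cmap_quotient)
  qed
  obtain p where p: "p \<in> points N" "untorify p \<in> lattice_orbit lattice ` V" "z = cmap N j p"
    using z by (auto simp: rep_domain_def global[OF j] cdom_quotient)
  then obtain q where q: "q \<in> V" "untorify p = lattice_orbit lattice q" by blast
  have "p = torify (lattice_orbit lattice q)" using torify_untorify[OF p(1)] q(2) by simp
  then have z_eq: "z = ?\<psi> (tchart q)" using p(3) by (simp add: local_rep_def cinv_quotient[OF q(1)])
  have y: "tchart q \<in> tchart ` V" using q(1) by blast
  define a where "a y = g' j (cover (tangent_inverse (y $ 1))) *
    (of_real \<alpha> * cover (tangent_inverse (y $ 1)) * of_real (slope (Re (y $ 1))))" for y :: "complex^1"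
  have D: "(?\<psi> has_derivative (\<lambda>v. vec (a y * v $ 1))) (at y)" if "y \<in> tchart ` V" for y
    unfolding a_def using open_tchart_V that local_rep_torify[OF j] derivative_torify_loc(1)[OF j that]
    by (rule has_derivative_vec_1_transform)
  have "(?f has_derivative (\<lambda>v. vec (inverse (a (tchart q)) * v $ 1))) (at (?\<psi> (tchart q)))"
  proof (rule has_derivative_inverse_strong[OF open_tchart_V y _ inverse D[OF y]])
    show "continuous_on (tchart ` V) ?\<psi>"
      using D has_derivative_continuous by (intro continuous_at_imp_continuous_on) blast
    show "(\<lambda>v :: complex^1. vec (a (tchart q) * v $ 1) :: complex^1) \<circ>
        (\<lambda>v. vec (inverse (a (tchart q)) * v $ 1)) = (id :: complex^1 \<Rightarrow> complex^1)"
      using derivative_torify_loc(2)[OF j y] unfolding a_def[symmetric]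
      by (simp add: fun_eq_iff vec_nth_1 mult.assoc[symmetric])
  qed
  then show ?thesis using z_eq by blast
qed

end

context exponential_covering
begin

lemma torify_diffeo: "holomorphic_isometric_diffeo quotient N torify"
proof -
  have chart: "quotient_chart c \<alpha> \<beta> N A k g g' \<rho> U x V" if "((U, x), V) \<in> charts quotient" for U x V
    using that by unfold_locales (auto simp: quotient_manifold_def dombrowski_def)
  define dens where "dens = (\<lambda>((U, x), V :: (real \<times> (unit \<Rightarrow> real^1)) set). affine_chart.tangent_density c U x)"
  have dens: "metric quotient i z v w = dens i (z $ 1) * (v \<bullet> w)"
    if i: "i \<in> charts quotient" and z: "z \<in> cimage quotient i" for i z v w
  proof -
    obtain U x V where i_eq: "i = ((U, x), V)" by (metis surj_pair)
    interpret quotient_chart c \<alpha> \<beta> N A k g g' \<rho> U x V using chart i i_eq by simp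
    show ?thesis using z metric_quotient cimage_quotient by (simp add: i_eq dens_def)
  qed
  have conf: "conformal_isometry_at dens \<rho> i j (local_rep quotient N torify i j) z"
    if i: "i \<in> charts quotient" and j: "j \<in> charts N" and z: "z \<in> rep_domain quotient N torify i j" for i j z
  proof -
    obtain U x V where i_eq: "i = ((U, x), V)" by (metis surj_pair)
    interpret quotient_chart c \<alpha> \<beta> N A k g g' \<rho> U x V using chart i i_eq by simp
    show ?thesis
      using z torify_conformal[OF j] rep_domain_torify[OF j]
      by (simp add: i_eq conformal_isometry_at_def dens_def)
  qed
  have "holomorphic_map N quotient untorify"
    unfolding holomorphic_map_def
  proof (intro conjI ballI untorify_continuous cholomorphic_on_1I)
    fix i j z assume i: "i \<in> charts quotient" and j: "j \<in> charts N"
      and z: "z \<in> rep_domain N quotient untorify j i"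
    obtain U x V where i_eq: "i = ((U, x), V)" by (metis surj_pair)
    interpret quotient_chart c \<alpha> \<beta> N A k g g' \<rho> U x V using chart i i_eq by simp
    show "\<exists>a. (local_rep N quotient untorify j i has_derivative (\<lambda>v. vec (a * v $ 1))) (at z)"
      using untorify_holomorphic[OF j] z by (simp add: i_eq)
  qed
  then show ?thesis
    unfolding holomorphic_isometric_diffeo_def untorify_def
    using torify_bij conformal_holomorphic_isometric_map[OF dens conformal torify_continuous conf] by blast
qed

lemma frame_generates: "lattice_generator (model c) lattice frame"
proof -
  have "parallel_field (model c) (frame k)" for k
    unfolding parallel_field_def
  proof (intro conjI ballI allI)
    show "frame k p \<in> tangent_space (model c) p" if "p \<in> points (model c)" for p
      using that by (auto simp: tangent_space_def frechet_transition_model)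
    show "smooth_on (\<lambda>x. frame k (cinv (model c) i x) i) (cimage (model c) i)" for i
      by (simp add: frame_def smooth_on_const)
    show "frechet_derivative (\<lambda>y. frame k (cinv (model c) i y) i) (at x) u
        + conn (model c) i x u (frame k (cinv (model c) i x) i) = 0" for i x u
      by (simp add: frame_def)
  qed
  moreover have "\<exists>!a :: real^1. v = (\<lambda>i. \<Sum>k\<in>UNIV. a $ k *\<^sub>R frame k p i)" for v :: "unit \<Rightarrow> real^1" and p
    using period_pos
    by (intro ex1I[of _ "vec (v () $ 1 / period)"]) (auto simp: sum_1 frame_def vec_eq_iff fun_eq_iff)
  ultimately show ?thesis
    by (simp add: lattice_generator_def parallel_frame_def lattice_def)
qed

text \<open>Translation by \<open>t (2 \<pi> / \<alpha>) \<partial>\<^sub>\<theta>\<close> multiplies \<open>exp (\<alpha> \<zeta>)\<close> by \<open>exp (2 \<i> \<pi> t)\<close>.\<close>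

lemma lattice_action_orbit:
  assumes "q \<in> TM" "abs_torus t = a"
  shows "lattice_action frame a (lattice_orbit lattice q) = lattice_orbit lattice (translate frame t q)"
    and "translate frame t q \<in> TM" and "upstairs (translate frame t q) = unit_phase a * upstairs q"
proof -
  have coord: "tangent_coordinate (translate frame s q) = tangent_coordinate q + \<i> * of_real (s $ 1 * period)" for s q
    by (simp add: translate_def frame_def tangent_coordinate_def complex_eq_iff sum_1 split_beta)
  have TM: "translate frame s q \<in> TM" if "q \<in> TM" for s q
    using that by (auto simp: translate_def tangent_bundle_model)
  then show "translate frame t q \<in> TM" using assms by blast
  have up: "upstairs (translate frame s q) = unit_phase (abs_torus s) * upstairs q" for s q
  proof -
    have "upstairs (translate frame s q) = cover (tangent_coordinate q) * exp (of_real \<alpha> * (\<i> * of_real (s $ 1 * period)))"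
      unfolding upstairs_def coord cover_def by (simp add: exp_add distrib_left)
    also have "of_real \<alpha> * (\<i> * of_real (s $ 1 * period)) = 2 * \<i> * of_real pi * of_real (s $ 1)"
      using positive by (simp add: period_def)
    finally show ?thesis by (simp add: unit_phase.abs_eq upstairs_def)
  qed
  then show "upstairs (translate frame t q) = unit_phase a * upstairs q" using assms(2) by blast
  show "lattice_action frame a (lattice_orbit lattice q) = lattice_orbit lattice (translate frame t q)"
  proof (intro subset_antisym subsetI)
    fix r assume "r \<in> lattice_action frame a (lattice_orbit lattice q)"
    then obtain s q' where s: "abs_torus s = a" "q' \<in> lattice_orbit lattice q" "r = translate frame s q'"
      by (auto simp: lattice_action_def)
    then show "r \<in> lattice_orbit lattice (translate frame t q)"
      using lattice_orbit_iff[OF assms(1)] lattice_orbit_iff[OF TM[OF assms(1)]] TM up assms(2) by simp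
  next
    fix r assume r: "r \<in> lattice_orbit lattice (translate frame t q)"
    have inv: "translate frame t (translate frame (- t) r) = r"
      by (simp add: translate_def frame_def split_beta sum_1 vec_eq_iff prod_eq_iff fun_eq_iff)
    have "r \<in> TM" "upstairs r = unit_phase a * upstairs q"
      using r lattice_orbit_iff[OF TM[OF assms(1)]] up assms(2) by simp_all
    moreover have "upstairs r = unit_phase a * upstairs (translate frame (- t) r)"
      using up[of t "translate frame (- t) r"] inv assms(2) by simp
    moreover have "unit_phase a \<noteq> 0" unfolding assms(2)[symmetric] by (simp add: unit_phase.abs_eq)
    ultimately have "translate frame (- t) r \<in> lattice_orbit lattice q"
      using lattice_orbit_iff[OF assms(1)] TM by simp
    then show "r \<in> lattice_action frame a (lattice_orbit lattice q)"
      unfolding lattice_action_def using inv assms(2) by (metis (mono_tags, lifting) UN_iff imageI mem_Collect_eq)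
  qed
qed

lemma torify_equivariant:
  assumes \<Phi>: "\<And>a p. p \<in> points N \<Longrightarrow> \<Phi> a p \<in> points N \<and> k (\<Phi> a p) = unit_phase a * k p"
    and "Q \<in> points quotient"
  shows "torify (lattice_action frame a Q) = \<Phi> a (torify Q)"
proof -
  obtain q where q: "q \<in> TM" "Q = lattice_orbit lattice q" using assms(2) by (auto simp: points_quotient)
  obtain t where t: "abs_torus t = a" using Quotient_abs_rep[OF Quotient_torus] by blast
  let ?p = "torify (lattice_orbit lattice q)"
  have p: "?p \<in> points N" using q(1) by (simp add: torify_orbit inv_in upstairs_in)
  have "\<Phi> a ?p \<in> points N" using \<Phi>[OF p] by blast
  then have "\<Phi> a ?p = inv_into (points N) k (k (\<Phi> a ?p))" by (simp only: inv_k)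
  also have "k (\<Phi> a ?p) = unit_phase a * upstairs q" using \<Phi>[OF p] k_torify[OF q(1)] by simp
  finally show ?thesis
    using lattice_action_orbit[OF q(1) t] by (simp add: q(2) torify_orbit)
qed

end

text \<open>All that depends on the space form is the covering of its free part and the elementary properties
  of its rotation; the dually flat structure, the lattice and the equivariant isometry are common to
  the three cases.\<close>

lemma torificationI:
  fixes N :: "('p, 'j, complex^1) riemannian" and \<Phi> :: "1 torus \<Rightarrow> 'p \<Rightarrow> 'p"
  assumes N: "kaehler_manifold N" "connected_space (mtop N)" "torus_action N \<Phi>" "effective_action N \<Phi>"
      "\<And>a. holomorphic_map N N (\<Phi> a)" "\<And>a. isometric_map N N (\<Phi> a)"
    and cov: "exponential_covering c \<alpha> \<beta> (open_submanifold N (free_points N \<Phi>)) A k g g' \<rho>"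
    and \<Phi>: "\<And>a p. p \<in> free_points N \<Phi> \<Longrightarrow> \<Phi> a p \<in> free_points N \<Phi> \<and> k (\<Phi> a p) = unit_phase a * k p"
  shows "torification (model c) N \<Phi>"
proof -
  interpret exponential_covering c \<alpha> \<beta> "open_submanifold N (free_points N \<Phi>)" A k g g' \<rho> by (rule cov)
  have pts: "points (open_submanifold N (free_points N \<Phi>)) = free_points N \<Phi>"
    by (auto simp: open_submanifold_def topspace_subtopology free_points_def)
  have "connected_space (mtop (model c))"
    using connected_model_set[of c, folded connectedin_iff_connected] by (simp add: connectedin_def)
  moreover have "torify (lattice_action frame a Q) = \<Phi> a (torify Q)" if "Q \<in> points quotient" for a Q
    by (rule torify_equivariant[OF _ that]) (use \<Phi> pts in auto)
  ultimately show ?thesis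
    unfolding torification_def Let_def
    using N dually_flat_manifold_model torify_diffeo frame_generates by blast
qed

section \<open>Rotations\<close>

lemma unit_phase_abs: "unit_phase (abs_torus t) = exp (2 * \<i> * of_real pi * of_real (t $ 1))"
  by (rule unit_phase.abs_eq)

lemma norm_unit_phase [simp]: "cmod (unit_phase a) = 1"
  by transfer simp

lemma unit_phase_nonzero [simp]: "unit_phase a \<noteq> 0"
  using norm_unit_phase[of a] by (metis norm_zero zero_neq_one)

lemma unit_phase_0 [simp]: "unit_phase 0 = 1"
  by transfer simp

lemma unit_phase_add: "unit_phase (a + b) = unit_phase a * unit_phase b"
  by transfer (simp add: exp_add distrib_left)

lemma unit_phase_eq_1_iff: "unit_phase a = 1 \<longleftrightarrow> a = 0"
proof transfer
  fix t :: "real^1"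
  have "exp (2 * \<i> * of_real pi * of_real (t $ 1)) = 1 \<longleftrightarrow> (\<exists>n :: int. 2 * pi * t $ 1 = of_int (2 * n) * pi)"
    by (simp add: exp_eq_1)
  also have "\<dots> \<longleftrightarrow> t $ 1 \<in> \<int>"
    by (auto simp: Ints_def)
  also have "\<dots> \<longleftrightarrow> (\<forall>k. t $ k - 0 $ k \<in> \<int>)" by simp
  finally show "(exp (2 * \<i> * of_real pi * of_real (t $ 1)) = 1) = (\<forall>k. t $ k - 0 $ k \<in> \<int>)" .
qed

lemma nontrivial_torus: "\<exists>a :: 1 torus. a \<noteq> 0"
proof -
  have "unit_phase (abs_torus (vec (1 / 2))) = - 1"
    by (simp add: unit_phase_abs)
  then show ?thesis using unit_phase_0 by (metis one_neq_neg_one)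
qed

text \<open>The version with the inverse phase is the rotation of the projective line in the coordinate
  \<open>z\<^sub>1 / z\<^sub>0\<close>.\<close>

lemma smooth_on_phase:
  assumes "open S"
  shows "smooth_on (\<lambda>x :: (real^1) \<times> (complex^1). unit_phase (abs_torus (fst x)) * snd x $ 1) S"
    and "smooth_on (\<lambda>x :: (real^1) \<times> (complex^1). inverse (unit_phase (abs_torus (fst x))) * snd x $ 1) S"
proof -
  have lin: "bounded_linear (\<lambda>x :: (real^1) \<times> (complex^1). k * \<i> * of_real pi * of_real (fst x $ 1))" for k
    by (intro bounded_linear_compose[OF bounded_linear_mult_right]
        bounded_linear_compose[OF bounded_linear_of_real]
        bounded_linear_compose[OF bounded_linear_nth_1] bounded_linear_fst)
  have e: "smooth_on (\<lambda>x :: (real^1) \<times> (complex^1). exp (k * \<i> * of_real pi * of_real (fst x $ 1))) S" for k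
    by (rule smooth_on_compose[OF assms open_UNIV _ smooth_on_exp smooth_on_bounded_linear[OF assms lin]]) simp
  have z: "smooth_on (\<lambda>x :: (real^1) \<times> (complex^1). snd x $ 1) S"
    by (intro smooth_on_bounded_linear assms bounded_linear_compose[OF bounded_linear_nth_1] bounded_linear_snd)
  show "smooth_on (\<lambda>x :: (real^1) \<times> (complex^1). unit_phase (abs_torus (fst x)) * snd x $ 1) S"
    unfolding unit_phase_abs by (intro smooth_on_mult assms e z)
  have "inverse (unit_phase (abs_torus t)) = exp ((- 2) * \<i> * of_real pi * of_real (t $ 1))" for t :: "real^1"
    by (simp add: unit_phase_abs exp_minus)
  then show "smooth_on (\<lambda>x :: (real^1) \<times> (complex^1). inverse (unit_phase (abs_torus (fst x))) * snd x $ 1) S"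
    by (simp only:) (intro smooth_on_mult assms e z)
qed

lemma continuous_phase: "continuous_on S (\<lambda>t. unit_phase (abs_torus t))"
  unfolding unit_phase_abs by (intro continuous_intros)

lemma analytic_near_Re: "analytic_near x (\<lambda>z :: complex^1. Re (z $ 1))"
  and analytic_near_Im: "analytic_near x (\<lambda>z :: complex^1. Im (z $ 1))"
proof -
  have "axis 1 1 \<in> (Basis :: (complex^1) set)" "axis 1 \<i> \<in> (Basis :: (complex^1) set)"
    by (auto simp: Basis_vec_def Basis_complex_def)
  from this[THEN analytic_near_coordinate, of x]
  show "analytic_near x (\<lambda>z :: complex^1. Re (z $ 1))" "analytic_near x (\<lambda>z :: complex^1. Im (z $ 1))"
    by (simp_all add: inner_axis)
qed

section \<open>The disc and the plane\<close>

definition plane_domain :: "complex set \<Rightarrow> (complex \<Rightarrow> real) \<Rightarrow> (complex, unit, complex^1) riemannian" where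
  "plane_domain A \<rho> = \<lparr>mtop = top_of_set A, charts = {()}, cdom = (\<lambda>_. A), cmap = (\<lambda>_ z. vec z),
     metric = (\<lambda>_ z v w. \<rho> (z $ 1) * (v \<bullet> w))\<rparr>"

lemma plane_domain_simps [simp]:
  "mtop (plane_domain A \<rho>) = top_of_set A" "charts (plane_domain A \<rho>) = {()}"
  "cdom (plane_domain A \<rho>) i = A" "cmap (plane_domain A \<rho>) i = vec"
  "metric (plane_domain A \<rho>) i z v w = \<rho> (z $ 1) * (v \<bullet> w)"
  "cimage (plane_domain A \<rho>) i = {z. z $ 1 \<in> A}"
  by (simp_all add: plane_domain_def cimage_def vec_image_1)

lemma cinv_plane_domain: "z $ 1 \<in> A \<Longrightarrow> cinv (plane_domain A \<rho>) i z = z $ 1"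
  unfolding cinv_def by (rule inv_into_f_eq) (auto simp: inj_on_def vec_nth_1 vec_eq_iff)

lemma overlap_plane_domain [simp]: "overlap (plane_domain A \<rho>) i j = {z. z $ 1 \<in> A}"
  by (simp add: overlap_def vec_image_1)

lemma transition_plane_domain: "z $ 1 \<in> A \<Longrightarrow> transition (plane_domain A \<rho>) i j z = z"
  by (simp add: transition_def cinv_plane_domain vec_nth_1)

text \<open>The properties shared by the disc and the plane. Convexity gives simple connectedness, and segments
  between any two points.\<close>

locale rotation_invariant_domain =
  fixes A :: "complex set" and \<rho> :: "complex \<Rightarrow> real"
  assumes A: "open A" "convex A" "0 \<in> A"
    and \<rho>_smooth: "smooth_on \<rho> A" and \<rho>_pos: "z \<in> A \<Longrightarrow> 0 < \<rho> z"
    and rot: "cmod u = 1 \<Longrightarrow> z \<in> A \<Longrightarrow> u * z \<in> A" "cmod u = 1 \<Longrightarrow> \<rho> (u * z) = \<rho> z"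
begin

abbreviation N :: "(complex, unit, complex^1) riemannian" where
  "N \<equiv> plane_domain A \<rho>"

lemma topological_manifold_N: "topological_manifold N"
proof -
  have "homeomorphic_map (top_of_set A) (top_of_set {z. z $ 1 \<in> A}) (vec :: complex \<Rightarrow> complex^1)"
    using homeomorphic_map_vec_1[of A] by (simp add: vec_image_1)
  then show ?thesis
    by (simp add: topological_manifold_def second_countable_top_of_set Hausdorff_space_subtopology
        open_nth_1 A subtopology_subtopology)
qed

lemma conformal_N: "conformal_metric N (\<lambda>_. \<rho>)"
  by (simp add: conformal_metric_def)

lemma kaehler_N: "kaehler_manifold N"
proof (rule kaehler_manifold_conformal[OF topological_manifold_N conformal_N])
  show "smooth_on (\<lambda>z. \<rho> (z $ 1)) (cimage N i)" for i
    using smooth_on_vec_1(2)[OF A(1) \<rho>_smooth] by simp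
  show "conformal_isometry_at (\<lambda>_. \<rho>) (\<lambda>_. \<rho>) i j (transition N i j) z" if "z \<in> overlap N i j" for i j z
    by (rule conformal_isometry_atI[where g = "\<lambda>w. w" and a = 1 and \<Omega> = "{z. z $ 1 \<in> A}"])
      (use that in \<open>auto simp: transition_plane_domain vec_nth_1 open_nth_1 A\<close>)
qed (use \<rho>_pos in simp)

sublocale smooth_riemannian N
proof unfold_locales
  show "smooth_on (transition N i j) (overlap N i j)" for i j
    using smooth_on_cong[OF open_nth_1[OF A(1)], of "transition N i j" "\<lambda>z. z"]
      smooth_on_bounded_linear[OF open_nth_1[OF A(1)] bounded_linear_ident]
    by (simp add: transition_plane_domain)
qed (use kaehler_N in \<open>auto simp: kaehler_manifold_def topological_manifold_N\<close>)

lemma phase_in_iff: "unit_phase a * z \<in> A \<longleftrightarrow> z \<in> A"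
  using rot(1)[of "unit_phase a" z] rot(1)[of "inverse (unit_phase a)" "unit_phase a * z"]
  by (auto simp: norm_inverse mult.assoc[symmetric])

lemma torus_action_N: "torus_action N rotation"
proof -
  have "continuous_on (UNIV \<times> A) (\<lambda>(t, p). rotation (abs_torus t) p)"
    unfolding rotation_def case_prod_unfold
    by (intro continuous_intros continuous_on_compose2[OF continuous_phase[of UNIV]]) auto
  then have "continuous_map (top_of_set (UNIV \<times> A)) (top_of_set A) (\<lambda>(t, p). rotation (abs_torus t) p)"
    by (auto simp: continuous_map_in_subtopology rotation_def phase_in_iff)
  then have "continuous_map (prod_topology euclidean (top_of_set A)) (top_of_set A) (\<lambda>(t, p). rotation (abs_torus t) p)"
    using prod_topology_subtopology_eu[of "UNIV :: (real^1) set" A] by (simp only: subtopology_UNIV)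
  moreover have "smooth_on (\<lambda>(t, z). cmap N j (rotation (abs_torus t) (cinv N i z)))
          {(t, z). z \<in> cimage N i \<and> rotation (abs_torus t) (cinv N i z) \<in> cdom N j}" for i j
  proof -
    let ?S = "{x :: (real^1) \<times> (complex^1). snd x $ 1 \<in> A}"
    have S: "{(t, z). z \<in> cimage N i \<and> rotation (abs_torus t) (cinv N i z) \<in> cdom N j} = ?S"
      by (auto simp: cinv_plane_domain rotation_def phase_in_iff)
    have "open ((\<lambda>x :: (real^1) \<times> (complex^1). snd x $ 1) -` A)"
      by (intro open_vimage A continuous_intros)
    then have op: "open ?S" by (simp add: vimage_def)
    have "smooth_on (\<lambda>x. vec (unit_phase (abs_torus (fst x)) * snd x $ 1) :: complex^1) ?S"
      by (rule smooth_on_compose_linear[OF op bounded_linear_vec_1 smooth_on_phase(1)[OF op]])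
    moreover have "(case x of (t, z) \<Rightarrow> cmap N j (rotation (abs_torus t) (cinv N i z))) =
        vec (unit_phase (abs_torus (fst x)) * snd x $ 1)" if "x \<in> ?S" for x
      using that by (cases x) (simp add: cinv_plane_domain rotation_def)
    ultimately show ?thesis unfolding S by (subst smooth_on_cong[OF op])
  qed
  ultimately show ?thesis
    by (auto simp: torus_action_def rotation_def phase_in_iff unit_phase_add mult.assoc)
qed

lemma rotation_fixed_iff: "rotation a z = z \<longleftrightarrow> z = 0 \<or> a = 0"
proof -
  have "rotation a z = z \<longleftrightarrow> (unit_phase a - 1) * z = 0" by (simp add: rotation_def algebra_simps)
  then show ?thesis by (auto simp: unit_phase_eq_1_iff)
qed

lemma free_points_N: "free_points N rotation = A - {0}"
  using nontrivial_torus by (auto simp: free_points_def rotation_fixed_iff)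

lemma effective_N: "effective_action N rotation"
proof -
  obtain r where "r > 0" "ball 0 r \<subseteq> A" using A openE by blast
  then have "of_real (r / 2) \<in> A" by (auto simp: subset_iff)
  then show ?thesis using \<open>r > 0\<close> by (auto simp: effective_action_def rotation_fixed_iff)
qed

lemma rotation_holomorphic_isometric: "holomorphic_map N N (rotation a)" "isometric_map N N (rotation a)"
proof -
  have "continuous_map (top_of_set A) (top_of_set A) (rotation a)"
    by (auto simp: continuous_map_in_subtopology rotation_def phase_in_iff intro!: continuous_intros)
  moreover have "conformal_isometry_at (\<lambda>_. \<rho>) (\<lambda>_. \<rho>) i j (local_rep N N (rotation a) i j) z"
    if "z \<in> rep_domain N N (rotation a) i j" for i j z
    by (rule conformal_isometry_atI[where g = "\<lambda>w. unit_phase a * w" and a = "unit_phase a" and \<Omega> = "{z. z $ 1 \<in> A}"])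
      (use that in \<open>auto simp: local_rep_def rep_domain_def cinv_plane_domain rotation_def open_nth_1 A rot
        intro!: derivative_eq_intros\<close>)
  ultimately show "holomorphic_map N N (rotation a)" "isometric_map N N (rotation a)"
    using conformal_holomorphic_isometric_map[of N "\<lambda>_. \<rho>" N "\<lambda>_. \<rho>" "rotation a"] conformal_N by simp_all
qed

lemma connected_N: "connected_space (mtop N)" and simply_connected_N: "simply_connected_top (mtop N)"
proof -
  show "connected_space (mtop N)"
    using convex_connected[OF A(2), folded connectedin_iff_connected] by (simp add: connectedin_def)
  show "simply_connected_top (mtop N)"
    using convex_imp_simply_connected[OF A(2)]
    unfolding simply_connected_top_def simply_connected_def homotopic_loops_def plane_domain_simps
    by (auto simp: pathin_canon_iff pathfinish_def pathstart_def path_image_def image_subset_iff_funcset)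
qed

lemma joined_N: "p \<in> A \<Longrightarrow> q \<in> A \<Longrightarrow> joined p q"
proof (rule joined_in_chart[of "()"])
  assume pq: "p \<in> A" "q \<in> A"
  have "convex {z :: complex^1. z $ 1 \<in> A}"
    using convex_linear_vimage[OF bounded_linear.linear[OF bounded_linear_nth_1] A(2)] by (simp add: vimage_def)
  with pq show "closed_segment (cmap N () p) (cmap N () q) \<subseteq> cimage N ()"
    by (intro closed_segment_subset) auto
qed auto

lemma derivative_in_coordinate:
  assumes "z \<in> cimage N i" "(u has_derivative U) (at (z $ 1))"
  shows "((u \<circ> cinv N i) has_derivative (\<lambda>v. U (v $ 1))) (at z)"
proof -
  have "((\<lambda>z :: complex^1. u (z $ 1)) has_derivative (\<lambda>v. U (v $ 1))) (at z)"
    using has_derivative_compose[OF bounded_linear_imp_has_derivative[OF bounded_linear_nth_1] assms(2)] .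
  then show ?thesis
    by (rule has_derivative_transform_within_open[OF _ open_nth_1[OF A(1)]])
      (use assms(1) in \<open>auto simp: cinv_plane_domain\<close>)
qed

lemma complete_N:
  fixes u :: "complex \<Rightarrow> 'v::banach"
  assumes u: "\<And>w. w \<in> A \<Longrightarrow> \<exists>U. (u has_derivative U) (at w) \<and> (\<forall>v. norm (U v) \<le> K * sqrt (\<rho> w * (v \<bullet> v)))"
    and K: "K > 0"
    and lim: "\<And>\<sigma> x. range \<sigma> \<subseteq> A \<Longrightarrow> (\<lambda>n :: nat. u (\<sigma> n)) \<longlonglongrightarrow> x \<Longrightarrow> \<exists>l\<in>A. \<sigma> \<longlonglongrightarrow> l"
  shows "complete_manifold N"
proof (rule complete_manifoldI[OF _ _ K])
  show "joined p q" if "p \<in> points N" "q \<in> points N" for p q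
    using that joined_N by simp
  show "\<exists>U. ((u \<circ> cinv N i) has_derivative U) (at z) \<and> (\<forall>v. norm (U v) \<le> K * sqrt (metric N i z v v))"
    if z: "z \<in> cimage N i" for i z
  proof -
    obtain U where "(u has_derivative U) (at (z $ 1))" "\<And>v. norm (U v) \<le> K * sqrt (\<rho> (z $ 1) * (v \<bullet> v))"
      using u[of "z $ 1"] z by auto
    then show ?thesis
      using derivative_in_coordinate[OF z] by (intro exI[of _ "\<lambda>v. U (v $ 1)"]) (simp add: inner_1)
  qed
  fix \<sigma> :: "nat \<Rightarrow> complex" and x assume \<sigma>: "range \<sigma> \<subseteq> points N" "(\<lambda>n. u (\<sigma> n)) \<longlonglongrightarrow> x"
  then obtain l where l: "l \<in> A" "\<sigma> \<longlonglongrightarrow> l" using lim[of \<sigma> x] by auto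
  then have "(\<lambda>n. vec (\<sigma> n) :: complex^1) \<longlonglongrightarrow> vec l"
    by (intro bounded_linear.tendsto[OF bounded_linear_vec_1])
  then show "\<exists>i\<in>charts N. \<exists>l\<in>cdom N i. eventually (\<lambda>n. \<sigma> n \<in> cdom N i) sequentially \<and>
      (\<lambda>n. cmap N i (\<sigma> n)) \<longlonglongrightarrow> cmap N i l"
    using l \<sigma>(1) by (auto intro!: bexI[of _ l] always_eventually)
qed

lemma regular_torification_N:
  assumes pos: "0 < \<alpha>" "0 < \<beta>"
    and covers: "(\<lambda>z. of_real \<beta> * exp (of_real \<alpha> * z)) ` {z. Re z \<in> model_set c} = A - {0}"
    and pullback: "\<And>z w. Re z \<in> model_set c \<Longrightarrow> w = of_real \<beta> * exp (of_real \<alpha> * z) \<Longrightarrow>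
      \<rho> w * (\<alpha> * cmod w)\<^sup>2 = model_metric c (Re z)"
    and complete: "complete_manifold N"
    and analytic: "\<And>z :: complex^1. z $ 1 \<in> A \<Longrightarrow> analytic_near z (\<lambda>z. \<rho> (z $ 1))"
  shows "regular_torification (model c) N rotation"
proof -
  have "exponential_covering c \<alpha> \<beta> (open_submanifold N (free_points N rotation)) (A - {0}) id (\<lambda>_ w. w) (\<lambda>_ _. 1) (\<lambda>_. \<rho>)"
  proof (unfold_locales, goal_cases)
    case 4
    have "A \<inter> (A - {0}) = A - {0}" by blast
    then show ?case
      by (simp add: open_submanifold_def free_points_N subtopology_subtopology)
  qed (use pos covers pullback in \<open>auto simp: open_submanifold_def free_points_N topspace_subtopology
      conformal_metric_def inj_on_def\<close>)
  then have "torification (model c) N rotation"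
    by (rule torificationI[OF kaehler_N connected_N torus_action_N effective_N rotation_holomorphic_isometric])
      (auto simp: free_points_N rotation_def phase_in_iff)
  moreover have "real_analytic_metric N"
    unfolding real_analytic_metric_def
    by (auto intro!: real_analytic_onI analytic_near_mult analytic analytic_near_const)
  ultimately show ?thesis
    unfolding regular_torification_def using connected_N simply_connected_N complete by blast
qed

end

lemma exp_half_plane: "exp ` {z. Re z < 0} = {w. cmod w < 1} - {0}"
proof (intro subset_antisym subsetI)
  fix w assume w: "w \<in> {w. cmod w < 1} - {0}"
  then have "exp (Ln w) = w" "Re (Ln w) < 0" by (auto simp: ln_less_zero_iff)
  then show "w \<in> exp ` {z. Re z < 0}" by (metis image_eqI mem_Collect_eq)
qed auto

lemma exp_UNIV: "exp ` UNIV = (UNIV - {0} :: complex set)"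
  by (metis Compl_eq_Diff_UNIV covering_space_exp_punctured_plane covering_space_imp_surjective)

text \<open>For \<open>w = 2 exp (\<zeta> / 2)\<close> one has \<open>\<bar>dw\<bar>\<^sup>2 = exp (Re \<zeta>) \<bar>d\<zeta>\<bar>\<^sup>2\<close>, which is the metric of the tangent bundle of
  the model with \<open>c = 0\<close>.\<close>

lemma regular_torification_plane: "regular_torification (model 0) complex_plane rotation"
proof -
  interpret rotation_invariant_domain UNIV "\<lambda>_. 1"
    by unfold_locales (auto simp: smooth_on_const)
  have plane: "complex_plane = plane_domain UNIV (\<lambda>_. 1)"
    by (simp add: complex_plane_def plane_domain_def)
  show ?thesis
    unfolding plane
  proof (rule regular_torification_N[of "1 / 2" 2])
    have "(\<lambda>z. of_real 2 * exp (of_real (1 / 2) * z)) ` UNIV = (*) 2 ` exp ` (\<lambda>z :: complex. of_real (1 / 2) * z) ` UNIV"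
      by (simp add: image_image)
    also have "(\<lambda>z :: complex. of_real (1 / 2) * z) ` UNIV = UNIV"
      by (rule surjI[of _ "\<lambda>z. 2 * z"]) simp
    also have "(*) 2 ` exp ` UNIV = UNIV - {0 :: complex}"
    proof -
      have "w \<in> (*) 2 ` (UNIV - {0})" if "w \<noteq> 0" for w :: complex
        by (rule image_eqI[of _ _ "w / 2"]) (use that in auto)
      then show ?thesis unfolding exp_UNIV by auto
    qed
    finally show "(\<lambda>z. of_real 2 * exp (of_real (1 / 2) * z)) ` {z. Re z \<in> model_set 0} = UNIV - {0 :: complex}"
      by (simp add: model_set_def)
    show "1 * (1 / 2 * cmod w)\<^sup>2 = model_metric 0 (Re z)" if "w = of_real 2 * exp (of_real (1 / 2) * z)" for z w
      using that by (simp add: model_metric_def norm_mult power2_eq_square flip: exp_add)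
    show "complete_manifold (plane_domain UNIV (\<lambda>_. 1))"
    proof (rule complete_N[of "\<lambda>z. z" 1])
      show "\<exists>U. ((\<lambda>z. z) has_derivative U) (at w) \<and> (\<forall>v. norm (U v) \<le> 1 * sqrt (1 * (v \<bullet> v)))" for w :: complex
        by (intro exI[of _ "\<lambda>v. v"]) (simp add: norm_eq_sqrt_inner)
    qed auto
  qed (auto simp: analytic_near_const)
qed

text \<open>For \<open>w = exp \<zeta>\<close> and \<open>r = \<bar>w\<bar> = exp (Re \<zeta>)\<close>, the hyperbolic metric pulls back to
  \<open>- 4 r\<^sup>2 / (c (1 - r\<^sup>2)\<^sup>2) = - 1 / (c sinh\<^sup>2 (Re \<zeta>))\<close> times \<open>\<bar>d\<zeta>\<bar>\<^sup>2\<close>. Completeness is proved with the two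
  Lipschitz functions \<open>w\<close> and \<open>- ln (1 - \<bar>w\<bar>\<^sup>2)\<close>: along a Cauchy sequence the second stays bounded and keeps
  the sequence away from the boundary circle.\<close>

lemma regular_torification_disc:
  assumes c: "c < 0"
  shows "regular_torification (model c) (disc c) rotation"
proof -
  define \<rho> where "\<rho> z = - 4 / c / (1 - (cmod z)\<^sup>2)\<^sup>2" for z :: complex
  let ?A = "{z. cmod z < 1}"
  have ball: "?A = ball 0 1" by (auto simp: dist_norm)
  have D_pos: "0 < 1 - (cmod z)\<^sup>2" if "z \<in> ?A" for z
    using that by (simp add: power_less_one_iff abs_square_less_1)
  have D_eq: "1 - (cmod z)\<^sup>2 = 1 + (- 1) * (Re z * Re z) + (- 1) * (Im z * Im z)" for z
    unfolding cmod_power2 by (simp add: power2_eq_square)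
  have smooth: "smooth_on \<rho> ?A"
  proof -
    have lin: "smooth_on Re ?A" "smooth_on Im ?A"
      unfolding ball by (auto intro!: smooth_on_bounded_linear bounded_linear_Re bounded_linear_Im)
    have "\<rho> = (\<lambda>z. (- 4 / c) * inverse ((1 + (- 1) * (Re z * Re z) + (- 1) * (Im z * Im z)) *
        (1 + (- 1) * (Re z * Re z) + (- 1) * (Im z * Im z))))"
      unfolding \<rho>_def[abs_def] D_eq by (simp add: power2_eq_square divide_inverse)
    moreover have "smooth_on (\<lambda>z. (- 4 / c) * inverse ((1 + (- 1) * (Re z * Re z) + (- 1) * (Im z * Im z)) *
        (1 + (- 1) * (Re z * Re z) + (- 1) * (Im z * Im z)))) ?A"
      using D_pos D_eq unfolding ball
      by (intro smooth_on_mult smooth_on_inverse' smooth_on_add smooth_on_const open_ball lin[unfolded ball])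
        (fastforce simp: dist_norm)
    ultimately show ?thesis by (simp only:)
  qed
  have "0 < \<rho> z" if "z \<in> ?A" for z
    unfolding \<rho>_def using D_pos[OF that] c
    by (intro divide_pos_pos divide_neg_neg zero_less_power) auto
  then interpret rotation_invariant_domain ?A \<rho>
    by unfold_locales (use smooth in \<open>auto simp: ball \<rho>_def norm_mult\<close>)
  have disc: "disc c = plane_domain ?A \<rho>"
    by (auto simp: disc_def plane_domain_def \<rho>_def fun_eq_iff cmod_power2 diff_diff_eq)
  show ?thesis
    unfolding disc
  proof (rule regular_torification_N[of 1 1])
    show "(\<lambda>z. of_real 1 * exp (of_real 1 * z)) ` {z. Re z \<in> model_set c} = ?A - {0 :: complex}"
      using exp_half_plane c by (simp add: model_set_def)
    show "\<rho> w * (1 * cmod w)\<^sup>2 = model_metric c (Re z)"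
      if "Re z \<in> model_set c" "w = of_real 1 * exp (of_real 1 * z)" for z w
    proof -
      have w: "cmod w = exp (Re z)" using that by simp
      define e where "e = exp (Re z)"
      have e: "e > 0" "exp (- Re z) = 1 / e" by (simp_all add: e_def exp_minus divide_inverse)
      have "(sinh (Re z))\<^sup>2 = ((1 - e\<^sup>2) / (2 * e))\<^sup>2"
        using e(1) by (simp add: sinh_def e(2) e_def[symmetric] power2_eq_square divide_simps) (simp add: algebra_simps)
      also have "- 1 / (c * \<dots>) = - 4 / c / (1 - e\<^sup>2)\<^sup>2 * e\<^sup>2"
        using e(1) by (simp add: power_divide power_mult_distrib)
      finally show ?thesis using c by (simp add: \<rho>_def w e_def model_metric_def)
    qed
    show "analytic_near z (\<lambda>z. \<rho> (z $ 1))" if "z $ 1 \<in> ?A" for z :: "complex^1"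
    proof -
      let ?D = "\<lambda>z :: complex^1. 1 + (- 1) * (Re (z $ 1) * Re (z $ 1)) + (- 1) * (Im (z $ 1) * Im (z $ 1))"
      have "analytic_near z (\<lambda>z. (- 4 / c) * (1 / (?D z * ?D z)))"
        using D_pos[OF that] unfolding D_eq
        by (intro analytic_near_mult analytic_near_inverse analytic_near_add analytic_near_const
            analytic_near_Re analytic_near_Im) auto
      then show ?thesis unfolding \<rho>_def D_eq by (simp add: power2_eq_square)
    qed
    show "complete_manifold (plane_domain ?A \<rho>)"
    proof (rule complete_N)
      define u where "u z = (z, - ln (1 - (cmod z)\<^sup>2))" for z :: complex
      \<comment> \<open>The differential of \<open>u\<close> has norm at most \<open>3 / (1 - \<bar>w\<bar>\<^sup>2)\<close>, and the metric
        measures a vector \<open>v\<close> at \<open>w\<close> by \<open>2 \<bar>v\<bar> / (sqrt (- c) (1 - \<bar>w\<bar>\<^sup>2))\<close>.\<close>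
      define K where "K = 3 * sqrt (- c) / 2"
      show "0 < K" using c by (simp add: K_def)
      show "\<exists>U. (u has_derivative U) (at w) \<and> (\<forall>v. norm (U v) \<le> K * sqrt (\<rho> w * (v \<bullet> v)))" if w: "w \<in> ?A" for w
      proof -
        let ?d = "1 - (cmod w)\<^sup>2"
        have d: "0 < ?d" "?d \<le> 1" using D_pos[OF w] by auto
        define U where "U v = (v, 2 * (w \<bullet> v) / ?d)" for v
        have sq: "(cmod z)\<^sup>2 = z \<bullet> z" for z by (simp add: power2_norm_eq_inner)
        have "(u has_derivative U) (at w)"
          unfolding u_def[abs_def] U_def[abs_def] sq using d(1)
          by (auto intro!: derivative_eq_intros simp: sq inner_commute divide_simps)
        moreover have "norm (U v) \<le> K * sqrt (\<rho> w * (v \<bullet> v))" for v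
        proof -
          have "norm (U v) \<le> norm v + norm (2 * (w \<bullet> v) / ?d)"
            unfolding U_def by (rule norm_Pair_le)
          also have "norm (2 * (w \<bullet> v) / ?d) \<le> 2 * norm v / ?d"
          proof -
            have "\<bar>w \<bullet> v\<bar> \<le> norm w * norm v" by (rule Cauchy_Schwarz_ineq2)
            also have "\<dots> \<le> 1 * norm v" using w by (intro mult_right_mono) auto
            finally show ?thesis using d by (simp add: abs_mult divide_right_mono)
          qed
          also have "norm v + 2 * norm v / ?d \<le> norm v / ?d + 2 * norm v / ?d"
            using d by (intro add_right_mono) (simp add: le_divide_eq mult_left_le)
          also have "\<dots> = (K * (2 / sqrt (- c))) * (norm v / ?d)"
            using c by (simp add: K_def)
          also have "\<dots> = K * (2 / sqrt (- c) * norm v / ?d)"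
            by simp
          also have "2 / sqrt (- c) * norm v / ?d = sqrt (\<rho> w * (v \<bullet> v))"
          proof -
            have "\<rho> w * (v \<bullet> v) = (2 / sqrt (- c) * norm v / ?d)\<^sup>2"
              using c by (simp add: \<rho>_def power_divide power_mult_distrib power2_norm_eq_inner)
            then show ?thesis using c d by simp
          qed
          finally show ?thesis by simp
        qed
        ultimately show ?thesis by blast
      qed
      fix \<sigma> :: "nat \<Rightarrow> complex" and x assume \<sigma>: "range \<sigma> \<subseteq> ?A" "(\<lambda>n. u (\<sigma> n)) \<longlonglongrightarrow> x"
      have l: "\<sigma> \<longlonglongrightarrow> fst x" using tendsto_fst[OF \<sigma>(2)] by (simp add: u_def)
      have "(\<lambda>n. - ln (1 - (cmod (\<sigma> n))\<^sup>2)) \<longlonglongrightarrow> snd x" using tendsto_snd[OF \<sigma>(2)] by (simp add: u_def)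
      then have "(\<lambda>n. exp (- (- ln (1 - (cmod (\<sigma> n))\<^sup>2)))) \<longlonglongrightarrow> exp (- snd x)" by (intro tendsto_intros)
      moreover have "exp (- (- ln (1 - (cmod (\<sigma> n))\<^sup>2))) = 1 - (cmod (\<sigma> n))\<^sup>2" for n
        using D_pos[of "\<sigma> n"] \<sigma>(1) by auto
      moreover have "(\<lambda>n. 1 - (cmod (\<sigma> n))\<^sup>2) \<longlonglongrightarrow> 1 - (cmod (fst x))\<^sup>2" by (intro tendsto_intros l)
      ultimately have "1 - (cmod (fst x))\<^sup>2 = exp (- snd x)" using LIMSEQ_unique by auto
      then have "(cmod (fst x))\<^sup>2 < 1" by (smt (verit) exp_gt_zero)
      then have "fst x \<in> ?A" by (simp add: abs_square_less_1)
      with l show "\<exists>l\<in>?A. \<sigma> \<longlonglongrightarrow> l" by blast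
    qed
  qed auto
qed

section \<open>The projective line as a round sphere\<close>

lemma homogeneous_scale:
  assumes "k \<noteq> 0"
  shows "homogeneous (k * z0, k * z1) = homogeneous (z0, z1)"
proof (intro subset_antisym subsetI)
  fix x assume "x \<in> homogeneous (k * z0, k * z1)"
  then obtain m where "m \<noteq> 0" "x = (m * (k * z0), m * (k * z1))" by (auto simp: homogeneous_def)
  then show "x \<in> homogeneous (z0, z1)"
    using assms by (auto simp: homogeneous_def intro!: exI[of _ "m * k"])
next
  fix x assume "x \<in> homogeneous (z0, z1)"
  then obtain m where "m \<noteq> 0" "x = (m * z0, m * z1)" by (auto simp: homogeneous_def)
  then show "x \<in> homogeneous (k * z0, k * z1)"
    using assms by (auto simp: homogeneous_def intro!: exI[of _ "m / k"])
qed

lemma homogeneous_eq_iff: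
  assumes "Z \<noteq> 0" "W \<noteq> 0"
  shows "homogeneous Z = homogeneous W \<longleftrightarrow> fst Z * snd W = snd Z * fst W"
proof
  assume eq: "homogeneous Z = homogeneous W"
  have "Z \<in> homogeneous Z" by (cases Z) (auto simp: homogeneous_def intro: exI[of _ 1])
  then have "Z \<in> homogeneous W" using eq by simp
  then show "fst Z * snd W = snd Z * fst W" by (auto simp: homogeneous_def split: prod.splits)
next
  assume eq: "fst Z * snd W = snd Z * fst W"
  obtain z0 z1 w0 w1 where ZW: "Z = (z0, z1)" "W = (w0, w1)" by (cases Z, cases W)
  obtain l where l: "l \<noteq> 0" "w0 = l * z0" "w1 = l * z1"
  proof (cases "z0 = 0")
    case True
    then have "z1 \<noteq> 0" "w0 = 0" using eq assms(1) by (auto simp: ZW zero_prod_def)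
    then show ?thesis using that[of "w1 / z1"] assms(2) True by (simp add: ZW zero_prod_def)
  next
    case False
    then have "w0 \<noteq> 0" using eq assms(2) by (auto simp: ZW zero_prod_def)
    then show ?thesis using that[of "w0 / z0"] eq False by (simp add: ZW field_simps)
  qed
  then show "homogeneous Z = homogeneous W"
    using homogeneous_scale[OF l(1), of z0 z1] by (simp add: ZW)
qed

text \<open>The classical embedding of the projective line as a sphere, in the form that makes sense for
  homogeneous coordinates; it separates lines because it determines both affine coordinates.\<close>

definition stereo :: "complex \<times> complex \<Rightarrow> complex \<times> real" where
  "stereo Z = (fst Z * cnj (snd Z) / of_real ((cmod (fst Z))\<^sup>2 + (cmod (snd Z))\<^sup>2),
     (cmod (snd Z))\<^sup>2 / ((cmod (fst Z))\<^sup>2 + (cmod (snd Z))\<^sup>2))"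

text \<open>Well defined on lines because \<open>stereo\<close> is invariant under scaling.\<close>

definition to_sphere :: "(complex \<times> complex) set \<Rightarrow> complex \<times> real" where
  "to_sphere p = stereo (SOME Z. Z \<in> p)"

definition round_sphere :: "(complex \<times> real) set" where
  "round_sphere = sphere (0, 1 / 2) (1 / 2)"

definition lines :: "(complex \<times> complex) set set" where
  "lines = homogeneous ` (- {0})"

definition line_topology :: "(complex \<times> complex) set topology" where
  "line_topology = quotient_top (top_of_set (- {0})) homogeneous"

lemma round_sphere_iff: "(x, h) \<in> round_sphere \<longleftrightarrow> (cmod x)\<^sup>2 = h * (1 - h)"
proof -
  have "(x, h) \<in> round_sphere \<longleftrightarrow> (cmod x)\<^sup>2 + (h - 1 / 2)\<^sup>2 = (1 / 2)\<^sup>2"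
  proof -
    have "dist (0, 1 / 2) (x, h) = sqrt ((cmod x)\<^sup>2 + (h - 1 / 2)\<^sup>2)"
      unfolding dist_Pair_Pair by (simp add: dist_norm power2_commute)
    moreover have "sqrt ((1 / 2)\<^sup>2) = 1 / 2" by (subst real_sqrt_abs) simp
    ultimately show ?thesis
      unfolding round_sphere_def mem_sphere by (metis real_sqrt_eq_iff)
  qed
  moreover have "(h - 1 / 2)\<^sup>2 = (1 / 2)\<^sup>2 - h * (1 - h)"
    by (simp add: power2_eq_square algebra_simps)
  ultimately show ?thesis by simp
qed

lemma squares_pos: "Z \<noteq> 0 \<Longrightarrow> 0 < (cmod (fst Z))\<^sup>2 + (cmod (snd Z))\<^sup>2"
  by (cases Z) (auto simp: zero_prod_def sum_power2_gt_zero_iff)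

lemma stereo_homogeneous:
  assumes "Z \<noteq> 0" "W \<in> homogeneous Z"
  shows "stereo W = stereo Z" "W \<noteq> 0"
proof -
  obtain k z0 z1 where k: "k \<noteq> 0" "Z = (z0, z1)" "W = (k * z0, k * z1)"
    using assms(2) by (cases Z) (auto simp: homogeneous_def)
  have n: "(cmod (k * z0))\<^sup>2 + (cmod (k * z1))\<^sup>2 = (cmod k)\<^sup>2 * ((cmod z0)\<^sup>2 + (cmod z1)\<^sup>2)"
    by (simp add: norm_mult power_mult_distrib distrib_left)
  have e: "k * z0 * cnj (k * z1) = of_real ((cmod k)\<^sup>2) * (z0 * cnj z1)"
    unfolding complex_norm_square by (simp add: mult_ac)
  have "of_real ((cmod k)\<^sup>2) \<noteq> (0 :: complex)" using k(1) by simp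
  then have "k * z0 * cnj (k * z1) / of_real ((cmod k)\<^sup>2 * ((cmod z0)\<^sup>2 + (cmod z1)\<^sup>2)) =
      z0 * cnj z1 / of_real ((cmod z0)\<^sup>2 + (cmod z1)\<^sup>2)"
    unfolding e of_real_mult by (rule mult_divide_mult_cancel_left)
  moreover have "(cmod (k * z1))\<^sup>2 / ((cmod k)\<^sup>2 * ((cmod z0)\<^sup>2 + (cmod z1)\<^sup>2)) =
      (cmod z1)\<^sup>2 / ((cmod z0)\<^sup>2 + (cmod z1)\<^sup>2)"
    using k(1) by (simp add: norm_mult power_mult_distrib)
  ultimately show "stereo W = stereo Z"
    unfolding stereo_def k fst_conv snd_conv n by (simp only:)
  show "W \<noteq> 0" using k assms(1) by (auto simp: zero_prod_def)
qed

lemma to_sphere_homogeneous: "Z \<noteq> 0 \<Longrightarrow> to_sphere (homogeneous Z) = stereo Z"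
proof -
  assume Z: "Z \<noteq> 0"
  have "Z \<in> homogeneous Z" by (cases Z) (auto simp: homogeneous_def intro: exI[of _ 1])
  then have "(SOME W. W \<in> homogeneous Z) \<in> homogeneous Z" by (rule someI)
  then show ?thesis using stereo_homogeneous(1)[OF Z] by (simp add: to_sphere_def)
qed

lemma stereo_in_round_sphere:
  assumes "Z \<noteq> 0"
  shows "stereo Z \<in> round_sphere"
proof -
  define a b where "a = (cmod (fst Z))\<^sup>2" and "b = (cmod (snd Z))\<^sup>2"
  have "a + b > 0" using squares_pos[OF assms] by (simp add: a_def b_def)
  then have "a * b / (a + b)\<^sup>2 = b / (a + b) * (1 - b / (a + b))"
    by (simp add: power2_eq_square divide_simps)
  moreover have "(cmod (fst Z * cnj (snd Z) / of_real (a + b)))\<^sup>2 = a * b / (a + b)\<^sup>2"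
    by (simp add: norm_divide norm_mult power_divide power_mult_distrib a_def b_def del: of_real_add)
  ultimately show ?thesis
    unfolding stereo_def round_sphere_iff a_def[symmetric] b_def[symmetric] by simp
qed

text \<open>A point \<open>(x, h)\<close> of the sphere with \<open>h \<noteq> 0\<close>, read as a pair of complex numbers, lies on the line that
  it represents.\<close>

lemma stereo_surj:
  assumes "y \<in> round_sphere"
  obtains Z where "Z \<noteq> 0" "stereo Z = y"
proof -
  obtain x h where y: "y = (x, h)" by (cases y)
  have x: "(cmod x)\<^sup>2 = h * (1 - h)" using assms by (simp add: y round_sphere_iff)
  show ?thesis
  proof (cases "h = 0")
    case True
    then show ?thesis using that[of "(1, 0)"] x by (simp add: y stereo_def zero_prod_def)
  next
    case False
    have "(cmod x)\<^sup>2 + h\<^sup>2 = h" using x by (simp add: power2_eq_square algebra_simps)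
    then have "stereo (x, of_real h) = (x, h)"
      using False by (simp add: stereo_def power2_eq_square flip: of_real_add of_real_mult)
    then show ?thesis using that[of "(x, of_real h)"] False by (simp add: y zero_prod_def)
  qed
qed

text \<open>The second component \<open>h\<close> vanishes only for \<open>z\<^sub>1 = 0\<close>; otherwise the first component divided by \<open>h\<close> is
  the ratio \<open>z\<^sub>0 / z\<^sub>1\<close>.\<close>

lemma stereo_inj:
  assumes "Z \<noteq> 0" "W \<noteq> 0" "stereo Z = stereo W"
  shows "homogeneous Z = homogeneous W"
proof -
  define n m where "n = (cmod (fst Z))\<^sup>2 + (cmod (snd Z))\<^sup>2" and "m = (cmod (fst W))\<^sup>2 + (cmod (snd W))\<^sup>2"
  have nm: "n > 0" "m > 0" using squares_pos assms by (simp_all add: n_def m_def)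
  have e1: "fst Z * cnj (snd Z) / of_real n = fst W * cnj (snd W) / of_real m"
    and e2: "(cmod (snd Z))\<^sup>2 / n = (cmod (snd W))\<^sup>2 / m"
    using assms(3) by (simp_all add: stereo_def n_def m_def)
  show ?thesis
  proof (cases "snd Z = 0")
    case True
    then have "snd W = 0" using e2 nm by simp
    then show ?thesis using True homogeneous_eq_iff[OF assms(1,2)] by simp
  next
    case False
    then have W: "snd W \<noteq> 0" using e2 nm by auto
    define h where "h = (cmod (snd Z))\<^sup>2 / n"
    have h: "h \<noteq> 0" using False nm by (simp add: h_def)
    have "fst Z * cnj (snd Z) / of_real n = fst Z / snd Z * of_real h"
      using False by (simp add: h_def complex_norm_square del: of_real_power)
    moreover have "fst W * cnj (snd W) / of_real m = fst W / snd W * of_real h"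
      using W e2 by (simp add: h_def complex_norm_square del: of_real_power)
    ultimately have "fst Z / snd Z * of_real h = fst W / snd W * of_real h" using e1 by metis
    moreover have "(of_real h :: complex) \<noteq> 0" using h by simp
    ultimately have "fst Z / snd Z = fst W / snd W" using mult_right_cancel by blast
    then show ?thesis using False W homogeneous_eq_iff[OF assms(1,2)] by (simp add: field_simps)
  qed
qed

lemma topspace_line_topology [simp]: "topspace line_topology = lines"
  by (simp add: line_topology_def topspace_quotient_top lines_def)

lemma continuous_map_homogeneous: "continuous_map (top_of_set (- {0})) line_topology homogeneous"
  unfolding continuous_map_def line_topology_def openin_quotient_top topspace_quotient_top by auto

lemma continuous_on_stereo: "continuous_on (- {0}) stereo"
proof -
  have "(cmod (fst Z))\<^sup>2 + (cmod (snd Z))\<^sup>2 \<noteq> 0" if "Z \<in> - {0}" for Z :: "complex \<times> complex"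
    using squares_pos[of Z] that by auto
  then show ?thesis
    unfolding stereo_def[abs_def] by (intro continuous_intros ballI) (simp_all only: of_real_eq_0_iff simp_thms)
qed

text \<open>A continuous bijection from a compact space to a Hausdorff space is a homeomorphism; all
  topological properties of the projective line are read off from the sphere.\<close>

lemma homeomorphic_map_to_sphere: "homeomorphic_map line_topology (top_of_set round_sphere) to_sphere"
proof (rule continuous_imp_homeomorphic_map)
  show "to_sphere ` topspace line_topology = topspace (top_of_set round_sphere)"
  proof (intro subset_antisym subsetI)
    fix y assume "y \<in> topspace (top_of_set round_sphere)"
    then obtain Z where "Z \<noteq> 0" "stereo Z = y" using stereo_surj[of y] by auto
    then have "y = to_sphere (homogeneous Z)" "homogeneous Z \<in> topspace line_topology"
      by (simp_all add: to_sphere_homogeneous lines_def)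
    then show "y \<in> to_sphere ` topspace line_topology" by (rule image_eqI)
  next
    fix y assume "y \<in> to_sphere ` topspace line_topology"
    then obtain Z where "Z \<noteq> 0" "y = to_sphere (homogeneous Z)"
      unfolding topspace_line_topology lines_def by blast
    then show "y \<in> topspace (top_of_set round_sphere)"
      by (simp add: to_sphere_homogeneous stereo_in_round_sphere)
  qed
  show "inj_on to_sphere (topspace line_topology)"
  proof (rule inj_onI)
    fix p q assume pq: "p \<in> topspace line_topology" "q \<in> topspace line_topology" "to_sphere p = to_sphere q"
    then obtain Z W where "Z \<noteq> 0" "p = homogeneous Z" "W \<noteq> 0" "q = homogeneous W"
      unfolding topspace_line_topology lines_def by blast
    then show "p = q" using pq(3) stereo_inj[of Z W] by (simp add: to_sphere_homogeneous)
  qed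
  have "continuous_map (top_of_set (- {0})) (top_of_set round_sphere) (to_sphere \<circ> homogeneous)"
  proof -
    have "continuous_map (top_of_set (- {0})) (top_of_set round_sphere) stereo"
      using continuous_on_stereo by (auto simp: continuous_map_in_subtopology stereo_in_round_sphere)
    then show ?thesis by (rule continuous_map_eq) (simp add: to_sphere_homogeneous)
  qed
  then show "continuous_map line_topology (top_of_set round_sphere) to_sphere"
    unfolding line_topology_def by (rule continuous_map_from_quotient_top)
  have "compactin (top_of_set (- {0})) (sphere (0 :: complex \<times> complex) 1)"
    by (auto simp: compactin_subtopology)
  then have "compactin line_topology (homogeneous ` sphere 0 1)"
    by (rule image_compactin[OF _ continuous_map_homogeneous])
  moreover have "homogeneous ` sphere 0 1 = lines"
  proof (intro subset_antisym subsetI)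
    fix p assume "p \<in> lines"
    then obtain Z where Z: "Z \<noteq> 0" "p = homogeneous Z" by (auto simp: lines_def)
    let ?W = "inverse (norm Z) *\<^sub>R Z"
    have "homogeneous Z = homogeneous ?W" using Z(1) by (subst homogeneous_eq_iff) auto
    moreover have "?W \<in> sphere 0 1" using Z(1) by simp
    ultimately show "p \<in> homogeneous ` sphere 0 1" using Z(2) by blast
  next
    fix p assume "p \<in> homogeneous ` sphere 0 1"
    then obtain Z :: "complex \<times> complex" where "norm Z = 1" "p = homogeneous Z" by auto
    then show "p \<in> lines" unfolding lines_def by (intro image_eqI[of _ _ Z]) auto
  qed
  ultimately show "compact_space line_topology" by (simp add: compact_space_def)
qed (simp add: Hausdorff_space_subtopology)

lemma to_sphere_bij: "bij_betw to_sphere lines round_sphere"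
  using homeomorphic_imp_injective_map[OF homeomorphic_map_to_sphere]
    homeomorphic_imp_surjective_map[OF homeomorphic_map_to_sphere] by (simp add: bij_betw_def)

lemma to_sphere_in: "p \<in> lines \<Longrightarrow> to_sphere p \<in> round_sphere"
  using to_sphere_bij by (rule bij_betw_apply)

lemma continuous_map_to_sphere: "continuous_map line_topology euclidean to_sphere"
  using homeomorphic_imp_continuous_map[OF homeomorphic_map_to_sphere]
  by (simp add: continuous_map_in_subtopology)

lemma continuous_map_into_lines:
  assumes "f \<in> topspace X \<rightarrow> lines" "continuous_map X euclidean (to_sphere \<circ> f)"
  shows "continuous_map X line_topology f"
proof -
  obtain s where s: "homeomorphic_maps line_topology (top_of_set round_sphere) to_sphere s"
    using homeomorphic_map_to_sphere homeomorphic_map_maps by blast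
  have f: "continuous_map X (top_of_set round_sphere) (to_sphere \<circ> f)"
    using assms to_sphere_in by (auto simp: continuous_map_in_subtopology Pi_iff)
  have s_cont: "continuous_map (top_of_set round_sphere) line_topology s"
    and s_inv: "\<And>p. p \<in> lines \<Longrightarrow> s (to_sphere p) = p"
    using s by (simp_all add: homeomorphic_maps_def)
  have "continuous_map X line_topology (s \<circ> (to_sphere \<circ> f))"
    by (rule continuous_map_compose[OF f s_cont])
  then show ?thesis
    by (rule continuous_map_eq) (use s_inv assms(1) in \<open>simp add: Pi_iff\<close>)
qed

lemma second_countable_homeomorphic:
  assumes f: "homeomorphic_map X Y f" and Y: "second_countable_top Y"
  shows "second_countable_top X"
proof -
  obtain B where B: "countable B" "\<forall>V\<in>B. openin Y V" "\<forall>U. openin Y U \<longrightarrow> (\<exists>C\<subseteq>B. U = \<Union>C)"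
    using Y[unfolded second_countable_top_def] by (elim exE conjE)
  let ?pre = "\<lambda>V. {x \<in> topspace X. f x \<in> V}"
  show ?thesis
    unfolding second_countable_top_def
  proof (rule exI[of _ "?pre ` B"], intro conjI allI impI ballI)
    show "countable (?pre ` B)" using B(1) by simp
    show "openin X V" if "V \<in> ?pre ` B" for V
      using that B(2) openin_continuous_map_preimage[OF homeomorphic_imp_continuous_map[OF f]] by blast
    fix U assume U: "openin X U"
    have "openin Y (f ` U)" using homeomorphic_map_openness[OF f openin_subset[OF U]] U by simp
    then obtain C where C: "C \<subseteq> B" "f ` U = \<Union>C" using B(3) by blast
    have "U = ?pre (f ` U)"
      using openin_subset[OF U] homeomorphic_imp_injective_map[OF f] by (auto dest: inj_onD)
    also have "\<dots> = \<Union>(?pre ` C)" unfolding C(2) by auto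
    finally have "U = \<Union>(?pre ` C)" .
    then show "\<exists>C\<subseteq>?pre ` B. U = \<Union>C"
      by (intro exI[of _ "?pre ` C"] conjI image_mono C(1))
  qed
qed

lemma connected_lines: "connected_space line_topology"
  and simply_connected_lines: "simply_connected_top line_topology"
proof -
  have sc: "simply_connected round_sphere"
    unfolding round_sphere_def by (rule simply_connected_sphere) simp
  have "connected_space (top_of_set round_sphere)"
    using simply_connected_imp_connected[OF sc, folded connectedin_iff_connected]
    by (simp add: connectedin_def)
  then show "connected_space line_topology"
    using homeomorphic_connected_space[of line_topology "top_of_set round_sphere"]
      homeomorphic_map_to_sphere homeomorphic_map_imp_homeomorphic_space by blast
  obtain s where s: "homeomorphic_maps line_topology (top_of_set round_sphere) to_sphere s"
    using homeomorphic_map_to_sphere homeomorphic_map_maps by blast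
  show "simply_connected_top line_topology"
    unfolding simply_connected_top_def
  proof (intro allI impI, elim conjE)
    fix g h assume gh: "pathin line_topology g" "g 1 = g 0" "pathin line_topology h" "h 1 = h 0"
    have sphere_path: "path (to_sphere \<circ> g)" "path_image (to_sphere \<circ> g) \<subseteq> round_sphere"
      if "pathin line_topology g" for g
    proof -
      have "pathin (top_of_set round_sphere) (to_sphere \<circ> g)"
        using that homeomorphic_imp_continuous_map[OF homeomorphic_map_to_sphere]
        unfolding pathin_def by (rule continuous_map_compose)
      then show "path (to_sphere \<circ> g)" "path_image (to_sphere \<circ> g) \<subseteq> round_sphere"
        by (auto simp: pathin_canon_iff path_image_def)
    qed
    have "homotopic_loops round_sphere (to_sphere \<circ> g) (to_sphere \<circ> h)"
      using sc gh sphere_path unfolding simply_connected_def by (auto simp: pathfinish_def pathstart_def)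
    then have "homotopic_with (\<lambda>r. r 1 = r 0) (top_of_set {0..1}) line_topology
        (s \<circ> (to_sphere \<circ> g)) (s \<circ> (to_sphere \<circ> h))"
      unfolding homotopic_loops_def
      by (rule homotopic_with_compose_continuous_map_left)
        (use s in \<open>auto simp: homeomorphic_maps_def pathfinish_def pathstart_def\<close>)
    moreover have "(s \<circ> (to_sphere \<circ> g)) t = g t" if "pathin line_topology g" "t \<in> {0..1}" for g t
      using that s by (auto simp: homeomorphic_maps_def pathin_def continuous_map_def Pi_iff)
    ultimately show "homotopic_with (\<lambda>r. r 1 = r 0) (top_of_set {0..1}) line_topology g h"
      using gh by (elim homotopic_with_eq) auto
  qed
qed

section \<open>Affine charts of the projective line\<close>

definition affine_line :: "bool \<Rightarrow> complex \<Rightarrow> (complex \<times> complex) set" where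
  "affine_line b w = homogeneous (affine_section b w)"

text \<open>The two affine coordinates in terms of the sphere: stereographic projection from either pole.\<close>

definition pole_distance :: "bool \<Rightarrow> complex \<times> real \<Rightarrow> real" where
  "pole_distance b y = (if b then snd y else 1 - snd y)"

definition stereographic :: "bool \<Rightarrow> complex \<times> real \<Rightarrow> complex" where
  "stereographic b y = (if b then fst y else cnj (fst y)) / of_real (pole_distance b y)"

definition affine_coordinate :: "bool \<Rightarrow> (complex \<times> complex) set \<Rightarrow> complex" where
  "affine_coordinate b p = stereographic b (to_sphere p)"

definition affine_part :: "bool \<Rightarrow> (complex \<times> complex) set set" where
  "affine_part b = range (affine_line b)"

text \<open>The height of the point with affine coordinate \<open>w\<close> above the pole at infinity of that coordinate;
  its square is, up to a constant, the conformal factor of the round metric.\<close>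

definition height :: "complex \<Rightarrow> real" where
  "height w = 1 / (1 + (cmod w)\<^sup>2)"

lemma affine_section_nonzero [simp]: "affine_section b w \<noteq> 0"
  by (simp add: affine_section_def zero_prod_def)

lemma one_plus_square_pos: "0 < 1 + (cmod w)\<^sup>2"
  by (simp add: add_pos_nonneg)

lemma one_plus_square: "1 + (cmod w)\<^sup>2 = 1 + (Re w * Re w + Im w * Im w)"
  unfolding cmod_power2 by (simp add: power2_eq_square)

lemma height_pos: "0 < height w" by (simp add: height_def one_plus_square_pos)

lemma affine_line_in: "affine_line b w \<in> lines"
  by (simp add: affine_line_def lines_def)

lemma to_sphere_affine_line:
  "to_sphere (affine_line b w) =
    (if b then (w * of_real (height w), height w) else (cnj w * of_real (height w), 1 - height w))"
proof -
  have "(cmod w)\<^sup>2 / (1 + (cmod w)\<^sup>2) = 1 - height w"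
    using one_plus_square_pos[of w] by (simp add: height_def field_simps)
  moreover have "z / of_real (1 + (cmod w)\<^sup>2) = z * of_real (height w)" for z :: complex
    by (simp only: height_def of_real_divide of_real_1 times_divide_eq_right mult_1_right)
  moreover have "1 / (1 + (cmod w)\<^sup>2) = height w" by (simp add: height_def)
  ultimately show ?thesis
    unfolding affine_line_def to_sphere_homogeneous[OF affine_section_nonzero]
    by (simp add: stereo_def affine_section_def add.commute del: of_real_add of_real_power)
qed

lemma pole_distance_affine_line: "pole_distance b (to_sphere (affine_line b w)) = height w"
  by (simp add: pole_distance_def to_sphere_affine_line)

lemma affine_coordinate_affine_line [simp]: "affine_coordinate b (affine_line b w) = w"
  using height_pos[of w]
  by (simp add: affine_coordinate_def stereographic_def pole_distance_affine_line)
    (simp add: to_sphere_affine_line)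

lemma affine_part_iff:
  assumes "p \<in> lines"
  shows "p \<in> affine_part b \<longleftrightarrow> pole_distance b (to_sphere p) \<noteq> 0"
proof
  assume "p \<in> affine_part b"
  then show "pole_distance b (to_sphere p) \<noteq> 0"
    using height_pos by (auto simp: affine_part_def pole_distance_affine_line less_imp_neq[symmetric])
next
  assume nz: "pole_distance b (to_sphere p) \<noteq> 0"
  obtain Z where Z: "Z \<noteq> 0" "p = homogeneous Z" using assms by (auto simp: lines_def)
  have "(if b then snd Z else fst Z) \<noteq> 0"
  proof
    assume "(if b then snd Z else fst Z) = 0"
    then show False
      using nz squares_pos[OF Z(1)]
      by (auto simp: Z(2) to_sphere_homogeneous[OF Z(1)] stereo_def pole_distance_def split: if_splits)
  qed
  then have "p = affine_line b (if b then fst Z / snd Z else snd Z / fst Z)"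
    unfolding affine_line_def Z(2)
    by (subst homogeneous_eq_iff[OF Z(1) affine_section_nonzero])
      (auto simp: affine_section_def split: if_splits)
  then show "p \<in> affine_part b" by (simp add: affine_part_def)
qed

lemma affine_line_coordinate: "p \<in> affine_part b \<Longrightarrow> affine_line b (affine_coordinate b p) = p"
  by (auto simp: affine_part_def)

lemma affine_part_sub: "affine_part b \<subseteq> lines"
  by (auto simp: affine_part_def affine_line_in)

lemma affine_line_in_other: "affine_line b w \<in> affine_part b' \<longleftrightarrow> b = b' \<or> w \<noteq> 0"
proof -
  have "height w = 1 \<longleftrightarrow> w = 0"
    using one_plus_square_pos[of w] by (simp add: height_def divide_eq_1_iff)
  then show ?thesis
    using height_pos[of w] unfolding affine_part_iff[OF affine_line_in]
    by (auto simp: pole_distance_def to_sphere_affine_line)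
qed

lemma affine_coordinate_other:
  assumes "w \<noteq> 0"
  shows "affine_coordinate b' (affine_line b w) = (if b = b' then w else inverse w)"
proof -
  have "affine_line b w = affine_line (\<not> b) (inverse w)"
    unfolding affine_line_def
    by (subst homogeneous_eq_iff[OF affine_section_nonzero affine_section_nonzero])
      (use assms in \<open>auto simp: affine_section_def\<close>)
  then have "affine_coordinate (\<not> b) (affine_line b w) = inverse w"
    using affine_coordinate_affine_line[of "\<not> b" "inverse w"] by argo
  moreover have "b' = (\<not> b)" if "b \<noteq> b'" using that by auto
  ultimately show ?thesis using affine_coordinate_affine_line[of b w] by auto
qed

lemma openin_affine_part: "openin line_topology (affine_part b)"
proof -
  have "open {y. pole_distance b y \<noteq> 0}"
    unfolding pole_distance_def by (cases b) (auto intro!: open_Collect_neq continuous_intros)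
  then have "openin line_topology {p \<in> topspace line_topology. to_sphere p \<in> {y. pole_distance b y \<noteq> 0}}"
    by (intro openin_continuous_map_preimage[OF continuous_map_to_sphere]) simp
  moreover have "{p \<in> topspace line_topology. to_sphere p \<in> {y. pole_distance b y \<noteq> 0}} = affine_part b"
    using affine_part_iff affine_part_sub by auto
  ultimately show ?thesis by simp
qed

lemma continuous_on_stereographic: "continuous_on {y. pole_distance b y \<noteq> 0} (stereographic b)"
  unfolding stereographic_def[abs_def] pole_distance_def
  by (cases b) (auto intro!: continuous_intros)

lemma homeomorphic_map_affine_coordinate:
  "homeomorphic_map (subtopology line_topology (affine_part b \<inter> K)) (top_of_set {w. affine_line b w \<in> K})
    (affine_coordinate b)"
proof -
  have "continuous_map (subtopology line_topology (affine_part b \<inter> K)) euclidean (affine_coordinate b)"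
  proof -
    have "continuous_map (subtopology line_topology (affine_part b \<inter> K)) (top_of_set {y. pole_distance b y \<noteq> 0}) to_sphere"
      using affine_part_iff affine_part_sub continuous_map_from_subtopology[OF continuous_map_to_sphere]
      by (auto simp: continuous_map_in_subtopology)
    then have "continuous_map (subtopology line_topology (affine_part b \<inter> K)) euclidean (stereographic b \<circ> to_sphere)"
      by (rule continuous_map_compose) (use continuous_on_stereographic in simp)
    then show ?thesis by (simp add: affine_coordinate_def[abs_def] o_def)
  qed
  moreover have "continuous_map (top_of_set {w. affine_line b w \<in> K}) line_topology (affine_line b)"
  proof -
    have "continuous_map (top_of_set {w. affine_line b w \<in> K}) (top_of_set (- {0})) (affine_section b)"
      unfolding affine_section_def[abs_def]
      by (cases b) (auto simp: continuous_map_in_subtopology zero_prod_def intro!: continuous_intros)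
    from continuous_map_compose[OF this continuous_map_homogeneous]
    show ?thesis by (simp add: affine_line_def[abs_def] o_def)
  qed
  ultimately have "homeomorphic_maps (subtopology line_topology (affine_part b \<inter> K))
      (top_of_set {w. affine_line b w \<in> K}) (affine_coordinate b) (affine_line b)"
    unfolding homeomorphic_maps_def
    by (auto simp: continuous_map_in_subtopology affine_line_coordinate affine_line_in_other image_subset_iff Pi_iff)
  then show ?thesis using homeomorphic_map_maps by blast
qed

lemma projective_line_simps [simp]:
  "mtop (projective_line c) = line_topology" "charts (projective_line c) = UNIV"
  "cdom (projective_line c) b = affine_part b"
  by (auto simp: projective_line_def line_topology_def affine_part_def affine_line_def)

lemma cmap_projective_line:
  assumes "p \<in> affine_part b"
  shows "cmap (projective_line c) b p = vec (affine_coordinate b p)"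
proof -
  obtain w where p: "p = affine_line b w" using assms by (auto simp: affine_part_def)
  have "(THE w'. affine_section b w' \<in> p) = w"
  proof (rule the_equality)
    show "affine_section b w \<in> p"
      by (auto simp: p affine_line_def homogeneous_def affine_section_def intro: exI[of _ 1])
    show "w' = w" if "affine_section b w' \<in> p" for w'
      using that by (auto simp: p affine_line_def homogeneous_def affine_section_def split: if_splits)
  qed
  then show ?thesis by (simp add: projective_line_def p)
qed

lemma cimage_projective_line [simp]: "cimage (projective_line c) b = UNIV"
proof -
  have "z = cmap (projective_line c) b (affine_line b (z $ 1))" for z
    by (simp add: cmap_projective_line affine_line_in_other vec_nth_1)
  then show ?thesis unfolding cimage_def by (auto simp: affine_part_def)
qed

lemma cinv_projective_line: "cinv (projective_line c) b z = affine_line b (z $ 1)"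
  unfolding cinv_def projective_line_simps
proof (rule inv_into_f_eq)
  show "inj_on (cmap (projective_line c) b) (affine_part b)"
    by (rule inj_on_inverseI[of _ "\<lambda>z. affine_line b (z $ 1)"])
      (simp add: cmap_projective_line affine_line_coordinate)
qed (simp_all add: affine_line_in_other cmap_projective_line vec_nth_1)

lemma overlap_projective_line:
  "overlap (projective_line c) b b' = (if b = b' then UNIV else {z. z $ 1 \<in> - {0}})"
proof -
  have "z \<in> overlap (projective_line c) b b' \<longleftrightarrow> affine_line b (z $ 1) \<in> affine_part b'" for z
  proof
    assume "z \<in> overlap (projective_line c) b b'"
    then show "affine_line b (z $ 1) \<in> affine_part b'"
      by (auto simp: overlap_def cmap_projective_line affine_line_coordinate)
  next
    assume "affine_line b (z $ 1) \<in> affine_part b'"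
    then show "z \<in> overlap (projective_line c) b b'"
      unfolding overlap_def
      by (intro image_eqI[of _ _ "affine_line b (z $ 1)"]) (simp_all add: cmap_projective_line affine_line_in_other vec_nth_1)
  qed
  then show ?thesis by (auto simp: affine_line_in_other)
qed

lemma transition_projective_line:
  assumes "z \<in> overlap (projective_line c) b b'"
  shows "transition (projective_line c) b b' z = vec (if b = b' then z $ 1 else inverse (z $ 1))"
  using assms
  by (auto simp: transition_def cinv_projective_line overlap_projective_line cmap_projective_line
      affine_line_in_other affine_coordinate_other split: if_splits)

definition projective_density :: "real \<Rightarrow> complex \<Rightarrow> real" where
  "projective_density c w = 4 / c * (height w)\<^sup>2"

text \<open>For vectors tangent to an affine section the numerator of the Fubini--Study metric collapses to
  \<open>v cnj w\<close>.\<close>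

lemma conformal_projective_line: "conformal_metric (projective_line c) (\<lambda>_. projective_density c)"
  unfolding conformal_metric_def
proof (intro ballI allI)
  fix b and z v w :: "complex^1"
  let ?x = "z $ 1" and ?Z = "affine_section b (z $ 1)"
    and ?V = "affine_tangent b (v $ 1)" and ?W = "affine_tangent b (w $ 1)"
  let ?n = "1 + (cmod ?x)\<^sup>2"
  have n: "?x * cnj ?x + 1 = of_real ?n"
    unfolding of_real_add complex_norm_square by simp
  have "hermitian ?Z ?Z * hermitian ?V ?W - hermitian ?V ?Z * hermitian ?Z ?W = v $ 1 * cnj (w $ 1)"
    by (simp add: hermitian_def affine_section_def affine_tangent_def algebra_simps)
  moreover have "hermitian ?Z ?Z = of_real ?n"
    using n by (simp add: hermitian_def affine_section_def add.commute)
  ultimately have "fubini_study c ?Z ?V ?W = 4 / c * Re (v $ 1 * cnj (w $ 1) / of_real (?n\<^sup>2))"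
    unfolding fubini_study_def by simp
  also have "Re (v $ 1 * cnj (w $ 1) / of_real (?n\<^sup>2)) = (height ?x)\<^sup>2 * (v $ 1 \<bullet> w $ 1)"
    unfolding Re_divide_of_real by (simp add: height_def power_divide inner_complex_def)
  finally show "metric (projective_line c) b z v w = projective_density c (z $ 1) * (v \<bullet> w)"
    by (simp add: projective_line_def projective_density_def inner_1)
qed

text \<open>Inversion is an isometry of the round metric.\<close>

lemma projective_density_inverse:
  "w \<noteq> 0 \<Longrightarrow> projective_density c (inverse w) * (cmod (inverse w * inverse w))\<^sup>2 = projective_density c w"
proof -
  assume w: "w \<noteq> 0"
  define r where "r = (cmod w)\<^sup>2"
  have r: "0 < r" using w by (simp add: r_def)
  have e: "(cmod (inverse w))\<^sup>2 = 1 / r" by (simp add: r_def norm_inverse power_inverse divide_inverse)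
  have "height (inverse w) * (cmod (inverse w))\<^sup>2 = height w"
    unfolding height_def e r_def[symmetric] using r by (simp add: divide_simps)
  then have "(height (inverse w))\<^sup>2 * ((cmod (inverse w))\<^sup>2)\<^sup>2 = (height w)\<^sup>2"
    by (metis power_mult_distrib)
  moreover have "cmod (inverse w * inverse w) = (cmod (inverse w))\<^sup>2"
    by (simp only: norm_mult power2_eq_square)
  ultimately show ?thesis unfolding projective_density_def mult.assoc by (simp only:)
qed

lemma derivative_inverse: "w \<noteq> 0 \<Longrightarrow> (inverse has_field_derivative - (inverse w * inverse w)) (at w)" for w :: complex
  by (auto intro!: derivative_eq_intros simp: power2_eq_square)

lemma topological_manifold_projective_line: "topological_manifold (projective_line c)"
proof -
  have cover: "p \<in> affine_part True \<or> p \<in> affine_part False" if "p \<in> lines" for p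
    using affine_part_iff[OF that] by (auto simp: pole_distance_def)
  have vec: "homeomorphic_map (top_of_set UNIV) (top_of_set UNIV) (vec :: complex \<Rightarrow> complex^1)"
    using homeomorphic_map_vec_1[of "UNIV :: complex set"] by (simp add: vec_image_1)
  have chart: "homeomorphic_map (subtopology line_topology (affine_part b)) euclidean (cmap (projective_line c) b)" for b
  proof -
    have "homeomorphic_map (subtopology line_topology (affine_part b)) (top_of_set UNIV) (affine_coordinate b)"
      using homeomorphic_map_affine_coordinate[of b UNIV] by simp
    from homeomorphic_map_compose[OF this vec]
    have "homeomorphic_map (subtopology line_topology (affine_part b)) euclidean (vec \<circ> affine_coordinate b :: _ \<Rightarrow> complex^1)"
      by simp
    then show ?thesis by (rule homeomorphic_map_eq) (simp add: cmap_projective_line)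
  qed
  have "Hausdorff_space line_topology"
    using homeomorphic_map_to_sphere homeomorphic_Hausdorff_space homeomorphic_map_imp_homeomorphic_space
    by (metis Hausdorff_space_euclidean Hausdorff_space_subtopology)
  moreover have "second_countable_top line_topology"
    by (rule second_countable_homeomorphic[OF homeomorphic_map_to_sphere second_countable_top_of_set])
  moreover have "lines = (\<Union>b. affine_part b)"
    using cover affine_part_sub by blast
  ultimately show ?thesis
    using chart openin_affine_part by (simp add: topological_manifold_def)
qed

lemma smooth_on_projective_density: "smooth_on (projective_density c) UNIV"
proof -
  have "smooth_on Re UNIV" "smooth_on Im UNIV"
    by (simp_all add: smooth_on_bounded_linear bounded_linear_Re bounded_linear_Im)
  then have "smooth_on (\<lambda>w. 1 + (Re w * Re w + Im w * Im w)) UNIV"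
    by (intro smooth_on_mult smooth_on_add smooth_on_const) auto
  then have "smooth_on (\<lambda>w. 1 + (cmod w)\<^sup>2) UNIV"
    unfolding one_plus_square .
  then have "smooth_on (\<lambda>w. (4 / c) * (inverse (1 + (cmod w)\<^sup>2) * inverse (1 + (cmod w)\<^sup>2))) UNIV"
    using one_plus_square_pos by (intro smooth_on_mult smooth_on_inverse' smooth_on_const) (auto simp: less_imp_neq[symmetric])
  then show ?thesis
    by (simp add: projective_density_def[abs_def] height_def power2_eq_square divide_inverse)
qed

locale round_projective_line =
  fixes c :: real
  assumes c: "0 < c"
begin

abbreviation N :: "((complex \<times> complex) set, bool, complex^1) riemannian" where
  "N \<equiv> projective_line c"

lemma density_pos: "0 < projective_density c w"
  using c height_pos[of w] by (simp add: projective_density_def)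

lemma open_overlap_formula: "open (if b = b' then UNIV else {z :: complex^1. z $ 1 \<in> - {0}})"
  using open_nth_1[of "- {0 :: complex}"] by auto

lemma kaehler_N: "kaehler_manifold N"
proof (rule kaehler_manifold_conformal[OF topological_manifold_projective_line conformal_projective_line])
  show "smooth_on (\<lambda>z. projective_density c (z $ 1)) (cimage N b)" for b
    using smooth_on_vec_1(2)[OF open_UNIV smooth_on_projective_density] by simp
  fix b b' z assume z: "z \<in> overlap N b b'"
  show "conformal_isometry_at (\<lambda>_. projective_density c) (\<lambda>_. projective_density c) b b' (transition N b b') z"
  proof (cases "b = b'")
    case True
    show ?thesis
      by (rule conformal_isometry_atI[where \<Omega> = UNIV and g = "\<lambda>w. w" and a = 1])
        (use True in \<open>simp_all add: transition_projective_line overlap_projective_line\<close>)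
  next
    case False
    then have "z $ 1 \<noteq> 0" using z by (simp add: overlap_projective_line)
    then show ?thesis
      by (intro conformal_isometry_atI[where \<Omega> = "overlap N b b'" and g = inverse, OF _ z _ derivative_inverse])
        (use False open_overlap_formula[of b b'] in \<open>simp_all add: transition_projective_line overlap_projective_line projective_density_inverse\<close>)
  qed
qed (rule density_pos)

sublocale smooth_riemannian N
proof unfold_locales
  fix b b' :: bool
  have op: "open (overlap N b b')" using open_overlap_formula[of b b'] by (simp add: overlap_projective_line)
  have "smooth_on (\<lambda>z. vec (if b = b' then z $ 1 else inverse (z $ 1)) :: complex^1) (overlap N b b')"
  proof (cases "b = b'")
    case True
    then show ?thesis
      using smooth_on_bounded_linear[OF open_UNIV bounded_linear_ident]
      by (simp add: overlap_projective_line vec_nth_1)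
  next
    case False
    then show ?thesis
      using smooth_on_vec_1(1)[OF open_Compl[OF closed_singleton] smooth_on_inverse[where 'a = complex]]
      by (simp add: overlap_projective_line)
  qed
  then show "smooth_on (transition N b b') (overlap N b b')"
    by (subst smooth_on_cong[OF op transition_projective_line])
qed (use kaehler_N in \<open>auto simp: kaehler_manifold_def topological_manifold_projective_line\<close>)

lemma derivative_height:
  "(height has_derivative (\<lambda>v. - 2 * (w \<bullet> v) * (height w)\<^sup>2)) (at w)"
proof -
  have "((\<lambda>w. 1 / (1 + w \<bullet> w)) has_derivative (\<lambda>v. - 2 * (w \<bullet> v) * (1 / (1 + w \<bullet> w))\<^sup>2)) (at w)"
    using one_plus_square_pos[of w] unfolding power2_norm_eq_inner
    by (auto intro!: derivative_eq_intros simp: inner_commute power2_eq_square divide_simps)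
  then show ?thesis by (simp add: height_def[abs_def] power2_norm_eq_inner)
qed

text \<open>In either affine coordinate \<open>w\<close> the components of the embedding are, up to conjugation, sign
  and a constant, \<open>w q\<close> and \<open>q\<close> with \<open>q = 1 / (1 + \<bar>w\<bar>\<^sup>2)\<close>. Since \<open>q \<bar>w\<bar>\<^sup>2 \<le> 1\<close> and \<open>2 q \<bar>w\<bar> \<le> 1\<close>, their derivatives add up to at
  most \<open>4 q \<bar>v\<bar>\<close>, while the metric measures \<open>v\<close> by \<open>2 q \<bar>v\<bar> / sqrt c\<close>.\<close>

lemma to_sphere_lipschitz:
  "\<exists>U. ((to_sphere \<circ> cinv N b) has_derivative U) (at z) \<and>
    (\<forall>v. norm (U v) \<le> 2 * sqrt c * sqrt (metric N b z v v))"
proof -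
  let ?w = "z $ 1"
  define q where "q = height ?w"
  define H where "H v = - 2 * (?w \<bullet> v) * q\<^sup>2" for v
  define G where "G v = ?w * of_real (H v) + v * of_real q" for v
  define S where "S v = (if b then (G v, H v) else (cnj (G v), - H v))" for v
  have q: "0 < q" "q * (1 + (cmod ?w)\<^sup>2) = 1"
    unfolding q_def using height_pos[of ?w] one_plus_square_pos[of ?w] unfolding height_def by auto
  have H: "(height has_derivative H) (at ?w)"
    unfolding H_def[abs_def] q_def by (rule derivative_height)
  have G: "((\<lambda>w. w * of_real (height w)) has_derivative G) (at ?w)"
    unfolding G_def[abs_def] q_def
    using has_derivative_mult[OF has_derivative_ident has_derivative_of_real[OF H]] by simp
  have "((\<lambda>w. to_sphere (affine_line b w)) has_derivative S) (at ?w)"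
  proof (cases b)
    case True
    then show ?thesis
      unfolding to_sphere_affine_line S_def[abs_def] using has_derivative_Pair[OF G H] by simp
  next
    case False
    have "((\<lambda>w. cnj (w * of_real (height w))) has_derivative (\<lambda>v. cnj (G v))) (at ?w)"
      by (rule bounded_linear.has_derivative[OF bounded_linear_cnj G])
    then have "((\<lambda>w. cnj w * of_real (height w)) has_derivative (\<lambda>v. cnj (G v))) (at ?w)" by simp
    moreover have "((\<lambda>w. 1 - height w) has_derivative (\<lambda>v. - H v)) (at ?w)"
      using has_derivative_diff[OF has_derivative_const[of 1] H] by simp
    ultimately show ?thesis
      unfolding to_sphere_affine_line S_def[abs_def] using False has_derivative_Pair by simp
  qed
  then have "((\<lambda>z. to_sphere (affine_line b (z $ 1))) has_derivative (\<lambda>v. S (v $ 1))) (at z)"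
    using has_derivative_compose[OF bounded_linear_imp_has_derivative[OF bounded_linear_nth_1]] by blast
  then have "((to_sphere \<circ> cinv N b) has_derivative (\<lambda>v. S (v $ 1))) (at z)"
    by (simp add: o_def cinv_projective_line)
  moreover have "norm (S (v $ 1)) \<le> 2 * sqrt c * sqrt (metric N b z v v)" for v
  proof -
    let ?v = "v $ 1"
    let ?r = "cmod ?w"
    have qr: "q * ?r\<^sup>2 \<le> 1" "2 * (q * ?r) \<le> 1"
    proof -
      show "q * ?r\<^sup>2 \<le> 1" using q by (simp add: distrib_left)
      have "2 * ?r \<le> 1 + ?r\<^sup>2" using zero_le_power2[of "?r - 1"] by (simp add: power2_diff)
      then have "q * (2 * ?r) \<le> q * (1 + ?r\<^sup>2)" using q(1) by (intro mult_left_mono) auto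
      then show "2 * (q * ?r) \<le> 1" using q(2) by simp
    qed
    have H_le: "\<bar>H ?v\<bar> \<le> 2 * (?r * norm ?v) * q\<^sup>2"
      using Cauchy_Schwarz_ineq2[of ?w ?v] by (simp add: H_def abs_mult mult_right_mono)
    have "norm (S ?v) \<le> norm (G ?v) + \<bar>H ?v\<bar>"
      using norm_Pair_le[of "G ?v" "H ?v"] norm_Pair_le[of "cnj (G ?v)" "- H ?v"] by (simp add: S_def)
    also have "norm (G ?v) \<le> ?r * \<bar>H ?v\<bar> + norm ?v * q"
      unfolding G_def using norm_triangle_ineq[of "?w * of_real (H ?v)" "?v * of_real q"] q(1) by (simp add: norm_mult)
    also have "?r * \<bar>H ?v\<bar> + norm ?v * q + \<bar>H ?v\<bar> \<le>
        ?r * (2 * (?r * norm ?v) * q\<^sup>2) + norm ?v * q + 2 * (?r * norm ?v) * q\<^sup>2"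
      using H_le by (intro add_mono mult_left_mono) auto
    also have "\<dots> = (norm ?v * q) * (2 * (q * ?r\<^sup>2) + 1 + 2 * (q * ?r))"
      by (simp add: power2_eq_square algebra_simps)
    also have "\<dots> \<le> (norm ?v * q) * 4"
      using qr q(1) by (intro mult_left_mono) auto
    also have "\<dots> = 2 * sqrt c * (2 / sqrt c * (norm ?v * q))" using c by simp
    also have "2 / sqrt c * (norm ?v * q) = sqrt (metric N b z v v)"
    proof -
      have "metric N b z v v = (2 / sqrt c * (norm ?v * q))\<^sup>2"
        using conformal_projective_line[of c] c
        by (simp add: conformal_metric_def projective_density_def q_def[symmetric] power_divide
            power_mult_distrib inner_1 power2_norm_eq_inner)
      then show ?thesis using c q(1) by simp
    qed
    finally show ?thesis by simp
  qed
  ultimately show ?thesis by blast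
qed

text \<open>Two points in a common affine chart are joined by a segment; the two poles are joined by a
  meridian.\<close>

lemma meridian:
  fixes a m :: real
  assumes "a = 0 \<and> m = 1 \<or> a = 1 \<and> m = - 1"
  shows "piecewise_C1_curve N (\<lambda>t. homogeneous (of_real (a + m * t), of_real (1 - (a + m * t))))"
proof -
  let ?f = "\<lambda>t. a + m * t"
  let ?Z = "\<lambda>t. (of_real (?f t), of_real (1 - ?f t)) :: complex \<times> complex"
  have Z: "?Z t \<noteq> 0" for t
    by (auto simp: zero_prod_def)
  have "continuous_map (top_of_set {0..1}) (top_of_set (- {0})) ?Z"
    using Z by (auto simp: continuous_map_in_subtopology intro!: continuous_intros)
  from continuous_map_compose[OF this continuous_map_homogeneous]
  have path: "pathin (mtop N) (\<lambda>t. homogeneous (?Z t))" by (simp add: pathin_def o_def)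
  have num: "homogeneous (?Z t) \<in> affine_part b \<longleftrightarrow> (if b then 1 - ?f t else ?f t) \<noteq> 0"
    and coord: "homogeneous (?Z t) \<in> affine_part b \<Longrightarrow>
      affine_coordinate b (homogeneous (?Z t)) = of_real (if b then ?f t / (1 - ?f t) else (1 - ?f t) / ?f t)" for b t
  proof -
    have sq: "0 < (?f t)\<^sup>2 + (1 - ?f t)\<^sup>2" using squares_pos[OF Z[of t]] by (simp del: of_real_add of_real_mult of_real_diff)
    have in_lines: "homogeneous (?Z t) \<in> lines" unfolding lines_def using Z by blast
    show "homogeneous (?Z t) \<in> affine_part b \<longleftrightarrow> (if b then 1 - ?f t else ?f t) \<noteq> 0"
      unfolding affine_part_iff[OF in_lines] to_sphere_homogeneous[OF Z] using sq
      by (auto simp: stereo_def pole_distance_def divide_eq_1_iff simp del: of_real_add of_real_mult of_real_diff)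
    assume "homogeneous (?Z t) \<in> affine_part b"
    then have nz: "(if b then 1 - ?f t else ?f t) \<noteq> 0"
      using \<open>homogeneous (?Z t) \<in> affine_part b \<longleftrightarrow> (if b then 1 - ?f t else ?f t) \<noteq> 0\<close> by blast
    define r where "r = (if b then ?f t / (1 - ?f t) else (1 - ?f t) / ?f t)"
    have "homogeneous (?Z t) = affine_line b (of_real r)"
      unfolding affine_line_def using nz
      by (subst homogeneous_eq_iff[OF Z affine_section_nonzero])
        (auto simp: affine_section_def r_def simp del: of_real_add of_real_mult of_real_diff split: if_splits)
    then show "affine_coordinate b (homogeneous (?Z t)) = of_real (if b then ?f t / (1 - ?f t) else (1 - ?f t) / ?f t)"
      by (simp add: r_def)
  qed
  define d where "d b t = (if b then m / (1 - ?f t)\<^sup>2 else - m / (?f t)\<^sup>2)" for b t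
  have "C1_curve_on N l r (\<lambda>t. homogeneous (?Z t))" for l r
    unfolding C1_curve_on_def projective_line_simps
  proof (intro ballI exI conjI)
    fix b :: bool
    let ?T = "{t \<in> {l..r}. homogeneous (?Z t) \<in> affine_part b}"
    show "continuous_on ?T (\<lambda>t. vec (of_real (d b t)) :: complex^1)"
    proof -
      have "continuous_on ?T (d b)"
        unfolding num d_def by (cases b) (auto intro!: continuous_intros)
      then show ?thesis
        by (intro bounded_linear.continuous_on[OF bounded_linear_vec_1]
            bounded_linear.continuous_on[OF bounded_linear_of_real])
    qed
    fix t assume "t \<in> ?T"
    then have nz: "(if b then 1 - ?f t else ?f t) \<noteq> 0" using num by blast
    have op: "open {t. (if b then 1 - ?f t else ?f t) \<noteq> 0}"
      by (cases b) (auto intro!: open_Collect_neq continuous_intros)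
    have "((\<lambda>t. if b then ?f t / (1 - ?f t) else (1 - ?f t) / ?f t) has_real_derivative d b t) (at t)"
      using nz unfolding d_def
      by (cases b) (auto intro!: derivative_eq_intros simp: power2_eq_square divide_simps algebra_simps)
    then have "((\<lambda>t. if b then ?f t / (1 - ?f t) else (1 - ?f t) / ?f t) has_vector_derivative d b t) (at t)"
      by (simp add: has_real_derivative_iff_has_vector_derivative)
    then have "((\<lambda>t. vec (of_real (if b then ?f t / (1 - ?f t) else (1 - ?f t) / ?f t)) :: complex^1)
        has_vector_derivative vec (of_real (d b t))) (at t)"
      by (intro bounded_linear.has_vector_derivative[OF bounded_linear_vec_1]
          bounded_linear.has_vector_derivative[OF bounded_linear_of_real])
    then have "((cmap N b \<circ> (\<lambda>t. homogeneous (?Z t))) has_vector_derivative vec (of_real (d b t))) (at t)"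
    proof (rule has_vector_derivative_transform_within_open[OF _ op])
      show "t \<in> {t. (if b then 1 - ?f t else ?f t) \<noteq> 0}" using nz by blast
      fix s assume "s \<in> {t. (if b then 1 - ?f t else ?f t) \<noteq> 0}"
      then have part: "homogeneous (?Z s) \<in> affine_part b" using num by blast
      show "vec (of_real (if b then ?f s / (1 - ?f s) else (1 - ?f s) / ?f s)) =
          (cmap N b \<circ> (\<lambda>t. homogeneous (?Z t))) s"
        by (simp only: comp_apply cmap_projective_line[OF part] coord[OF part])
    qed
    then show "((cmap N b \<circ> (\<lambda>t. homogeneous (?Z t))) has_vector_derivative vec (of_real (d b t)))
        (at t within {l..r})"
      by (rule has_vector_derivative_at_within)
  qed
  then show ?thesis using path unfolding piecewise_C1_curve_def by blast
qed

lemma joined_N: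
  assumes "p \<in> lines" "q \<in> lines"
  shows "joined p q"
proof (cases "\<exists>b. p \<in> affine_part b \<and> q \<in> affine_part b")
  case True
  then show ?thesis using joined_in_chart by auto
next
  case False
  obtain Z W where Z: "Z \<noteq> 0" "p = homogeneous Z" and W: "W \<noteq> 0" "q = homogeneous W"
    using assms by (auto simp: lines_def)
  have zero: "homogeneous V \<in> affine_part b \<longleftrightarrow> (if b then snd V else fst V) \<noteq> 0" if "V \<noteq> 0" for V b
    using that squares_pos[OF that] affine_part_iff[of "homogeneous V" b]
    by (auto simp: lines_def to_sphere_homogeneous stereo_def pole_distance_def divide_eq_1_iff)
  have "snd Z = 0 \<or> snd W = 0"
    using False zero[OF Z(1), of True] zero[OF W(1), of True] unfolding Z(2) W(2) if_True by blast
  moreover have "fst Z = 0 \<or> fst W = 0"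
    using False zero[OF Z(1), of False] zero[OF W(1), of False] unfolding Z(2) W(2) if_False by blast
  moreover have "V = 0" if "fst V = 0" "snd V = 0" for V :: "complex \<times> complex"
    using that by (simp add: prod_eq_iff)
  ultimately have "(snd Z = 0 \<and> fst W = 0) \<or> (fst Z = 0 \<and> snd W = 0)"
    using Z(1) W(1) by blast
  then have "\<exists>a m. (a = 0 \<and> m = 1 \<or> a = 1 \<and> m = - 1) \<and>
      p = homogeneous (of_real (a + m * 0), of_real (1 - (a + m * 0))) \<and>
      q = homogeneous (of_real (a + m * 1), of_real (1 - (a + m * 1)))"
  proof
    assume 0: "snd Z = 0 \<and> fst W = 0"
    then have "p = homogeneous (1, 0)" "q = homogeneous (0, 1)"
      using Z W by (auto simp: homogeneous_eq_iff zero_prod_def)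
    then show ?thesis by (intro exI[of _ 1] exI[of _ "- 1"]) simp
  next
    assume 0: "fst Z = 0 \<and> snd W = 0"
    then have "p = homogeneous (0, 1)" "q = homogeneous (1, 0)"
      using Z W by (auto simp: homogeneous_eq_iff zero_prod_def)
    then show ?thesis by (intro exI[of _ 0] exI[of _ 1]) simp
  qed
  then show ?thesis unfolding joined_def using meridian by blast
qed

text \<open>A limit point on the sphere differs from one of the two poles; the affine coordinate centred at the
  other pole is continuous there and pulls the limit back.\<close>

lemma complete_N: "complete_manifold N"
proof (rule complete_manifoldI[where u = to_sphere and K = "2 * sqrt c"])
  show "joined p q" if "p \<in> points N" "q \<in> points N" for p q using that joined_N by simp
  show "0 < 2 * sqrt c" using c by simp
  show "\<exists>U. ((to_sphere \<circ> cinv N b) has_derivative U) (at z) \<and>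
      (\<forall>v. norm (U v) \<le> 2 * sqrt c * sqrt (metric N b z v v))" for b z
    by (rule to_sphere_lipschitz)
  fix \<sigma> :: "nat \<Rightarrow> (complex \<times> complex) set" and y
  assume "range \<sigma> \<subseteq> points N" and lim: "(\<lambda>n. to_sphere (\<sigma> n)) \<longlonglongrightarrow> y"
  then have \<sigma>: "\<sigma> n \<in> lines" for n by auto
  have "closed round_sphere" by (simp add: round_sphere_def)
  then have "y \<in> round_sphere"
    using closed_sequentially[OF _ _ lim] \<sigma> to_sphere_in by blast
  then obtain l where l: "l \<in> lines" "to_sphere l = y"
    using to_sphere_bij by (metis bij_betw_def imageE)
  obtain b where b: "pole_distance b y \<noteq> 0"
    by (metis pole_distance_def diff_zero zero_neq_one)
  have op: "open {y. pole_distance b y \<noteq> 0}"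
    unfolding pole_distance_def by (cases b) (auto intro!: open_Collect_neq continuous_intros)
  have ev: "eventually (\<lambda>n. pole_distance b (to_sphere (\<sigma> n)) \<noteq> 0) sequentially"
    using topological_tendstoD[OF lim op] b by simp
  then have ev': "eventually (\<lambda>n. \<sigma> n \<in> affine_part b) sequentially"
    using affine_part_iff[OF \<sigma>] by simp
  have l_part: "l \<in> affine_part b" using affine_part_iff[OF l(1)] l(2) b by simp
  have "isCont (stereographic b) y"
    using continuous_on_stereographic[of b] b unfolding continuous_on_eq_continuous_at[OF op] by blast
  then have "(\<lambda>n. stereographic b (to_sphere (\<sigma> n))) \<longlonglongrightarrow> stereographic b y"
    using lim by (rule isCont_tendsto_compose)
  then have "(\<lambda>n. vec (affine_coordinate b (\<sigma> n)) :: complex^1) \<longlonglongrightarrow> vec (affine_coordinate b l)"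
    unfolding affine_coordinate_def l(2) by (rule bounded_linear.tendsto[OF bounded_linear_vec_1])
  moreover have "eventually (\<lambda>n. vec (affine_coordinate b (\<sigma> n)) = cmap N b (\<sigma> n)) sequentially"
    using ev' by eventually_elim (simp add: cmap_projective_line)
  ultimately have "(\<lambda>n. cmap N b (\<sigma> n)) \<longlonglongrightarrow> cmap N b l"
    using tendsto_cong unfolding cmap_projective_line[OF l_part] by fastforce
  then show "\<exists>i\<in>charts N. \<exists>l\<in>cdom N i. eventually (\<lambda>n. \<sigma> n \<in> cdom N i) sequentially \<and>
      (\<lambda>n. cmap N i (\<sigma> n)) \<longlonglongrightarrow> cmap N i l"
    using ev' l_part by auto
qed

lemma analytic_N: "real_analytic_metric N"
proof -
  have "analytic_near z (\<lambda>z. projective_density c (z $ 1))" for z :: "complex^1"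
  proof -
    let ?D = "\<lambda>z :: complex^1. 1 + (Re (z $ 1) * Re (z $ 1) + Im (z $ 1) * Im (z $ 1))"
    have "analytic_near z (\<lambda>z. (4 / c) * ((1 / ?D z) * (1 / ?D z)))"
      using one_plus_square_pos[of "z $ 1"] unfolding one_plus_square
      by (intro analytic_near_mult analytic_near_inverse analytic_near_add analytic_near_const
          analytic_near_Re analytic_near_Im) auto
    then show ?thesis
      unfolding projective_density_def height_def one_plus_square by (simp add: power2_eq_square)
  qed
  then show ?thesis
    using conformal_projective_line[of c] unfolding real_analytic_metric_def conformal_metric_def
    by (auto intro!: real_analytic_onI analytic_near_mult analytic_near_const)
qed

end

section \<open>The rotation of the projective line\<close>

text \<open>Rotating \<open>z\<^sub>0\<close> multiplies the coordinate \<open>z\<^sub>0 / z\<^sub>1\<close> by the phase and \<open>z\<^sub>1 / z\<^sub>0\<close> by its inverse.\<close>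

definition affine_rotation :: "bool \<Rightarrow> complex \<Rightarrow> complex \<Rightarrow> complex" where
  "affine_rotation b u w = (if b then u else inverse u) * w"

lemma projective_rotation_homogeneous:
  "projective_rotation a (homogeneous (z0, z1)) = homogeneous (unit_phase a * z0, z1)"
  by (auto simp: projective_rotation_def homogeneous_def image_iff mult.left_commute)

lemma projective_rotation_affine_line:
  "projective_rotation a (affine_line b w) = affine_line b (affine_rotation b (unit_phase a) w)"
proof (cases b)
  case True
  then show ?thesis
    by (simp add: affine_line_def affine_section_def projective_rotation_homogeneous affine_rotation_def)
next
  case False
  have "homogeneous (unit_phase a, w) = homogeneous (1, inverse (unit_phase a) * w)"
    by (subst homogeneous_eq_iff) (auto simp: zero_prod_def)
  then show ?thesis using False
    by (simp add: affine_line_def affine_section_def projective_rotation_homogeneous affine_rotation_def)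
qed

lemma projective_rotation_in: "p \<in> lines \<Longrightarrow> projective_rotation a p \<in> lines"
  and to_sphere_projective_rotation: "p \<in> lines \<Longrightarrow>
    to_sphere (projective_rotation a p) = (unit_phase a * fst (to_sphere p), snd (to_sphere p))"
proof -
  assume "p \<in> lines"
  then obtain z0 z1 where Z: "(z0, z1) \<noteq> 0" "p = homogeneous (z0, z1)" by (auto simp: lines_def)
  have W: "(unit_phase a * z0, z1) \<noteq> 0" using Z(1) by (auto simp: zero_prod_def)
  show "projective_rotation a p \<in> lines"
    unfolding Z(2) projective_rotation_homogeneous lines_def using W by blast
  show "to_sphere (projective_rotation a p) = (unit_phase a * fst (to_sphere p), snd (to_sphere p))"
    unfolding Z(2) projective_rotation_homogeneous to_sphere_homogeneous[OF W] to_sphere_homogeneous[OF Z(1)]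
    by (simp add: stereo_def norm_mult mult.assoc)
qed

lemma projective_rotation_affine_part:
  "p \<in> lines \<Longrightarrow> projective_rotation a p \<in> affine_part b \<longleftrightarrow> p \<in> affine_part b"
  by (simp add: affine_part_iff projective_rotation_in to_sphere_projective_rotation pole_distance_def)

lemma lines_eqI: "p \<in> lines \<Longrightarrow> q \<in> lines \<Longrightarrow> to_sphere p = to_sphere q \<Longrightarrow> p = q"
  using to_sphere_bij by (auto simp: bij_betw_def dest: inj_onD)

lemma projective_rotation_fixed_iff:
  assumes "p \<in> lines"
  shows "projective_rotation a p = p \<longleftrightarrow> a = 0 \<or> fst (to_sphere p) = 0"
proof -
  have "projective_rotation a p = p \<longleftrightarrow> unit_phase a * fst (to_sphere p) = fst (to_sphere p)"
    using lines_eqI[OF projective_rotation_in[OF assms, of a] assms]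
    by (metis fst_conv prod.collapse to_sphere_projective_rotation[OF assms])
  also have "\<dots> \<longleftrightarrow> (unit_phase a - 1) * fst (to_sphere p) = 0" by (simp add: algebra_simps)
  finally show ?thesis by (simp add: unit_phase_eq_1_iff)
qed

lemma continuous_map_projective_rotation:
  "continuous_map (prod_topology euclidean line_topology) line_topology
    (\<lambda>(t, p). projective_rotation (abs_torus t) p)"
proof (rule continuous_map_into_lines)
  let ?f = "\<lambda>(t :: real^1, y :: complex \<times> real). (unit_phase (abs_torus t) * fst y, snd y)"
  have "continuous_map (prod_topology euclidean line_topology) (prod_topology euclidean euclidean)
      (\<lambda>(t :: real^1, p). (t, to_sphere p))"
    unfolding continuous_map_prod_top using continuous_map_to_sphere by simp
  moreover have "continuous_map (prod_topology euclidean euclidean) euclidean ?f"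
    unfolding prod_topology_euclidean case_prod_unfold
    by (auto intro!: continuous_intros continuous_on_compose2[OF continuous_phase[of UNIV]])
  ultimately have "continuous_map (prod_topology euclidean line_topology) euclidean (?f \<circ> (\<lambda>(t, p). (t, to_sphere p)))"
    by (rule continuous_map_compose)
  then show "continuous_map (prod_topology euclidean line_topology) euclidean
      (to_sphere \<circ> (\<lambda>(t, p). projective_rotation (abs_torus t) p))"
    by (rule continuous_map_eq) (auto simp: to_sphere_projective_rotation)
qed (auto simp: projective_rotation_in)

context round_projective_line
begin

lemma local_rotation:
  assumes "affine_line b (z $ 1) \<in> affine_part b'"
  shows "cmap N b' (projective_rotation a (cinv N b z)) =
    vec (if b = b' then affine_rotation b (unit_phase a) (z $ 1) else inverse (affine_rotation b (unit_phase a) (z $ 1)))"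
proof -
  have "projective_rotation a (affine_line b (z $ 1)) \<in> affine_part b'"
    using assms by (simp add: projective_rotation_affine_part affine_line_in)
  note part = this[unfolded projective_rotation_affine_line]
  have "affine_rotation b (unit_phase a) (z $ 1) \<noteq> 0" if "b \<noteq> b'"
    using assms that by (simp add: affine_line_in_other affine_rotation_def)
  then show ?thesis
    unfolding cinv_projective_line projective_rotation_affine_line cmap_projective_line[OF part]
    by (cases "b = b'") (simp_all add: affine_coordinate_other)
qed

lemma torus_action_N: "torus_action N projective_rotation"
proof -
  have "smooth_on (\<lambda>(t, z). cmap N b' (projective_rotation (abs_torus t) (cinv N b z)))
          {(t, z). z \<in> cimage N b \<and> projective_rotation (abs_torus t) (cinv N b z) \<in> cdom N b'}" for b b'
  proof -
    let ?S = "{x :: (real^1) \<times> (complex^1). b = b' \<or> snd x $ 1 \<noteq> 0}"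
    let ?r = "\<lambda>x :: (real^1) \<times> (complex^1). affine_rotation b (unit_phase (abs_torus (fst x))) (snd x $ 1)"
    have S: "{(t, z). z \<in> cimage N b \<and> projective_rotation (abs_torus t) (cinv N b z) \<in> cdom N b'} = ?S"
      by (auto simp: cinv_projective_line projective_rotation_affine_part affine_line_in affine_line_in_other)
    have "open {x :: (real^1) \<times> (complex^1). snd x $ 1 \<noteq> 0}"
      by (intro open_Collect_neq continuous_intros)
    then have op: "open ?S" by (cases "b = b'") simp_all
    have r: "smooth_on ?r ?S"
      using smooth_on_phase[OF op] by (cases b) (simp_all add: affine_rotation_def)
    have "smooth_on (\<lambda>x. if b = b' then ?r x else inverse (?r x)) ?S"
    proof (cases "b = b'")
      case False
      then show ?thesis
        using smooth_on_inverse'[OF op r] by (simp add: affine_rotation_def)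
    qed (use r in simp)
    then have "smooth_on (\<lambda>x. vec (if b = b' then ?r x else inverse (?r x)) :: complex^1) ?S"
      by (rule smooth_on_compose_linear[OF op bounded_linear_vec_1])
    moreover have "(case x of (t, z) \<Rightarrow> cmap N b' (projective_rotation (abs_torus t) (cinv N b z))) =
        vec (if b = b' then ?r x else inverse (?r x))" if "x \<in> ?S" for x
      using that by (cases x) (simp add: local_rotation affine_line_in_other)
    ultimately show ?thesis unfolding S by (subst smooth_on_cong[OF op])
  qed
  moreover have "projective_rotation 0 p = p" "projective_rotation (a + b) p = projective_rotation a (projective_rotation b p)"
    if "p \<in> lines" for a b p
    by (rule lines_eqI; use that in \<open>simp add: projective_rotation_in to_sphere_projective_rotation
        unit_phase_add mult.assoc\<close>)+
  ultimately show ?thesis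
    using continuous_map_projective_rotation by (simp add: torus_action_def projective_rotation_in)
qed

lemma free_points_N: "free_points N projective_rotation = {p \<in> lines. fst (to_sphere p) \<noteq> 0}"
  using nontrivial_torus by (auto simp: free_points_def projective_rotation_fixed_iff)

lemma fst_to_sphere_affine_line: "fst (to_sphere (affine_line b w)) = 0 \<longleftrightarrow> w = 0"
  using height_pos[of w] by (simp add: to_sphere_affine_line)

lemma effective_N: "effective_action N projective_rotation"
proof -
  have "fst (to_sphere (affine_line True 1)) \<noteq> 0" by (simp add: fst_to_sphere_affine_line)
  then show ?thesis
    unfolding effective_action_def using projective_rotation_fixed_iff affine_line_in by (metis projective_line_simps(1) topspace_line_topology)
qed

lemma rotation_holomorphic_isometric:
  "holomorphic_map N N (projective_rotation a)" "isometric_map N N (projective_rotation a)"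
proof -
  let ?\<rho> = "\<lambda>_ :: bool. projective_density c"
  have "continuous_map line_topology line_topology (projective_rotation a)"
  proof -
    obtain t where t: "abs_torus t = a" using Quotient_abs_rep[OF Quotient_torus] by blast
    have "continuous_map line_topology (prod_topology euclidean line_topology) (\<lambda>p. (t, p))"
      by (intro continuous_map_pairedI) auto
    from continuous_map_compose[OF this continuous_map_projective_rotation] show ?thesis
      by (simp add: o_def t)
  qed
  then have cont: "continuous_map (mtop N) (mtop N) (projective_rotation a)" by simp
  have conf: "conformal_isometry_at ?\<rho> ?\<rho> b b' (local_rep N N (projective_rotation a) b b') z"
    if z: "z \<in> rep_domain N N (projective_rotation a) b b'" for b b' z
  proof -
    let ?\<Omega> = "rep_domain N N (projective_rotation a) b b'"
    define u where "u = (if b then unit_phase a else inverse (unit_phase a))"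
    have u: "cmod u = 1" "u \<noteq> 0" by (simp_all add: u_def norm_inverse)
    have op: "open ?\<Omega>" by (rule rep_domain_open) (simp_all add: openin_affine_part continuous_map_projective_rotation cont[simplified])
    have part: "affine_line b (z $ 1) \<in> affine_part b'" if "z \<in> ?\<Omega>" for z
      using rep_domainD(3)[OF _ that] by (simp add: cinv_projective_line projective_rotation_affine_part affine_line_in)
    have rep: "local_rep N N (projective_rotation a) b b' z = vec (if b = b' then u * z $ 1 else inverse (u * z $ 1))"
      if "z \<in> ?\<Omega>" for z
      using local_rotation[OF part[OF that]] by (simp add: local_rep_def affine_rotation_def u_def)
    have dens: "projective_density c (u * w) = projective_density c w" for w
      by (simp add: projective_density_def height_def norm_mult u)
    show ?thesis
    proof (cases "b = b'")
      case True
      show ?thesis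
        by (rule conformal_isometry_atI[OF op z, where g = "\<lambda>w. u * w" and a = u])
          (use True rep dens u in \<open>auto intro!: derivative_eq_intros\<close>)
    next
      case False
      let ?w = "u * z $ 1"
      have w: "?w \<noteq> 0" using part[OF z] False u by (simp add: affine_line_in_other)
      have D: "((\<lambda>w. inverse (u * w)) has_field_derivative - (inverse ?w * inverse ?w) * u) (at (z $ 1))"
        by (rule DERIV_chain2[of inverse _ "\<lambda>w. u * w", OF derivative_inverse[OF w]]) (auto intro!: derivative_eq_intros)
      show ?thesis
        by (rule conformal_isometry_atI[OF op z _ D])
          (use False rep projective_density_inverse[OF w, of c] dens u in \<open>simp_all add: norm_mult\<close>)
    qed
  qed
  show "holomorphic_map N N (projective_rotation a)" "isometric_map N N (projective_rotation a)"
    using conformal_holomorphic_isometric_map[OF _ conformal_projective_line cont conf]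
      conformal_projective_line[of c] by (simp_all add: conformal_metric_def)
qed

text \<open>On the free part both affine coordinates are global; the exponential map covers it in the
  coordinate \<open>z\<^sub>0 / z\<^sub>1\<close>.\<close>

lemma exponential_covering_N:
  "exponential_covering c 1 1 (open_submanifold N (free_points N projective_rotation)) (- {0})
    (affine_coordinate True) (\<lambda>b w. if b then w else inverse w)
    (\<lambda>b w. if b then 1 else - (inverse w * inverse w)) (\<lambda>_. projective_density c)"
proof -
  let ?F = "free_points N projective_rotation"
  have in_F: "affine_line b w \<in> ?F \<longleftrightarrow> w \<noteq> 0" for b w
    by (simp add: free_points_N affine_line_in fst_to_sphere_affine_line)
  have F_part: "p \<in> affine_part b" if p: "p \<in> ?F" for p b
  proof -
    have p': "p \<in> lines" "fst (to_sphere p) \<noteq> 0" using p by (simp_all add: free_points_N)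
    have "(cmod (fst (to_sphere p)))\<^sup>2 = snd (to_sphere p) * (1 - snd (to_sphere p))"
      using to_sphere_in[OF p'(1)] round_sphere_iff[of "fst (to_sphere p)" "snd (to_sphere p)"] by simp
    then show ?thesis using p' by (auto simp: affine_part_iff pole_distance_def)
  qed
  have inter: "affine_part b \<inter> ?F = ?F" for b using F_part by blast
  have points: "points (open_submanifold N ?F) = ?F"
    by (auto simp: open_submanifold_def free_points_N)
  have line: "\<exists>w. w \<noteq> 0 \<and> p = affine_line True w" if "p \<in> ?F" for p
    using F_part[OF that, of True] in_F that by (auto simp: affine_part_def)
  show ?thesis
  proof (unfold_locales, goal_cases)
    case 2
    have "exp ` UNIV = (- {0} :: complex set)" using exp_UNIV by auto
    then show ?case using c by (simp add: model_set_def)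
  next
    case 3
    have "{w. affine_line True w \<in> ?F} = - {0}" by (auto simp: in_F)
    then show ?case
      using homeomorphic_map_affine_coordinate[of True ?F] by (simp add: inter open_submanifold_def)
  next
    case (4 b)
    then show ?case using inter[of b] points by (simp add: open_submanifold_def)
  next
    case (5 b p)
    then have p: "p \<in> ?F" using points by simp
    then obtain w where w: "w \<noteq> 0" "p = affine_line True w" using line by blast
    have "cmap (open_submanifold N ?F) b p = vec (affine_coordinate b p)"
      using cmap_projective_line[OF F_part[OF p]] by (simp add: open_submanifold_def)
    then show ?case using w by (auto simp: affine_coordinate_other)
  next
    case (6 b)
    show ?case by (auto simp: inj_on_def)
  next
    case (7 b w)
    then show ?case using derivative_inverse[of w] by (cases b) auto
  next
    case 9
    show ?case using conformal_projective_line by (simp add: conformal_metric_def open_submanifold_def)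
  next
    case (10 b z w)
    have w: "w \<noteq> 0" "cmod w = exp (Re z)" using 10 by auto
    define e where "e = exp (Re z)"
    have e: "e > 0" "exp (- Re z) = 1 / e" by (simp_all add: e_def exp_minus divide_inverse)
    have "projective_density c (if b then w else inverse w) *
        (cmod (if b then 1 else - (inverse w * inverse w)))\<^sup>2 = projective_density c w"
      using projective_density_inverse[OF w(1), of c] by (cases b) simp_all
    then have "projective_density c (if b then w else inverse w) *
        (cmod (if b then 1 else - (inverse w * inverse w)) * (1 * cmod w))\<^sup>2 = projective_density c w * e\<^sup>2"
      by (simp add: power_mult_distrib w(2) e_def mult.assoc[symmetric])
    also have "\<dots> = 1 / (c * ((1 + e\<^sup>2) / (2 * e))\<^sup>2)"
      using e(1) by (simp add: projective_density_def height_def w(2) e_def[symmetric] power_divide power_mult_distrib)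
    also have "(1 + e\<^sup>2) / (2 * e) = cosh (Re z)"
      using e(1) by (simp add: cosh_def e(2) e_def[symmetric] power2_eq_square divide_simps)
    finally show ?case using c by (simp add: model_metric_def)
  qed auto
qed

lemma regular_torification_projective_line: "regular_torification (model c) N projective_rotation"
proof -
  have "projective_rotation a p \<in> free_points N projective_rotation \<and>
      affine_coordinate True (projective_rotation a p) = unit_phase a * affine_coordinate True p"
    if "p \<in> free_points N projective_rotation" for a p
    using that
    by (simp add: free_points_N projective_rotation_in to_sphere_projective_rotation
        affine_coordinate_def stereographic_def pole_distance_def)
  then have "torification (model c) N projective_rotation"
    by (intro torificationI[OF kaehler_N _ torus_action_N effective_N rotation_holomorphic_isometric
          exponential_covering_N]) (simp_all add: connected_lines)
  then show ?thesis
    unfolding regular_torification_def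
    using connected_lines simply_connected_lines complete_N analytic_N by simp
qed

end

section \<open>The space forms as torifications\<close>

theorem proposition3p3:
  fixes c :: real
  shows "(c < 0 \<longrightarrow> regular_torification (model c) (disc c) rotation) \<and>
         (c = 0 \<longrightarrow> regular_torification (model c) complex_plane rotation) \<and>
         (c > 0 \<longrightarrow> regular_torification (model c) (projective_line c) projective_rotation)"
  using regular_torification_disc regular_torification_plane
    round_projective_line.regular_torification_projective_line[OF round_projective_line.intro]
  by blast

end
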